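(* There exists an absolute constant $C>0$ (independent of the dimension) and, for every integer $d\ge2$, a constant $b_d>0$ depending only on $d$, such that for every integer $d\ge2$ and every $0<\delta<1$, $$ b_d\,\delta^{-2+\frac2{d+1}}\;\le\; N(d,\delta)\;\le\;\max\Big\{100d,\ \ C\,d^{\alpha}\,\delta^{-2+\frac2{d+1}}\Big(1+\log d+\log\tfrac1\delta\Big)^{\frac d{d+1}}\Big\},$$ where $\alpha=\frac52-\frac2{d+1}$. Here $N(d,\delta)$ is the minimal integer $N$ for which there exists an $N$-point set $Z\subset\mathbb S^d$ such that the sign-linear map $\varphi_Z:\mathbb S^d\to\{-1,+1\}^N$ satisfies $\delta$-RIP.
   Context: $\mathbb S^d\subset\mathbb R^{d+1}$ is the unit sphere, with normalized geodesic distance $d(x,y)=\frac{1}{\pi}\arccos(x\cdot y)$ (antipodal points are at distance $1$). The Hamming cube $H^N=\{-1,+1\}^N$ carries the metric $d_H(s,t)=\frac1N\#\{1\le j\le N: s_j\ne t_j\}$. For an $N$-point set $Z=\{z_1,\dots,z_N\}\subset\mathbb S^d$, the sign-linear map is $\varphi_Z(x)=(\mathrm{sgn}(z_j\cdot x))_{j=1}^N$, with the convention $\mathrm{sgn}(t)=+1$ for $t\ge0$ and $\mathrm{sgn}(t)=-1$ for $t<0$. A map $\varphi:\mathbb S^d\to H^N$ satisfies $\delta$-RIP (restricted isometric property), for $0<\delta<1$, if $$\sup_{x,y\in\mathbb S^d}\big|d_H(\varphi(x),\varphi(y))-d(x,y)\big|<\delta.$$ *)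

theory Defs
  imports "HOL-Analysis.Analysis"
begin

(* The dimension is quantified inside the theorem, so points of R^(d+1) are functions
   nat => real with coordinates 0, ..., d and zero elsewhere, as in the library's nsphere. *)

abbreviation unit_sphere :: "nat \<Rightarrow> (nat \<Rightarrow> real) set" where
  "unit_sphere d \<equiv> topspace (nsphere d)"

definition sdot :: "nat \<Rightarrow> (nat \<Rightarrow> real) \<Rightarrow> (nat \<Rightarrow> real) \<Rightarrow> real" where
  "sdot d x y = (\<Sum>i\<le>d. x i * y i)"

definition geo_dist :: "nat \<Rightarrow> (nat \<Rightarrow> real) \<Rightarrow> (nat \<Rightarrow> real) \<Rightarrow> real" where
  "geo_dist d x y = arccos (sdot d x y) / pi"

definition hamming_cube :: "nat \<Rightarrow> (nat \<Rightarrow> int) set" where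
  "hamming_cube N = {1..N} \<rightarrow>\<^sub>E {-1, 1}"

definition hamming_dist :: "nat \<Rightarrow> (nat \<Rightarrow> int) \<Rightarrow> (nat \<Rightarrow> int) \<Rightarrow> real" where
  "hamming_dist N s t = real (card {j \<in> {1..N}. s j \<noteq> t j}) / real N"

(* Unlike the library's sgn, this takes the value 1 at 0. *)
definition sgn_plus :: "real \<Rightarrow> int" where
  "sgn_plus t = (if t \<ge> 0 then 1 else -1)"

definition sign_linear_map ::
    "nat \<Rightarrow> nat \<Rightarrow> (nat \<Rightarrow> nat \<Rightarrow> real) \<Rightarrow> (nat \<Rightarrow> real) \<Rightarrow> (nat \<Rightarrow> int)" where
  "sign_linear_map d N z x = (\<lambda>j\<in>{1..N}. sgn_plus (sdot d (z j) x))"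

(* The supremum is over a nonempty family of values in [0,1], so the real SUP is the
   genuine supremum. *)
definition RIP :: "nat \<Rightarrow> nat \<Rightarrow> real \<Rightarrow> ((nat \<Rightarrow> real) \<Rightarrow> (nat \<Rightarrow> int)) \<Rightarrow> bool" where
  "RIP d N \<delta> \<phi> \<longleftrightarrow>
     \<phi> \<in> unit_sphere d \<rightarrow> hamming_cube N \<and>
     (SUP (x, y) \<in> unit_sphere d \<times> unit_sphere d.
        \<bar>hamming_dist N (\<phi> x) (\<phi> y) - geo_dist d x y\<bar>) < \<delta>"

(* An N-point set Z is given by an injective enumeration z 1, ..., z N. *)
definition sign_linear_RIP :: "nat \<Rightarrow> real \<Rightarrow> nat \<Rightarrow> bool" where
  "sign_linear_RIP d \<delta> N \<longleftrightarrow>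
     (\<exists>Z z. Z \<subseteq> unit_sphere d \<and> bij_betw z {1..N} Z \<and> RIP d N \<delta> (sign_linear_map d N z))"

(* Meaningful only if some N satisfies the predicate. *)
definition min_N :: "nat \<Rightarrow> real \<Rightarrow> nat" where
  "min_N d \<delta> = (LEAST N. sign_linear_RIP d \<delta> N)"

end

(*
  Both bounds work with a standard Gaussian vector z in R^(d+1), whose direction is uniform on the
  sphere.  Rotation invariance makes the measure of the wedge {z : sgn(z.x) ~= sgn(z.y)} additive in
  the angle between x and y, hence equal to the normalized geodesic distance.

  Upper bound (jittered sampling).  In the projective coordinates u = z / z_k, where |z_k| is the
  largest coordinate, cut each face [-1,1]^d of the cube into columns over a grid of mesh about
  N^(-1/d) in d - 1 of the coordinates, string all columns together and cut the string into N pieces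
  of mass 1/N.  Apart from the few pieces that meet two columns, each piece has diameter
  O(sqrt d N^(-1/d)), so only O(d^(3/2) N^(1-1/d)) pieces cross the boundary of a given wedge.  One
  independent random point per piece, Hoeffding's inequality and a union bound over a finite set of
  brackets for wedges give the estimate.

  Lower bound.  The mean square over x, y of the discrepancy is an energy difference for the kernel
  (2/pi arcsin t)^2 = sum_k a_k t^(2k+2), where a_k is at least of order k^(-3/2).  For every power
  t^m the energy of an N-point set is at least the energy c_m of the uniform measure, since the
  difference is a squared norm of a tensor; by the diagonal terms it is also at least 1/N.  As c_2k
  is of order at most k^(-d/2), each k of order at least N^(2/d) contributes a_k/(2N), and summing
  over one dyadic block of such k gives a mean square of order N^(-1-1/d).
*)
theory Submission
  imports Defs "HOL-Probability.Probability"
begin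

section \<open>Equal mass pieces and jittered sampling\<close>

text \<open>Only pieces that cross a wedge add randomness, so a count deviates by about the square
  root of N^(1-1/d) instead of the square root of N. Setting this equal to \<delta> N gives
  N^(1+1/d) of order \<delta>^(-2), the relation that the lower bound also produces; the power
  d/(d+1) then yields the exponent -2 + 2/(d+1). In the upper bound the crossing estimate
  contributes d^(3/2) and the union bound another d times a logarithm; the power d/(d+1) turns
  d^(5/2) into d^(5/2 - 5/(2(d+1))), which is at most d^\<alpha>. The obstacle is that the pieces
  must have mass exactly 1/N, since a piece inside a wedge may contribute no error at all, while a
  partition into equal pieces that are all small is laborious to construct. Cutting a string of
  columns gets the masses right by the intermediate value theorem, and the few pieces that are not
  small are simply counted as crossing. The coordinates z / z_k do not distinguish z from -z. This
  is harmless: off the hyperplanes orthogonal to x and y, a wedge is symmetric under z ->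
  -z.\<close>

lemma indep_vars_PiM_components:
  assumes "finite I" "I \<noteq> {}" and M: "\<And>i. i \<in> I \<Longrightarrow> prob_space (N i)"
  shows "prob_space.indep_vars (PiM I N) N (\<lambda>i \<omega>. \<omega> i) I"
proof -
  interpret P: prob_space "PiM I N" by (intro prob_space_PiM M)
  have "distr (PiM I N) (PiM I N) (\<lambda>x. \<lambda>i\<in>I. x i) = distr (PiM I N) (PiM I N) (\<lambda>x. x)"
    by (intro distr_cong) (auto simp: space_PiM PiE_def extensional_restrict)
  also have "\<dots> = PiM I N" by (rule distr_id)
  also have "\<dots> = (\<Pi>\<^sub>M i\<in>I. distr (PiM I N) (N i) (\<lambda>\<omega>. \<omega> i))"
    using M by (intro PiM_cong) (auto simp: distr_PiM_component)
  finally show ?thesis using assms by (subst P.indep_vars_iff_distr_eq_PiM') auto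
qed

text \<open>A piece inside E or disjoint from E contributes exactly its share
  \<open>real N * prob (P i \<inter> E)\<close> to the count, so the deviation comes from the
  crossing pieces alone. Hoeffding's inequality therefore sees at most K summands instead of N, and
  a union bound over \<E> finishes.\<close>

lemma (in prob_space) jittered_sampling:
  fixes N :: nat and P :: "nat \<Rightarrow> 'a set"
  assumes N: "N \<ge> 1"
    and P: "\<And>i. i \<in> {1..N} \<Longrightarrow> P i \<in> events" "\<And>i. i \<in> {1..N} \<Longrightarrow> prob (P i) = 1 / real N"
    and disj: "disjoint_family_on P {1..N}"
    and fin: "finite \<E>" and E: "\<And>E. E \<in> \<E> \<Longrightarrow> E \<in> events"
    and crossing: "\<And>E. E \<in> \<E> \<Longrightarrow> real (card {i \<in> {1..N}. P i \<inter> E \<noteq> {} \<and> \<not> P i \<subseteq> E}) \<le> K"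
    and K: "K > 0" and \<epsilon>: "\<epsilon> > 0" and small: "real (card \<E>) * (2 * exp (- 2 * \<epsilon>\<^sup>2 / K)) < 1"
  shows "\<exists>z. (\<forall>i\<in>{1..N}. z i \<in> P i) \<and> (\<forall>E\<in>\<E>. \<bar>real (card {i \<in> {1..N}. z i \<in> E}) - real N * prob E\<bar> < \<epsilon>)"
proof -
  define U where "U i = uniform_measure M (P i)" for i
  have Up: "prob_space (U i)" if "i \<in> {1..N}" for i
    unfolding U_def using P(2)[OF that] N by (intro prob_space_uniform_measure) (auto simp: emeasure_eq_measure)
  define \<Omega> where "\<Omega> = PiM {1..N} U"
  interpret \<Omega>: prob_space \<Omega> unfolding \<Omega>_def by (intro prob_space_PiM Up)
  have sU: "sets (U i) = events" for i by (simp add: U_def)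
  have proj: "(\<lambda>\<omega>. \<omega> i) \<in> measurable \<Omega> (U i)" if "i \<in> {1..N}" for i
    unfolding \<Omega>_def using that by measurable
  have Um: "measure (U i) E = real N * prob (P i \<inter> E)" if "i \<in> {1..N}" "E \<in> events" for i E
    unfolding U_def using that P N by (subst measure_uniform_measure) (auto simp: emeasure_eq_measure)
  define X where "X E i \<omega> = (indicator E (\<omega> i) :: real)" for E i and \<omega> :: "nat \<Rightarrow> 'a"
  have Xm: "X E i \<in> borel_measurable \<Omega>" if "i \<in> {1..N}" "E \<in> events" for E i
  proof -
    have "indicator E \<in> borel_measurable (U i)" by (intro borel_measurable_indicator) (simp add: sU that)
    from measurable_compose[OF proj[OF that(1)] this] show ?thesis unfolding X_def .
  qed
  have expX: "\<Omega>.expectation (X E i) = real N * prob (P i \<inter> E)" if i: "i \<in> {1..N}" and E: "E \<in> events" for E i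
  proof -
    have "\<Omega>.expectation (X E i) = (\<integral>x. indicator E x \<partial>distr \<Omega> (U i) (\<lambda>\<omega>. \<omega> i))"
      unfolding X_def using proj[OF i]
      by (subst integral_distr) (auto intro!: borel_measurable_indicator simp: sU E)
    also have "distr \<Omega> (U i) (\<lambda>\<omega>. \<omega> i) = U i"
      unfolding \<Omega>_def using i Up by (intro distr_PiM_component) auto
    also have "(\<integral>x. indicator E x \<partial>U i) = measure (U i) E"
      using E sU sets.sets_into_space[OF E] by (simp add: U_def Int_absorb2)
    finally show ?thesis using Um i E by simp
  qed
  define C where "C E = {i \<in> {1..N}. P i \<inter> E \<noteq> {} \<and> \<not> P i \<subseteq> E}" for E
  define B where "B E = {\<omega> \<in> space \<Omega>. \<bar>(\<Sum>i\<in>C E. X E i \<omega>) - (\<Sum>i\<in>C E. \<Omega>.expectation (X E i))\<bar> \<ge> \<epsilon>}" for E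
  have CN: "C E \<subseteq> {1..N}" for E by (auto simp: C_def)
  have Bm: "B E \<in> sets \<Omega>" if "E \<in> \<E>" for E
  proof -
    have [measurable]: "i \<in> C E \<Longrightarrow> X E i \<in> borel_measurable \<Omega>" for i using Xm CN E that by blast
    show ?thesis unfolding B_def by measurable
  qed
  have BP: "\<Omega>.prob (B E) \<le> 2 * exp (- 2 * \<epsilon>\<^sup>2 / K)" if EE: "E \<in> \<E>" for E
  proof (cases "C E = {}")
    case True
    then have "B E = {}" using \<epsilon> by (auto simp: B_def)
    then show ?thesis by simp
  next
    case False
    have finC: "finite (C E)" using CN finite_subset by blast
    have "\<Omega>.indep_vars U (\<lambda>i \<omega>. \<omega> i) {1..N}"
      unfolding \<Omega>_def using N Up by (intro indep_vars_PiM_components) auto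
    then have "\<Omega>.indep_vars U (\<lambda>i \<omega>. \<omega> i) (C E)" using CN by (rule \<Omega>.indep_vars_subset)
    then have ind: "\<Omega>.indep_vars (\<lambda>_. borel) (X E) (C E)"
      unfolding X_def by (rule \<Omega>.indep_vars_compose2) (intro borel_measurable_indicator, simp add: sU E[OF EE])
    interpret H: Hoeffding_ineq \<Omega> "C E" "X E" "\<lambda>_. 0" "\<lambda>_. 1" "\<Sum>i\<in>C E. \<Omega>.expectation (X E i)"
    proof unfold_locales
      show "finite (C E)" by (rule finC)
      show "\<Omega>.indep_vars (\<lambda>_. borel) (X E) (C E)" by (rule ind)
      show "AE x in \<Omega>. X E i x \<in> {0..1}" for i by (simp add: X_def indicator_def)
    qed
    have cpos: "real (card (C E)) > 0" using finC False by (simp add: card_gt_0_iff)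
    have "\<Omega>.prob (B E) \<le> 2 * exp (-2 * \<epsilon>\<^sup>2 / (\<Sum>i\<in>C E. (1 - 0)\<^sup>2))"
      unfolding B_def using \<epsilon> cpos by (intro H.Hoeffding_ineq_abs_ge) auto
    also have "\<dots> = 2 * exp (- (2 * \<epsilon>\<^sup>2 / real (card (C E))))" by simp
    also have "\<dots> \<le> 2 * exp (- (2 * \<epsilon>\<^sup>2 / K))"
    proof -
      have "real (card (C E)) \<le> K" unfolding C_def by (rule crossing[OF EE])
      then have "2 * \<epsilon>\<^sup>2 / K \<le> 2 * \<epsilon>\<^sup>2 / real (card (C E))"
        using cpos by (intro divide_left_mono mult_pos_pos) auto
      then show ?thesis by simp
    qed
    finally show ?thesis by simp
  qed
  have "\<Omega>.prob (\<Union>E\<in>\<E>. B E) \<le> (\<Sum>E\<in>\<E>. \<Omega>.prob (B E))"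
    using fin Bm by (intro \<Omega>.finite_measure_subadditive_finite) auto
  also have "\<dots> \<le> (\<Sum>E\<in>\<E>. 2 * exp (- 2 * \<epsilon>\<^sup>2 / K))" by (intro sum_mono BP)
  also have "\<dots> < 1" using small by simp
  finally have less: "\<Omega>.prob (\<Union>E\<in>\<E>. B E) < 1" .
  \<comment> \<open>\<open>\<Omega>\<close> lives on the full product space, so the coordinates fall
    into their pieces only almost surely. A sample that has this property and avoids every
    \<open>B E\<close> exists because the bad events have total probability below 1.\<close>
  have AEP: "AE \<omega> in \<Omega>. \<forall>i\<in>{1..N}. \<omega> i \<in> P i"
  proof (intro AE_finite_allI)
    fix i assume i: "i \<in> {1..N}"
    have "AE x in U i. x \<in> P i" unfolding U_def using P(1)[OF i] by (intro AE_uniform_measureI) auto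
    then show "AE \<omega> in \<Omega>. \<omega> i \<in> P i"
      unfolding \<Omega>_def using i Up by (intro AE_PiM_component) auto
  qed simp
  have "\<exists>\<omega>\<in>space \<Omega>. (\<forall>i\<in>{1..N}. \<omega> i \<in> P i) \<and> \<omega> \<notin> (\<Union>E\<in>\<E>. B E)"
  proof (rule ccontr)
    assume c: "\<not> ?thesis"
    have "AE \<omega> in \<Omega>. \<omega> \<in> (\<Union>E\<in>\<E>. B E)" using AEP AE_space by eventually_elim (use c in blast)
    then have "\<Omega>.prob (\<Union>E\<in>\<E>. B E) = 1" using fin Bm by (subst \<Omega>.prob_eq_1) auto
    then show False using less by simp
  qed
  then obtain \<omega> where \<omega>: "\<omega> \<in> space \<Omega>" "\<forall>i\<in>{1..N}. \<omega> i \<in> P i" "\<omega> \<notin> (\<Union>E\<in>\<E>. B E)" by blast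
  have "\<bar>real (card {i \<in> {1..N}. \<omega> i \<in> E}) - real N * prob E\<bar> < \<epsilon>" if EE: "E \<in> \<E>" for E
  proof -
    have "real (card {i \<in> {1..N}. \<omega> i \<in> E}) = (\<Sum>i\<in>{1..N}. X E i \<omega>)"
      by (simp add: X_def indicator_def sum.If_cases Int_def)
    also have "\<dots> = (\<Sum>i\<in>C E. X E i \<omega>) + (\<Sum>i\<in>{1..N} - C E. X E i \<omega>)"
      using sum.subset_diff[OF CN[of E], of "\<lambda>i. X E i \<omega>"] by simp
    also have "(\<Sum>i\<in>{1..N} - C E. X E i \<omega>) = (\<Sum>i\<in>{1..N} - C E. real N * prob (P i \<inter> E))"
    proof (intro sum.cong refl)
      fix i assume i: "i \<in> {1..N} - C E"
      then consider "P i \<inter> E = {}" | "P i \<subseteq> E" by (auto simp: C_def)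
      then show "X E i \<omega> = real N * prob (P i \<inter> E)"
      proof cases
        case 1
        then have "\<omega> i \<notin> E" using \<omega>(2) i by auto
        then show ?thesis using 1 by (simp add: X_def)
      next
        case 2
        then have "\<omega> i \<in> E" "P i \<inter> E = P i" using \<omega>(2) i by auto
        then show ?thesis using P(2)[of i] i N by (simp add: X_def)
      qed
    qed
    finally have c: "real (card {i \<in> {1..N}. \<omega> i \<in> E}) = (\<Sum>i\<in>C E. X E i \<omega>) + (\<Sum>i\<in>{1..N} - C E. real N * prob (P i \<inter> E))" .
    \<comment> \<open>N disjoint pieces of mass 1/N cover the space up to a null set, so
      \<open>prob E\<close> splits over the pieces.\<close>
    have UPm: "(\<Union>i\<in>{1..N}. P i) \<in> events" using P(1) by auto
    have "prob (\<Union>i\<in>{1..N}. P i) = (\<Sum>i\<in>{1..N}. prob (P i))"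
      using P(1) disj by (intro finite_measure_finite_Union) auto
    also have "\<dots> = 1" using P(2) N by simp
    finally have "prob (\<Union>i\<in>{1..N}. P i) = 1" .
    then have "AE x in M. x \<in> (\<Union>i\<in>{1..N}. P i)" using UPm by (subst (asm) prob_eq_1) auto
    then have "prob E = prob (\<Union>i\<in>{1..N}. P i \<inter> E)"
      using E[OF EE] P(1) by (intro finite_measure_eq_AE) (auto elim!: eventually_mono)
    also have "\<dots> = (\<Sum>i\<in>{1..N}. prob (P i \<inter> E))"
      using P(1) disj E[OF EE] by (intro finite_measure_finite_Union) (auto simp: disjoint_family_on_def)
    finally have "real N * prob E = (\<Sum>i\<in>{1..N}. real N * prob (P i \<inter> E))" by (simp add: sum_distrib_left)
    also have "\<dots> = (\<Sum>i\<in>C E. real N * prob (P i \<inter> E)) + (\<Sum>i\<in>{1..N} - C E. real N * prob (P i \<inter> E))"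
      using sum.subset_diff[OF CN[of E], of "\<lambda>i. real N * prob (P i \<inter> E)"] by simp
    also have "(\<Sum>i\<in>C E. real N * prob (P i \<inter> E)) = (\<Sum>i\<in>C E. \<Omega>.expectation (X E i))"
      using CN E[OF EE] by (intro sum.cong refl) (auto simp: expX subset_iff)
    finally have d: "real N * prob E = (\<Sum>i\<in>C E. \<Omega>.expectation (X E i)) + (\<Sum>i\<in>{1..N} - C E. real N * prob (P i \<inter> E))" .
    have "\<omega> \<notin> B E" using \<omega>(3) EE by auto
    then have "\<bar>(\<Sum>i\<in>C E. X E i \<omega>) - (\<Sum>i\<in>C E. \<Omega>.expectation (X E i))\<bar> < \<epsilon>"
      using \<omega>(1) by (auto simp: B_def)
    then show ?thesis unfolding c d by simp
  qed
  then show ?thesis using \<omega>(2) by blast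
qed

text \<open>Restricted to Q and pushed forward by f, the measure has no atoms, so its distribution
  function is continuous. This is what the intermediate value theorem needs when columns are cut at
  prescribed masses.\<close>

lemma (in prob_space) continuous_sublevel_prob:
  fixes f :: "'a \<Rightarrow> real"
  assumes Q: "Q \<in> events" and f [measurable]: "f \<in> borel_measurable M"
    and null: "\<And>t. prob {x \<in> space M. f x = t} = 0"
  shows "continuous_on A (\<lambda>t. prob {x \<in> Q. f x \<le> t})"
proof -
  define D where "D = distr (density M (indicator Q)) borel f"
  have fm: "finite_measure (density M (indicator Q))" using Q by (rule finite_measure_restricted)
  interpret D: finite_borel_measure D
    unfolding D_def using fm by (intro finite_borel_measure.intro finite_measure.finite_measure_distr)
      (auto simp: finite_borel_measure_axioms_def)
  have m: "measure D S = prob {x \<in> Q. f x \<in> S}" if S [measurable]: "S \<in> sets borel" for S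
  proof -
    have "emeasure D S = emeasure M {x \<in> Q. f x \<in> S}"
    proof -
      have "emeasure D S = emeasure (density M (indicator Q)) (f -` S \<inter> space M)"
        unfolding D_def by (subst emeasure_distr) auto
      also have "\<dots> = emeasure M (Q \<inter> (f -` S \<inter> space M))"
        using Q by (intro emeasure_restricted) auto
      also have "Q \<inter> (f -` S \<inter> space M) = {x \<in> Q. f x \<in> S}" using sets.sets_into_space[OF Q] by auto
      finally show ?thesis .
    qed
    then show ?thesis by (simp add: measure_def)
  qed
  have "isCont (cdf D) t" for t
  proof -
    have "prob {x \<in> Q. f x \<in> {t}} \<le> prob {x \<in> space M. f x = t}"
      using sets.sets_into_space[OF Q] by (intro finite_measure_mono) auto
    then have "measure D {t} \<le> 0" using null[of t] m[of "{t}"] by simp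
    then have "measure D {t} = 0" using measure_nonneg[of D "{t}"] by linarith
    then show ?thesis by (simp add: D.isCont_cdf)
  qed
  then have "continuous_on A (cdf D)" by (intro continuous_at_imp_continuous_on) auto
  moreover have "cdf D = (\<lambda>t. prob {x \<in> Q. f x \<le> t})" using m[of "{.._}"] by (auto simp: cdf_def)
  ultimately show ?thesis by simp
qed

text \<open>The sets \<open>U c t\<close>, all columns before c together with the part f \<le> t of
  column c, form a chain whose mass takes every value in [0,1]; cutting at the masses i/N gives the
  pieces. A piece fails to be an interval of one column only if the column changes between its two
  cuts, which happens at most n times. The third conclusion records that a piece depends only on
  column and f, which later keeps the sampled directions distinct.\<close>

lemma (in prob_space) equal_mass_pieces:
  fixes n N :: nat and Q :: "nat \<Rightarrow> 'a set" and f :: "'a \<Rightarrow> real"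
  assumes N: "N \<ge> 1"
    and Q: "\<And>c. c < n \<Longrightarrow> Q c \<in> events" and disj: "disjoint_family_on Q {..<n}" and cover: "(\<Union>c<n. Q c) = space M"
    and f [measurable]: "f \<in> borel_measurable M" and f1: "\<And>x. x \<in> space M \<Longrightarrow> -1 \<le> f x \<and> f x \<le> 1"
    and null: "\<And>t. prob {x \<in> space M. f x = t} = 0"
  shows "\<exists>P. (\<forall>i\<in>{1..N}. P i \<in> events \<and> prob (P i) = 1 / real N) \<and> disjoint_family_on P {1..N} \<and>
    (\<forall>i x y. (\<forall>c<n. x \<in> Q c \<longleftrightarrow> y \<in> Q c) \<longrightarrow> f x = f y \<longrightarrow> i \<in> {1..N} \<longrightarrow> x \<in> P i \<longrightarrow> y \<in> P i) \<and>
    card {i \<in> {1..N}. \<not> (\<exists>c<n. \<exists>a b. -1 \<le> a \<and> a \<le> b \<and> b \<le> 1 \<and> P i = {x \<in> Q c. a < f x \<and> f x \<le> b})} \<le> n"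
proof -
  define U where "U c t = (\<Union>c'<c. Q c') \<union> {x \<in> Q c. f x \<le> t}" for c t
  have QS: "Q c \<subseteq> space M" if "c < n" for c using Q[OF that] sets.sets_into_space by blast
  have Qe: "{x \<in> Q c. f x \<le> t} \<in> events" if "c < n" for c t
  proof -
    have "{x \<in> Q c. f x \<le> t} = Q c \<inter> {x \<in> space M. f x \<le> t}" using QS[OF that] by auto
    also have "\<dots> \<in> events" using Q[OF that] by measurable
    finally show ?thesis .
  qed
  have Ue: "U c t \<in> events" if "c < n" for c t
    unfolding U_def using Q Qe that by (intro sets.Un sets.finite_UN) auto
  have disjQ: "x \<in> Q c \<Longrightarrow> x \<in> Q c' \<Longrightarrow> c < n \<Longrightarrow> c' < n \<Longrightarrow> c = c'" for x c c'
    using disj by (auto simp: disjoint_family_on_def)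
  define S where "S c = (\<Sum>c'<c. prob (Q c'))" for c
  have S: "prob (\<Union>c'<c. Q c') = S c" if "c \<le> n" for c
    unfolding S_def using that Q disj by (intro finite_measure_finite_Union) (auto simp: disjoint_family_on_def)
  have US: "prob (U c t) = S c + prob {x \<in> Q c. f x \<le> t}" if c: "c < n" for c t
    unfolding U_def using Q Qe c S[of c] disjQ by (subst finite_measure_Union) (fastforce simp: S)+
  have Sn: "S n = 1" using S[of n] cover prob_space by simp
  have ex: "\<exists>c t. c < n \<and> -1 \<le> t \<and> t \<le> 1 \<and> prob (U c t) = p" if p: "0 \<le> p" "p \<le> 1" for p
  proof -
    have n0: "n > 0" using Sn by (cases n) (auto simp: S_def)
    have ex: "\<exists>c. c < n \<and> p \<le> S (Suc c)" using n0 Sn p by (intro exI[of _ "n - 1"]) auto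
    \<comment> \<open>The first column at whose end the accumulated mass reaches p; inside it the
      mass rises continuously from at most p (as f = -1 is a null event) to at least p.\<close>
    define c where "c = (LEAST c. c < n \<and> p \<le> S (Suc c))"
    have c: "c < n" "p \<le> S (Suc c)" using LeastI_ex[OF ex] by (auto simp: c_def)
    have Sc: "S c \<le> p"
    proof (cases c)
      case 0 then show ?thesis using p by (simp add: S_def)
    next
      case (Suc k)
      then have "\<not> (k < n \<and> p \<le> S (Suc k))" unfolding c_def using not_less_Least by (metis c_def lessI)
      then show ?thesis using Suc c by auto
    qed
    have "{x \<in> Q c. f x \<le> 1} = Q c" using f1 QS[OF c(1)] by auto
    then have e1: "prob {x \<in> Q c. f x \<le> 1} = prob (Q c)" by simp
    have "prob {x \<in> Q c. f x \<le> -1} \<le> prob {x \<in> space M. f x = -1}"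
      using f1 QS[OF c(1)] by (intro finite_measure_mono) (force simp: antisym, simp)
    then have e0: "prob {x \<in> Q c. f x \<le> -1} = 0" using null[of "-1"] measure_nonneg[of M "{x \<in> Q c. f x \<le> -1}"] by simp
    have "\<exists>t\<ge>-1. t \<le> 1 \<and> prob {x \<in> Q c. f x \<le> t} = p - S c"
      using c Sc e0 e1 Q null by (intro IVT' continuous_sublevel_prob) (auto simp: S_def)
    then show ?thesis using US[OF c(1)] c by force
  qed
  have "\<forall>i. \<exists>ct. i \<le> N \<longrightarrow> fst ct < n \<and> -1 \<le> snd ct \<and> snd ct \<le> 1 \<and> prob (U (fst ct) (snd ct)) = real i / real N"
  proof
    fix i show "\<exists>ct. i \<le> N \<longrightarrow> fst ct < n \<and> -1 \<le> snd ct \<and> snd ct \<le> 1 \<and> prob (U (fst ct) (snd ct)) = real i / real N"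
      using ex[of "real i / real N"] N by (cases "i \<le> N") auto
  qed
  then obtain ct where ct: "\<And>i. i \<le> N \<Longrightarrow> fst (ct i) < n \<and> -1 \<le> snd (ct i) \<and> snd (ct i) \<le> 1 \<and> prob (U (fst (ct i)) (snd (ct i))) = real i / real N"
    by metis
  define c where "c i = fst (ct i)" for i
  define t where "t i = snd (ct i)" for i
  define V where "V i = U (c i) (t i)" for i
  have cn: "c i < n" and t1: "-1 \<le> t i" "t i \<le> 1" and V: "prob (V i) = real i / real N" if "i \<le> N" for i
    using ct[OF that] by (auto simp: c_def t_def V_def)
  have Ve: "V i \<in> events" if "i \<le> N" for i using Ue cn that by (simp add: V_def)
  have lex: "U a s \<subseteq> U b u" if "a < b \<or> a = b \<and> s \<le> u" for a b s u
    using that by (fastforce simp: U_def)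
  \<comment> \<open>The cut positions are ordered as their masses: in the reverse order the chain
    would make \<open>V j\<close> a subset of \<open>V i\<close>, although its mass is
    larger.\<close>
  have ord: "c i < c j \<or> c i = c j \<and> t i < t j" if ij: "i < j" "j \<le> N" for i j
  proof (rule ccontr)
    assume "\<not> ?thesis"
    then have "V j \<subseteq> V i" unfolding V_def by (intro lex) auto
    then have "prob (V j) \<le> prob (V i)" using Ve ij by (intro finite_measure_mono) auto
    then show False using V[of i] V[of j] ij N by (simp add: divide_le_cancel)
  qed
  have Vmono: "V i \<subseteq> V j" if "i \<le> j" "j \<le> N" for i j
    using ord[of i j] that unfolding V_def by (cases "i = j") (auto intro!: lex)
  define P where "P i = V i - V (i - 1)" for i
  have "P i \<in> events \<and> prob (P i) = 1 / real N" if i: "i \<in> {1..N}" for i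
  proof
    show "P i \<in> events" unfolding P_def using Ve i by auto
    have "prob (P i) = prob (V i) - prob (V (i - 1))"
      unfolding P_def using Ve i Vmono[of "i - 1" i] by (intro finite_measure_Diff) auto
    moreover have "i - 1 \<le> N" "i \<le> N" "1 \<le> i" using i by auto
    ultimately show "prob (P i) = 1 / real N" using V[of i] V[of "i - 1"] by (simp add: of_nat_diff diff_divide_distrib)
  qed
  moreover have "y \<in> P i" if xy: "\<forall>c<n. x \<in> Q c \<longleftrightarrow> y \<in> Q c" "f x = f y" and i: "i \<in> {1..N}" and x: "x \<in> P i" for i x y
  proof -
    have "x \<in> V j \<longleftrightarrow> y \<in> V j" if "j \<le> N" for j
    proof -
      have "x \<in> Q c' \<longleftrightarrow> y \<in> Q c'" if "c' \<le> c j" for c'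
        using xy(1) cn[OF \<open>j \<le> N\<close>] that by auto
      then show ?thesis unfolding V_def U_def using xy(2) by auto
    qed
    then show ?thesis using x i by (auto simp: P_def)
  qed
  moreover have "disjoint_family_on P {1..N}"
  proof -
    have "P i \<inter> P j = {}" if "i < j" "j \<le> N" for i j
    proof -
      have "i \<le> j - 1" "j - 1 \<le> N" using that by auto
      then have "V i \<subseteq> V (j - 1)" by (rule Vmono)
      then show ?thesis by (auto simp: P_def)
    qed
    then show ?thesis unfolding disjoint_family_on_def
      by (metis Int_commute atLeastAtMost_iff linorder_neqE_nat)
  qed
  moreover have "card {i \<in> {1..N}. \<not> (\<exists>c<n. \<exists>a b. -1 \<le> a \<and> a \<le> b \<and> b \<le> 1 \<and> P i = {x \<in> Q c. a < f x \<and> f x \<le> b})} \<le> n"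
    (is "card ?B \<le> n")
  proof -
    \<comment> \<open>Two cuts in the same column bound an interval of that column, so a bad piece
      ends in a later column than it starts. Hence distinct bad pieces end in distinct columns,
      which bounds their number by n.\<close>
    have B: "c (i - 1) < c i" if "i \<in> ?B" for i
    proof (rule ccontr)
      have "1 \<le> i \<and> i \<le> N" using that by (simp del: not_ex)
      then have i: "1 \<le> i" "i \<le> N" "i - 1 \<le> N" by auto
      assume "\<not> c (i - 1) < c i"
      then have o: "c (i - 1) = c i" "t (i - 1) < t i" using ord[of "i - 1" i] i by auto
      have "P i = {x \<in> Q (c i). t (i - 1) < f x \<and> f x \<le> t i}"
      proof -
        have "x \<notin> (\<Union>c'<c i. Q c')" if "x \<in> Q (c i)" for x
        proof
          assume "x \<in> (\<Union>c'<c i. Q c')"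
          then obtain c' where "c' < c i" "x \<in> Q c'" by auto
          then show False using disjQ[OF that \<open>x \<in> Q c'\<close> cn[OF i(2)]] cn[OF i(2)] by simp
        qed
        then show ?thesis unfolding P_def V_def U_def o(1) set_eq_iff by (simp add: not_le) blast
      qed
      moreover have "c i < n" "-1 \<le> t (i - 1)" "t (i - 1) \<le> t i" "t i \<le> 1"
        using cn[OF i(2)] t1[OF i(2)] t1[OF i(3)] o(2) by simp_all
      ultimately have "\<exists>c<n. \<exists>a b. -1 \<le> a \<and> a \<le> b \<and> b \<le> 1 \<and> P i = {x \<in> Q c. a < f x \<and> f x \<le> b}"
        by blast
      then show False using that by (simp only: mem_Collect_eq simp_thms)
    qed
    have "inj_on c ?B"
    proof (rule linorder_inj_onI)
      fix i j assume ij: "i < j" "i \<in> ?B" "j \<in> ?B"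
      have "j \<le> N" using ij(3) by (simp del: not_ex)
      then have "i < j - 1 \<Longrightarrow> c i < c (j - 1) \<or> c i = c (j - 1)" using ord[of i "j - 1"] by auto
      moreover have "i = j - 1 \<or> i < j - 1" using ij(1) by auto
      ultimately have "c i \<le> c (j - 1)" by auto
      then show "c i \<noteq> c j" using B[OF ij(3)] by simp
    qed auto
    then have "card ?B = card (c ` ?B)" by (simp add: card_image)
    also have "\<dots> \<le> card {..<n}"
    proof (rule card_mono)
      have "?B \<subseteq> {1..N}" by (rule Collect_restrict)
      then show "c ` ?B \<subseteq> {..<n}" using cn by (auto simp del: not_ex)
    qed simp
    finally show ?thesis by simp
  qed
  ultimately show ?thesis by blast
qed

section \<open>Rotation invariance of the Gaussian measure\<close>

abbreviation std_gauss :: "real measure" where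
  "std_gauss \<equiv> density lborel (\<lambda>x. ennreal (std_normal_density x))"

definition gauss :: "nat \<Rightarrow> (nat \<Rightarrow> real) measure" where
  "gauss d = PiM {..d} (\<lambda>_. std_gauss)"

lemma prob_space_std_gauss: "prob_space std_gauss"
  by (simp add: prob_space_normal_density)

interpretation lborel_product: product_sigma_finite "\<lambda>_::nat. lborel :: real measure"
  by standard

interpretation gauss_product: product_sigma_finite "\<lambda>_::nat. std_gauss"
  by (intro product_sigma_finite.intro prob_space_imp_sigma_finite prob_space_std_gauss)

lemma prob_space_gauss: "prob_space (gauss d)"
  unfolding gauss_def by (intro prob_space_PiM prob_space_std_gauss)

lemma sets_gauss [measurable_cong]: "sets (gauss d) = sets (PiM {..d} (\<lambda>_. borel))"
  unfolding gauss_def by (intro sets_PiM_cong) auto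

lemma space_gauss: "space (gauss d) = {..d} \<rightarrow>\<^sub>E UNIV"
  by (simp add: gauss_def space_PiM)

text \<open>Rotations mix coordinates and do not respect the product form. In density form the
  invariance splits into that of Lebesgue measure and that of a density depending on the norm
  alone.\<close>

lemma gauss_eq_density:
  "gauss d = density (PiM {..d} (\<lambda>_. lborel)) (\<lambda>z. \<Prod>i\<le>d. ennreal (std_normal_density (z i)))"
  unfolding gauss_def
proof (rule gauss_product.PiM_eqI[symmetric])
  fix A :: "nat \<Rightarrow> real set" assume "\<And>i. i \<in> {..d} \<Longrightarrow> A i \<in> sets std_gauss"
  then have A [measurable]: "i \<in> {..d} \<Longrightarrow> A i \<in> sets borel" for i by simp
  have m: "Pi\<^sub>E {..d} A \<in> sets (PiM {..d} (\<lambda>_. lborel))"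
    by (intro sets_PiM_I_finite) (use A in auto)
  have "emeasure (density (PiM {..d} (\<lambda>_. lborel)) (\<lambda>z. \<Prod>i\<le>d. ennreal (std_normal_density (z i)))) (Pi\<^sub>E {..d} A)
    = (\<integral>\<^sup>+ z. (\<Prod>i\<le>d. ennreal (std_normal_density (z i))) * indicator (Pi\<^sub>E {..d} A) z \<partial>PiM {..d} (\<lambda>_. lborel))"
    using m by (intro emeasure_density) auto
  also have "\<dots> = (\<integral>\<^sup>+ z. (\<Prod>i\<in>{..d}. ennreal (std_normal_density (z i)) * indicator (A i) (z i)) \<partial>PiM {..d} (\<lambda>_. lborel))"
  proof (intro nn_integral_cong)
    fix z :: "nat \<Rightarrow> real" assume "z \<in> space (PiM {..d} (\<lambda>_. lborel))"
    then have e: "z \<in> extensional {..d}" by (simp add: space_PiM PiE_iff)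
    have "indicator (Pi\<^sub>E {..d} A) z = (\<Prod>i\<in>{..d}. indicator (A i) (z i) :: ennreal)"
    proof (cases "\<forall>i\<in>{..d}. z i \<in> A i")
      case True then show ?thesis using e by (auto simp: PiE_iff)
    next
      case False then show ?thesis using e by (auto simp: PiE_iff indicator_def)
    qed
    then show "(\<Prod>i\<le>d. ennreal (std_normal_density (z i))) * indicator (Pi\<^sub>E {..d} A) z =
      (\<Prod>i\<in>{..d}. ennreal (std_normal_density (z i)) * indicator (A i) (z i))"
      by (simp add: prod.distrib)
  qed
  also have "\<dots> = (\<Prod>i\<in>{..d}. \<integral>\<^sup>+ y. ennreal (std_normal_density y) * indicator (A i) y \<partial>lborel)"
    by (intro lborel_product.product_nn_integral_prod) auto
  also have "\<dots> = (\<Prod>i\<in>{..d}. emeasure std_gauss (A i))"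
    by (intro prod.cong refl) (use A in \<open>simp add: emeasure_density\<close>)
  finally show "emeasure (density (PiM {..d} (\<lambda>_. lborel)) (\<lambda>z. \<Prod>i\<le>d. ennreal (std_normal_density (z i)))) (Pi\<^sub>E {..d} A)
    = (\<Prod>i\<in>{..d}. emeasure std_gauss (A i))" .
qed (auto intro!: sets_PiM_cong)

text \<open>With the other coordinates fixed, the shear is a translation of coordinate i; Tonelli
  and translation invariance in one variable suffice.\<close>

lemma nn_integral_shear:
  fixes d :: nat
  assumes "i \<le> d" "j \<le> d" "i \<noteq> j"
    and [measurable]: "f \<in> borel_measurable (PiM {..d} (\<lambda>_. lborel))"
  shows "(\<integral>\<^sup>+ z. f (z(i := z i + c * z j)) \<partial>PiM {..d} (\<lambda>_. lborel)) = (\<integral>\<^sup>+ z. f z \<partial>PiM {..d} (\<lambda>_. lborel :: real measure))"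
proof -
  define I where "I = {..d} - {i}"
  have I: "{..d} = insert i I" "finite I" "i \<notin> I" "j \<in> I" using assms by (auto simp: I_def)
  have f [measurable]: "f \<in> borel_measurable (PiM (insert i I) (\<lambda>_. lborel))"
    using assms(4) by (simp add: I(1))
  have g [measurable]: "(\<lambda>z. z(i := z i + c * z j)) \<in> measurable (PiM (insert i I) (\<lambda>_. lborel)) (PiM (insert i I) (\<lambda>_. lborel :: real measure))"
    using I by (intro measurable_PiM_single') (auto simp: space_PiM PiE_iff extensional_def)
  have "(\<integral>\<^sup>+ z. f (z(i := z i + c * z j)) \<partial>PiM (insert i I) (\<lambda>_. lborel))
     = (\<integral>\<^sup>+ x. \<integral>\<^sup>+ y. f ((x(i := y))(i := (x(i := y)) i + c * (x(i := y)) j)) \<partial>lborel \<partial>PiM I (\<lambda>_. lborel))"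
    using I by (intro lborel_product.product_nn_integral_insert) auto
  also have "\<dots> = (\<integral>\<^sup>+ x. \<integral>\<^sup>+ y. f (x(i := y)) \<partial>lborel \<partial>PiM I (\<lambda>_. lborel))"
  proof (rule nn_integral_cong)
    fix x assume x: "x \<in> space (PiM I (\<lambda>_. lborel :: real measure))"
    have h [measurable]: "(\<lambda>y. f (x(i := y))) \<in> borel_measurable lborel"
      using x I by measurable
    have "(\<integral>\<^sup>+ y. f (x(i := y)) \<partial>lborel) = (\<integral>\<^sup>+ y. f (x(i := c * x j + 1 * y)) \<partial>lborel)"
      using nn_integral_real_affine[of "\<lambda>y. f (x(i := y))" 1 "c * x j"] h by simp
    then show "(\<integral>\<^sup>+ y. f ((x(i := y))(i := (x(i := y)) i + c * (x(i := y)) j)) \<partial>lborel) = (\<integral>\<^sup>+ y. f (x(i := y)) \<partial>lborel)"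
      using assms(3) by (simp add: add.commute)
  qed
  also have "\<dots> = (\<integral>\<^sup>+ z. f z \<partial>PiM (insert i I) (\<lambda>_. lborel))"
    using I by (intro lborel_product.product_nn_integral_insert[symmetric]) auto
  finally show ?thesis by (simp add: I(1))
qed

definition rot :: "nat \<Rightarrow> nat \<Rightarrow> real \<Rightarrow> real \<Rightarrow> (nat \<Rightarrow> real) \<Rightarrow> nat \<Rightarrow> real" where
  "rot i j c s z = z(i := c * z i - s * z j, j := s * z i + c * z j)"

lemma measurable_rot [measurable]:
  assumes "i \<le> d" "j \<le> d"
  shows "rot i j c s \<in> measurable (PiM {..d} (\<lambda>_. borel)) (PiM {..d} (\<lambda>_. borel))"
  unfolding rot_def using assms
  by (intro measurable_PiM_single') (auto simp: space_PiM PiE_iff extensional_def fun_upd_def)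

(* A rotation with s ~= 0 is a product of three shears, and the rotation by pi is the square of
   the rotation by pi/2. *)
lemma nn_integral_rot_lborel:
  fixes d :: nat
  assumes "i \<le> d" "j \<le> d" "i \<noteq> j" "c\<^sup>2 + s\<^sup>2 = 1"
    and f: "f \<in> borel_measurable (PiM {..d} (\<lambda>_. lborel))"
  shows "(\<integral>\<^sup>+ z. f (rot i j c s z) \<partial>PiM {..d} (\<lambda>_. lborel)) = (\<integral>\<^sup>+ z. f z \<partial>PiM {..d} (\<lambda>_. lborel))"
proof -
  have sub: "(\<integral>\<^sup>+ z. g (rot i j c s z) \<partial>PiM {..d} (\<lambda>_. lborel)) = (\<integral>\<^sup>+ z. g z \<partial>PiM {..d} (\<lambda>_. lborel))"
    if cs: "c\<^sup>2 + s\<^sup>2 = 1" "s \<noteq> 0" and g: "g \<in> borel_measurable (PiM {..d} (\<lambda>_. lborel))" for c s g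
  proof -
    \<comment> \<open>For c = cos theta and s = sin theta this is -tan(theta/2), the factor of the
      outer shears in the decomposition of a rotation.\<close>
    define t where "t = (c - 1) / s"
    have t1: "1 + t * s = c" using cs by (simp add: t_def)
    have "t * (1 + c) = - s" using cs by (simp add: t_def field_simps power2_eq_square)
    then have t2: "t + t * c = - s" by (simp add: algebra_simps)
    define S1 where "S1 z = z(i := z i + t * z j)" for z :: "nat \<Rightarrow> real"
    define S2 where "S2 z = z(j := z j + s * z i)" for z :: "nat \<Rightarrow> real"
    have eq: "rot i j c s z = S1 (S2 (S1 z))" for z
    proof
      fix k
      have "c * z i - s * z j = (1 + t * s) * z i + (t + t * c) * z j" by (simp only: t1 t2) 
      also have "\<dots> = z i + t * z j + t * (z j + s * (z i + t * z j))"
        using arg_cong[OF t1, of "\<lambda>x. t * x * z j"] by (simp add: algebra_simps)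
      finally have 1: "c * z i - s * z j = z i + t * z j + t * (z j + s * (z i + t * z j))" .
      have "s * z i + c * z j = z j + s * (z i + t * z j)" by (simp add: t1[symmetric] algebra_simps)
      then show "rot i j c s z k = S1 (S2 (S1 z)) k" using 1 assms(3) by (auto simp: rot_def S1_def S2_def)
    qed
    have ms: "S1 \<in> measurable (PiM {..d} (\<lambda>_. lborel)) (PiM {..d} (\<lambda>_. lborel))" "S2 \<in> measurable (PiM {..d} (\<lambda>_. lborel)) (PiM {..d} (\<lambda>_. lborel))"
      unfolding S1_def S2_def using assms
      by (intro measurable_PiM_single'; auto simp: space_PiM PiE_iff extensional_def fun_upd_def)+
    have [measurable]: "(\<lambda>z. g (S1 z)) \<in> borel_measurable (PiM {..d} (\<lambda>_. lborel))"
      "(\<lambda>z. g (S1 (S2 z))) \<in> borel_measurable (PiM {..d} (\<lambda>_. lborel))"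
      using ms g by measurable
    note S = nn_integral_shear[OF assms(1,2,3), of _ t, folded S1_def] nn_integral_shear[OF assms(2,1) assms(3)[symmetric], of _ s, folded S2_def]
    show ?thesis unfolding eq
      using S(1)[of "\<lambda>z. g (S1 (S2 z))"] S(2)[of "\<lambda>z. g (S1 z)"] S(1)[OF g] by simp
  qed
  have m: "(\<lambda>z. g (rot i j c s z)) \<in> borel_measurable (PiM {..d} (\<lambda>_. lborel))"
    if "g \<in> borel_measurable (PiM {..d} (\<lambda>_. lborel))" for g :: "_ \<Rightarrow> ennreal" and c s
    using that measurable_rot[OF assms(1,2), of c s] by measurable
  consider "s \<noteq> 0" | "s = 0" "c = 1" | "s = 0" "c = -1"
    using assms(4) by (cases "s = 0") (auto simp: power2_eq_1_iff)
  then show ?thesis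
  proof cases
    case 1 then show ?thesis using sub assms f by simp
  next
    case 2 then have "rot i j c s z = z" for z by (auto simp: rot_def)
    then show ?thesis by simp
  next
    case 3
    then have "rot i j c s z = rot i j 0 1 (rot i j 0 1 z)" for z using assms(3) by (auto simp: rot_def)
    then show ?thesis using sub[of 0 1 "\<lambda>z. f (rot i j 0 1 z)"] sub[of 0 1 f] f m by simp
  qed
qed

lemma sum_split2:
  fixes f :: "nat \<Rightarrow> real"
  assumes "i \<le> d" "j \<le> d" "i \<noteq> j"
  shows "(\<Sum>k\<le>d. f k) = f i + f j + (\<Sum>k\<in>{..d} - {i, j}. f k)"
proof -
  have "{..d} = {i, j} \<union> ({..d} - {i, j})" using assms by auto
  then have "(\<Sum>k\<le>d. f k) = (\<Sum>k\<in>{i,j}. f k) + (\<Sum>k\<in>{..d} - {i, j}. f k)"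
    by (metis (no_types, lifting) Diff_disjoint finite.emptyI finite_atMost finite_Diff finite_insert sum.union_disjoint)
  then show ?thesis using assms by simp
qed

lemma sdot_rot_left:
  assumes "i \<le> d" "j \<le> d" "i \<noteq> j"
  shows "sdot d (rot i j c s z) w = sdot d z (rot i j c (- s) w)"
  unfolding sdot_def sum_split2[OF assms] using assms by (auto simp: rot_def algebra_simps intro!: sum.cong)

lemma sdot_rot_rot:
  assumes "i \<le> d" "j \<le> d" "i \<noteq> j" "c\<^sup>2 + s\<^sup>2 = 1"
  shows "sdot d (rot i j c s z) (rot i j c s w) = sdot d z w"
proof -
  have "(c * z i - s * z j) * (c * w i - s * w j) + (s * z i + c * z j) * (s * w i + c * w j) = (c\<^sup>2 + s\<^sup>2) * (z i * w i + z j * w j)"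
    by (simp add: algebra_simps power2_eq_square)
  then show ?thesis
  unfolding sdot_def sum_split2[OF assms(1-3)] using assms by (auto simp: rot_def intro!: sum.cong)
qed

text \<open>The Gaussian density is a function of \<open>sdot d z z\<close>, which rotations
  preserve, so the invariance of Lebesgue measure carries over.\<close>

lemma nn_integral_rot:
  assumes "i \<le> d" "j \<le> d" "i \<noteq> j" "c\<^sup>2 + s\<^sup>2 = 1"
    and f [measurable]: "f \<in> borel_measurable (gauss d)"
  shows "(\<integral>\<^sup>+ z. f (rot i j c s z) \<partial>gauss d) = (\<integral>\<^sup>+ z. f z \<partial>gauss d)"
proof -
  let ?L = "PiM {..d} (\<lambda>_. lborel :: real measure)"
  define D where "D z = (\<Prod>i\<le>d. ennreal (std_normal_density (z i)))" for z
  have Dm [measurable]: "D \<in> borel_measurable ?L" unfolding D_def by measurable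
  have D: "D z = ennreal ((1 / sqrt (2 * pi)) ^ Suc d * exp (- sdot d z z / 2))" for z
    unfolding D_def std_normal_density_def
    by (simp add: prod_ennreal prod.distrib prod_dividef exp_sum[symmetric] sdot_def sum_negf sum_divide_distrib[symmetric] power2_eq_square power_divide)
  have Drot: "D (rot i j c s z) = D z" for z
    using assms by (simp add: D sdot_rot_rot)
  have sL: "sets (gauss d) = sets ?L" unfolding gauss_eq_density by simp
  have f' [measurable]: "f \<in> borel_measurable ?L" using f unfolding measurable_cong_sets[OF sL refl] .
  have r [measurable]: "rot i j c s \<in> measurable ?L ?L"
    using measurable_rot[OF assms(1,2)] by (simp cong: measurable_cong_sets)
  have "(\<integral>\<^sup>+ z. f (rot i j c s z) \<partial>gauss d) = (\<integral>\<^sup>+ z. D z * f (rot i j c s z) \<partial>?L)"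
    unfolding gauss_eq_density D_def[symmetric] by (subst nn_integral_density) auto
  also have "\<dots> = (\<integral>\<^sup>+ z. (\<lambda>z. D z * f z) (rot i j c s z) \<partial>?L)" by (simp add: Drot)
  also have "\<dots> = (\<integral>\<^sup>+ z. D z * f z \<partial>?L)"
    by (intro nn_integral_rot_lborel assms) auto
  also have "\<dots> = (\<integral>\<^sup>+ z. f z \<partial>gauss d)"
    unfolding gauss_eq_density D_def[symmetric] by (subst nn_integral_density) auto
  finally show ?thesis .
qed

section \<open>The joint law of two inner products and the norm\<close>

lemma measurable_sdot [measurable (raw)]:
  assumes "\<And>i. i \<le> d \<Longrightarrow> (\<lambda>x. f x i) \<in> borel_measurable M" "\<And>i. i \<le> d \<Longrightarrow> (\<lambda>x. g x i) \<in> borel_measurable M"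
  shows "(\<lambda>x. sdot d (f x) (g x)) \<in> borel_measurable M"
  unfolding sdot_def using assms by (intro borel_measurable_sum borel_measurable_times) auto

text \<open>The third component lets quantities that depend on the direction of z, such as z.x /
  |z|, be read off the same law.\<close>

definition gram_law :: "nat \<Rightarrow> (nat \<Rightarrow> real) \<Rightarrow> (nat \<Rightarrow> real) \<Rightarrow> (real \<times> real \<times> real) measure" where
  "gram_law d x y = distr (gauss d) (borel \<Otimes>\<^sub>M borel \<Otimes>\<^sub>M borel) (\<lambda>z. (sdot d z x, sdot d z y, sdot d z z))"

text \<open>Rotating x and y amounts to rotating z by the inverse rotation, which leaves the
  Gaussian measure unchanged.\<close>

lemma gram_law_rot:
  assumes "i \<le> d" "j \<le> d" "i \<noteq> j" "c\<^sup>2 + s\<^sup>2 = 1"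
  shows "gram_law d (rot i j c s x) (rot i j c s y) = gram_law d x y"
proof (rule measure_eqI)
  fix A assume "A \<in> sets (gram_law d (rot i j c s x) (rot i j c s y))"
  then have A [measurable]: "A \<in> sets (borel \<Otimes>\<^sub>M borel \<Otimes>\<^sub>M borel)" by (simp add: gram_law_def)
  have e: "emeasure (gram_law d x y) A = (\<integral>\<^sup>+ z. indicator A (sdot d z x, sdot d z y, sdot d z z) \<partial>gauss d)" for x y
    unfolding gram_law_def by (subst nn_integral_indicator[symmetric], simp, subst nn_integral_distr) auto
  have "emeasure (gram_law d x y) A = (\<integral>\<^sup>+ z. (\<lambda>z. indicator A (sdot d z x, sdot d z y, sdot d z z)) (rot i j c (-s) z) \<partial>gauss d)"
    unfolding e using assms by (intro nn_integral_rot[symmetric]) auto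
  also have "\<dots> = emeasure (gram_law d (rot i j c s x) (rot i j c s y)) A"
    unfolding e using assms sdot_rot_rot[of i d j c "- s"] by (simp add: sdot_rot_left[of i d j c "- s" _ x] sdot_rot_left[of i d j c "- s" _ y])
  finally show "emeasure (gram_law d (rot i j c s x) (rot i j c s y)) A = emeasure (gram_law d x y) A" by simp
qed (simp add: gram_law_def)

lemma sdot_cong: "(\<And>i. i \<le> d \<Longrightarrow> x i = x' i) \<Longrightarrow> (\<And>i. i \<le> d \<Longrightarrow> y i = y' i) \<Longrightarrow> sdot d x y = sdot d x' y'"
  unfolding sdot_def by (intro sum.cong) auto

lemma gram_law_cong:
  assumes "\<And>i. i \<le> d \<Longrightarrow> x i = x' i" "\<And>i. i \<le> d \<Longrightarrow> y i = y' i"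
  shows "gram_law d x y = gram_law d x' y'"
  unfolding gram_law_def using sdot_cong[OF refl assms(1)] sdot_cong[OF refl assms(2)] by simp

lemma sdot_commute: "sdot d x y = sdot d y x"
  by (simp add: sdot_def mult.commute)

text \<open>Bundles everything a plane rotation preserves. The inner products are carried along
  because they identify the normal form once it is reached.\<close>

definition gram_equiv :: "nat \<Rightarrow> (nat \<Rightarrow> real) \<times> (nat \<Rightarrow> real) \<Rightarrow> (nat \<Rightarrow> real) \<times> (nat \<Rightarrow> real) \<Rightarrow> bool" where
  "gram_equiv d p q \<longleftrightarrow> gram_law d (fst p) (snd p) = gram_law d (fst q) (snd q) \<and>
     sdot d (fst p) (fst p) = sdot d (fst q) (fst q) \<and> sdot d (fst p) (snd p) = sdot d (fst q) (snd q) \<and>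
     sdot d (snd p) (snd p) = sdot d (snd q) (snd q)"

lemma gram_equiv_refl: "gram_equiv d p p" by (simp add: gram_equiv_def)

lemma gram_equiv_rot:
  assumes "i \<le> d" "j \<le> d" "i \<noteq> j" "c\<^sup>2 + s\<^sup>2 = 1" "gram_equiv d p (u, v)"
  shows "gram_equiv d p (rot i j c s u, rot i j c s v)"
  using assms by (auto simp: gram_equiv_def gram_law_rot sdot_rot_rot)

text \<open>A Givens rotation: the vector (x_i, x_j) is turned onto the first axis of its
  plane.\<close>

lemma ex_rot_zero:
  assumes "i \<noteq> j"
  shows "\<exists>c s. c\<^sup>2 + s\<^sup>2 = 1 \<and> rot i j c s x j = 0"
proof (cases "x i = 0 \<and> x j = 0")
  case True then show ?thesis by (intro exI[of _ 1] exI[of _ 0]) (auto simp: rot_def)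
next
  case False
  define r where "r = sqrt ((x i)\<^sup>2 + (x j)\<^sup>2)"
  have r: "r > 0" "r\<^sup>2 = (x i)\<^sup>2 + (x j)\<^sup>2" using False by (auto simp: r_def sum_power2_gt_zero_iff)
  show ?thesis
    using r assms by (intro exI[of _ "x i / r"] exI[of _ "- x j / r"])
      (auto simp: rot_def power_divide add_divide_distrib[symmetric])
qed

text \<open>Triangularisation by plane rotations: those in the planes (0, m) clear the first vector
  beyond coordinate 0, then those in the planes (1, m) clear the second beyond coordinate 1 without
  touching the first. The two signs are corrected by half turns in the planes (0, 1) and (1, 2); the
  latter needs d \<ge> 2.\<close>

lemma gram_normal_form:
  assumes "d \<ge> 2"
  shows "\<exists>u v. gram_equiv d (x, y) (u, v) \<and> (\<forall>i\<in>{1..d}. u i = 0) \<and> u 0 \<ge> 0 \<and> (\<forall>i\<in>{2..d}. v i = 0) \<and> v 1 \<ge> 0"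
proof -
  have "\<exists>u v. gram_equiv d (x, y) (u, v) \<and> (\<forall>i\<in>{1..m}. u i = 0)" if "m \<le> d" for m
    using that
  proof (induction m)
    case 0 then show ?case using gram_equiv_refl by force
  next
    case (Suc m)
    then obtain u v where uv: "gram_equiv d (x, y) (u, v)" "\<forall>i\<in>{1..m}. u i = 0" by auto
    obtain c s where cs: "c\<^sup>2 + s\<^sup>2 = 1" "rot 0 (Suc m) c s u (Suc m) = 0" using ex_rot_zero[of 0 "Suc m" u] by auto
    have "gram_equiv d (x, y) (rot 0 (Suc m) c s u, rot 0 (Suc m) c s v)"
      using Suc cs uv by (intro gram_equiv_rot) auto
    moreover have "rot 0 (Suc m) c s u i = 0" if "i \<in> {1..Suc m}" for i
      using that cs uv by (cases "i = Suc m") (auto simp: rot_def)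
    ultimately show ?case by blast
  qed
  then obtain u v where uv: "gram_equiv d (x, y) (u, v)" "\<forall>i\<in>{1..d}. u i = 0" by blast
  have "\<exists>u v. gram_equiv d (x, y) (u, v) \<and> (\<forall>i\<in>{1..d}. u i = 0) \<and> u 0 \<ge> 0"
  proof (cases "u 0 \<ge> 0")
    case True then show ?thesis using uv by blast
  next
    case False
    have "gram_equiv d (x, y) (rot 0 1 (-1) 0 u, rot 0 1 (-1) 0 v)"
      using uv assms by (intro gram_equiv_rot) auto
    moreover have "(\<forall>i\<in>{1..d}. rot 0 1 (-1) 0 u i = 0) \<and> rot 0 1 (-1) 0 u 0 \<ge> 0" using uv False by (auto simp: rot_def)
    ultimately show ?thesis by blast
  qed
  then obtain u v where uv: "gram_equiv d (x, y) (u, v)" "\<forall>i\<in>{1..d}. u i = 0" "u 0 \<ge> 0" by blast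
  have "\<exists>u v. gram_equiv d (x, y) (u, v) \<and> (\<forall>i\<in>{1..d}. u i = 0) \<and> u 0 \<ge> 0 \<and> (\<forall>i\<in>{2..Suc m}. v i = 0)" if "Suc m \<le> d" for m
    using that
  proof (induction m)
    case 0 then show ?case using uv by auto
  next
    case (Suc m)
    then obtain u v where uv: "gram_equiv d (x, y) (u, v)" "\<forall>i\<in>{1..d}. u i = 0" "u 0 \<ge> 0" "\<forall>i\<in>{2..Suc m}. v i = 0" by auto
    obtain c s where cs: "c\<^sup>2 + s\<^sup>2 = 1" "rot 1 (Suc (Suc m)) c s v (Suc (Suc m)) = 0" using ex_rot_zero[of 1 "Suc (Suc m)" v] by auto
    have "gram_equiv d (x, y) (rot 1 (Suc (Suc m)) c s u, rot 1 (Suc (Suc m)) c s v)"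
      using Suc cs uv by (intro gram_equiv_rot) auto
    moreover have "rot 1 (Suc (Suc m)) c s v i = 0" if "i \<in> {2..Suc (Suc m)}" for i
      using that cs uv by (cases "i = Suc (Suc m)") (auto simp: rot_def)
    moreover have "rot 1 (Suc (Suc m)) c s u i = 0" if "i \<in> {1..d}" for i
      using that uv Suc.prems by (auto simp: rot_def)
    moreover have "rot 1 (Suc (Suc m)) c s u 0 \<ge> 0" using uv by (auto simp: rot_def)
    ultimately show ?case by blast
  qed
  from this[of "d - 1"] assms
  obtain u v where uv: "gram_equiv d (x, y) (u, v)" "\<forall>i\<in>{1..d}. u i = 0" "u 0 \<ge> 0" "\<forall>i\<in>{2..d}. v i = 0" by auto
  show ?thesis
  proof (cases "v 1 \<ge> 0")
    case True then show ?thesis using uv by blast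
  next
    case False
    have "gram_equiv d (x, y) (rot 1 2 (-1) 0 u, rot 1 2 (-1) 0 v)"
      using uv assms by (intro gram_equiv_rot) auto
    moreover have "(\<forall>i\<in>{1..d}. rot 1 2 (-1) 0 u i = 0) \<and> rot 1 2 (-1) 0 u 0 \<ge> 0" using uv assms by (auto simp: rot_def)
    moreover have "(\<forall>i\<in>{2..d}. rot 1 2 (-1) 0 v i = 0) \<and> rot 1 2 (-1) 0 v 1 \<ge> 0" using uv False assms by (auto simp: rot_def)
    ultimately show ?thesis by blast
  qed
qed

definition plane_vec :: "real \<Rightarrow> real \<Rightarrow> nat \<Rightarrow> real" where
  "plane_vec a b = (\<lambda>i. if i = 0 then a else if i = 1 then b else 0)"

lemma sdot_plane_vec: "d \<ge> 1 \<Longrightarrow> sdot d z (plane_vec a b) = z 0 * a + z 1 * b"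
  using sum_split2[of 0 d 1 "\<lambda>i. z i * plane_vec a b i"]
    sum.neutral[of "{..d} - {0, 1}" "\<lambda>i. z i * plane_vec a b i"]
  unfolding sdot_def by (auto simp: plane_vec_def)

text \<open>The sign conditions of the normal form leave only one choice of its three free entries,
  so the law depends on x and y through their inner product alone.\<close>

lemma gram_law_unit:
  assumes "d \<ge> 2" "sdot d x x = 1" "sdot d y y = 1"
  shows "gram_law d x y = gram_law d (plane_vec 1 0) (plane_vec (sdot d x y) (sqrt (1 - (sdot d x y)\<^sup>2)))"
proof -
  obtain u v where uv: "gram_equiv d (x, y) (u, v)" "\<forall>i\<in>{1..d}. u i = 0" "u 0 \<ge> 0" "\<forall>i\<in>{2..d}. v i = 0" "v 1 \<ge> 0"
    using gram_normal_form[OF assms(1)] by blast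
  have u: "u i = plane_vec (u 0) 0 i" if "i \<le> d" for i using uv that by (auto simp: plane_vec_def)
  have v: "v i = plane_vec (v 0) (v 1) i" if "i \<le> d" for i using uv that by (auto simp: plane_vec_def)
  have su: "sdot d w u = w 0 * u 0" for w
    using sdot_plane_vec[of d w "u 0" 0] assms(1) sdot_cong[OF refl u] by simp
  have sv: "sdot d w v = w 0 * v 0 + w 1 * v 1" for w
    using sdot_plane_vec[of d w "v 0" "v 1"] assms(1) sdot_cong[OF refl v] by simp
  have "u 0 * u 0 = 1" using uv(1) assms su by (simp add: gram_equiv_def)
  then have u0: "u 0 = 1" using uv(3) by (metis abs_of_nonneg real_sqrt_abs2 real_sqrt_one)
  have "sdot d x y = sdot d v u" using uv(1) by (simp add: gram_equiv_def sdot_commute)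
  then have v0: "v 0 = sdot d x y" using su u0 by simp
  have "v 0 * v 0 + v 1 * v 1 = 1" using uv(1) assms sv by (simp add: gram_equiv_def)
  then have "1 - (v 0)\<^sup>2 = (v 1)\<^sup>2" by (simp add: power2_eq_square)
  then have v1: "v 1 = sqrt (1 - (sdot d x y)\<^sup>2)" using uv(5) v0 by simp
  have "gram_law d x y = gram_law d u v" using uv(1) by (simp add: gram_equiv_def)
  also have "\<dots> = gram_law d (plane_vec 1 0) (plane_vec (sdot d x y) (sqrt (1 - (sdot d x y)\<^sup>2)))"
    using u v u0 v0 v1 by (intro gram_law_cong) auto
  finally show ?thesis .
qed

lemma gram_law_eq:
  assumes "d \<ge> 2" "sdot d x x = 1" "sdot d y y = 1" "sdot d x' x' = 1" "sdot d y' y' = 1" "sdot d x y = sdot d x' y'"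
  shows "gram_law d x y = gram_law d x' y'"
  using assms gram_law_unit by simp

section \<open>Wedges and tubes\<close>

interpretation gauss: prob_space "gauss d" for d
  by (rule prob_space_gauss)

lemma gauss_measure_gram_eq:
  assumes "d \<ge> 2" "sdot d x x = 1" "sdot d y y = 1" "sdot d x' x' = 1" "sdot d y' y' = 1" "sdot d x y = sdot d x' y'"
    and P: "{p \<in> space (borel \<Otimes>\<^sub>M borel \<Otimes>\<^sub>M borel). P p} \<in> sets (borel \<Otimes>\<^sub>M borel \<Otimes>\<^sub>M borel)"
  shows "measure (gauss d) {z \<in> space (gauss d). P (sdot d z x, sdot d z y, sdot d z z)} =
         measure (gauss d) {z \<in> space (gauss d). P (sdot d z x', sdot d z y', sdot d z z)}"
proof -
  have "measure (gram_law d x y) {p \<in> space (borel \<Otimes>\<^sub>M borel \<Otimes>\<^sub>M borel). P p} =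
     measure (gauss d) {z \<in> space (gauss d). P (sdot d z x, sdot d z y, sdot d z z)}" for x y
    unfolding gram_law_def using P by (subst measure_distr) (auto intro!: arg_cong[where f="measure _"] simp: space_pair_measure)
  then show ?thesis using gram_law_eq[OF assms(1-6)] by metis
qed

lemma gauss_integral_gram_eq:
  fixes f :: "real \<times> real \<times> real \<Rightarrow> real"
  assumes "d \<ge> 2" "sdot d x x = 1" "sdot d y y = 1" "sdot d x' x' = 1" "sdot d y' y' = 1" "sdot d x y = sdot d x' y'"
    and f: "f \<in> borel_measurable (borel \<Otimes>\<^sub>M borel \<Otimes>\<^sub>M borel)"
  shows "(\<integral>z. f (sdot d z x, sdot d z y, sdot d z z) \<partial>gauss d) = (\<integral>z. f (sdot d z x', sdot d z y', sdot d z z) \<partial>gauss d)"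
proof -
  have "(\<integral>p. f p \<partial>gram_law d x y) = (\<integral>z. f (sdot d z x, sdot d z y, sdot d z z) \<partial>gauss d)" for x y
    unfolding gram_law_def using f by (subst integral_distr) auto
  then show ?thesis using gram_law_eq[OF assms(1-6)] by metis
qed

lemma distr_gauss_component: "i \<le> d \<Longrightarrow> distr (gauss d) borel (\<lambda>z. z i) = std_gauss"
proof -
  assume i: "i \<le> d"
  have "distr (gauss d) borel (\<lambda>z. z i) = distr (gauss d) std_gauss (\<lambda>z. z i)"
    by (rule distr_cong) auto
  also have "\<dots> = std_gauss"
    unfolding gauss_def using i prob_space_std_gauss by (intro distr_PiM_component) auto
  finally show ?thesis .
qed

lemma std_gauss_singleton: "emeasure std_gauss {a} = 0"
proof -
  have "{a} \<in> null_sets lborel" by (simp add: null_sets_def)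
  then have "(\<integral>\<^sup>+ x. ennreal (std_normal_density x) * indicator {a} x \<partial>lborel) = 0"
    by (rule nn_integral_null_set)
  then show ?thesis by (simp add: emeasure_density)
qed

text \<open>Rotation invariance allows x to be the first basis vector, and a Gaussian coordinate has
  no atom at 0.\<close>

lemma AE_sdot_nonzero:
  assumes "d \<ge> 2" "sdot d x x = 1"
  shows "AE z in gauss d. sdot d z x \<noteq> 0"
proof -
  have u: "sdot d (plane_vec 1 0) (plane_vec 1 0) = 1" using assms by (simp add: sdot_plane_vec) (simp add: plane_vec_def)
  have "measure (gauss d) {z \<in> space (gauss d). (\<lambda>p. fst p = 0) (sdot d z x, sdot d z x, sdot d z z)} =
     measure (gauss d) {z \<in> space (gauss d). (\<lambda>p. fst p = 0) (sdot d z (plane_vec 1 0), sdot d z (plane_vec 1 0), sdot d z z)}"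
    using assms u by (intro gauss_measure_gram_eq) auto
  also have "\<dots> = measure (gauss d) {z \<in> space (gauss d). z 0 = 0}"
    using assms by (simp add: sdot_plane_vec)
  also have "\<dots> = measure (distr (gauss d) borel (\<lambda>z. z 0)) {0}"
    by (subst measure_distr) (auto intro!: arg_cong[where f="measure _"])
  also have "\<dots> = 0" by (simp add: distr_gauss_component measure_def std_gauss_singleton)
  finally have "measure (gauss d) {z \<in> space (gauss d). sdot d z x = 0} = 0" by simp
  then show ?thesis by (subst AE_iff_measurable[OF _ refl]) (auto simp: gauss.emeasure_eq_measure)
qed

lemma measurable_sgn_plus [measurable]: "sgn_plus \<in> measurable borel (count_space UNIV)"
  unfolding sgn_plus_def[abs_def] by measurable

text \<open>Cauchy's equation on an interval. Nonnegativity makes f monotone, so f x is squeezed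
  between its values at neighbouring multiples of T/m, where additivity forces linearity; then m
  tends to infinity. Additivity is asked only up to T because wedges are additive only up to the
  angle pi.\<close>

lemma additive_on_interval_linear:
  fixes f :: "real \<Rightarrow> real"
  assumes pos: "\<And>x. f x \<ge> 0" and add: "\<And>a b. a > 0 \<Longrightarrow> b > 0 \<Longrightarrow> a + b \<le> T \<Longrightarrow> f (a + b) = f a + f b"
    and T: "T > 0" and f0: "f 0 = 0" and x: "0 \<le> x" "x \<le> T"
  shows "f x = x / T * f T"
proof -
  have mono: "f a \<le> f b" if "0 \<le> a" "a \<le> b" "b \<le> T" for a b
  proof (cases "a = 0 \<or> a = b")
    case True then show ?thesis using pos f0 by auto
  next
    case False
    then have "f (a + (b - a)) = f a + f (b - a)" using that by (intro add) auto
    then show ?thesis using pos[of "b - a"] by simp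
  qed
  have mult: "f (real n * h) = real n * f h" if "h > 0" "real n * h \<le> T" for n h
    using that(2)
  proof (induction n)
    case 0 then show ?case by (simp add: f0)
  next
    case (Suc n)
    show ?case
    proof (cases "n = 0")
      case False
      have "f (real n * h + h) = f (real n * h) + f h"
        using Suc that False by (intro add) (auto simp: algebra_simps)
      then show ?thesis using Suc that by (simp add: algebra_simps)
    qed auto
  qed
  have bound: "\<bar>f x - x / T * f T\<bar> \<le> f T / real m" if m: "m \<ge> 1" for m :: nat
  proof (cases "x = T")
    case True then show ?thesis using T pos by simp
  next
    case False
    then have xT: "x < T" using x by simp
    define h where "h = T / real m"
    have h: "h > 0" "real m * h = T" using T m by (auto simp: h_def)
    have fh: "f h = f T / real m" using mult[of h m] h m by (simp add: field_simps)
    have "x / h = x * real m / T" using m by (simp add: h_def)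
    then have xh: "x / h * f h = x / T * f T" using m by (simp add: fh)
    define k where "k = nat \<lfloor>x / h\<rfloor>"
    have k: "real k * h \<le> x" "x < (real k + 1) * h"
    proof -
      have "real k = of_int \<lfloor>x / h\<rfloor>" using h x by (simp add: k_def)
      then have "real k \<le> x / h" "x / h < real k + 1" using floor_correct[of "x / h"] by auto
      then show "real k * h \<le> x" "x < (real k + 1) * h" using h by (auto simp: field_simps)
    qed
    have "real k * h < real m * h" using k xT h by simp
    then have "k < m" using h by (simp only: mult_less_cancel_right of_nat_less_iff) auto
    then have "k + 1 \<le> m" by simp
    then have k2: "real (k + 1) * h \<le> T" using h by (metis mult_right_mono of_nat_le_iff less_imp_le)
    have "f (real k * h) \<le> f x" using k h x by (intro mono) auto
    then have 1: "real k * f h \<le> f x" using mult[of h k] k x h by simp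
    have "f x \<le> f (real (k + 1) * h)" using k k2 x by (intro mono) (auto simp: add.commute)
    then have 2: "f x \<le> (real k + 1) * f h" using mult[of h "k + 1"] k2 h by (simp add: add.commute)
    have 3: "real k * f h \<le> x / T * f T"
    proof -
      have "real k \<le> x / h" using k h by (simp add: field_simps)
      then have "real k * f h \<le> x / h * f h" using pos by (intro mult_right_mono) auto
      also have "\<dots> = x / T * f T" using xh .
      finally show ?thesis .
    qed
    have 4: "x / T * f T \<le> (real k + 1) * f h"
    proof -
      have "x / h \<le> real k + 1" using k h by (simp add: field_simps)
      then have "x / h * f h \<le> (real k + 1) * f h" using pos by (intro mult_right_mono) auto
      then show ?thesis using xh by simp
    qed
    have "\<bar>f x - x / T * f T\<bar> \<le> f h"
      using 1 2 3 4 unfolding distrib_right by (simp only: abs_le_iff) linarith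
    then show ?thesis by (simp add: fh)
  qed
  have "(\<lambda>m. f T / real m) \<longlonglongrightarrow> 0" by (rule lim_const_over_n)
  then have "\<bar>f x - x / T * f T\<bar> \<le> 0"
    by (rule tendsto_lowerbound) (use bound in \<open>auto intro!: eventually_sequentiallyI[of 1]\<close>)
  then show ?thesis by simp
qed

lemma sdot_self_nonneg: "sdot d x x \<ge> 0"
  by (simp add: sdot_def sum_nonneg)

lemma sdot_diff_left: "sdot d (\<lambda>i. x i - y i) z = sdot d x z - sdot d y z"
  by (simp add: sdot_def left_diff_distrib sum_subtractf)

lemma sdot_diff_right: "sdot d z (\<lambda>i. x i - y i) = sdot d z x - sdot d z y"
  by (simp add: sdot_def right_diff_distrib sum_subtractf)

lemma sdot_scale_left: "sdot d (\<lambda>i. c * x i) y = c * sdot d x y"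
  by (simp add: sdot_def sum_distrib_left mult.assoc)

lemma sdot_scale_right: "sdot d x (\<lambda>i. c * y i) = c * sdot d x y"
  by (simp add: sdot_def sum_distrib_left mult_ac)

lemma sdot_Cauchy_Schwarz: "\<bar>sdot d x y\<bar> \<le> sqrt (sdot d x x) * sqrt (sdot d y y)"
proof -
  have "(sdot d x y)\<^sup>2 \<le> sdot d x x * sdot d y y"
    using Cauchy_Schwarz_ineq_sum[of x y "{..d}"] by (simp add: sdot_def power2_eq_square)
  then show ?thesis by (metis real_sqrt_abs real_sqrt_le_iff real_sqrt_mult)
qed

lemma sdot_unit_bounds:
  assumes "sdot d x x = 1" "sdot d y y = 1"
  shows "-1 \<le> sdot d x y" "sdot d x y \<le> 1"
  using sdot_Cauchy_Schwarz[of d x y] assms by auto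

definition wedge :: "nat \<Rightarrow> (nat \<Rightarrow> real) \<Rightarrow> (nat \<Rightarrow> real) \<Rightarrow> (nat \<Rightarrow> real) set" where
  "wedge d x y = {z \<in> space (gauss d). sgn_plus (sdot d z x) \<noteq> sgn_plus (sdot d z y)}"

lemma sets_wedge [measurable]: "wedge d x y \<in> sets (gauss d)"
  unfolding wedge_def by measurable

lemma measure_wedge_gram_eq:
  assumes "d \<ge> 2" "sdot d x x = 1" "sdot d y y = 1" "sdot d x' x' = 1" "sdot d y' y' = 1" "sdot d x y = sdot d x' y'"
  shows "measure (gauss d) (wedge d x y) = measure (gauss d) (wedge d x' y')"
  using gauss_measure_gram_eq[OF assms, of "\<lambda>p. sgn_plus (fst p) \<noteq> sgn_plus (fst (snd p))"]
  by (simp add: wedge_def)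

proposition measure_wedge:
  assumes d: "d \<ge> 2" and x: "sdot d x x = 1" and y: "sdot d y y = 1"
  shows "measure (gauss d) (wedge d x y) = geo_dist d x y"
proof -
  define e where "e t = plane_vec (cos t) (sin t)" for t
  have ze: "sdot d z (e t) = z 0 * cos t + z 1 * sin t" for z t using d by (simp add: e_def sdot_plane_vec)
  have ee: "sdot d (e a) (e b) = cos (b - a)" for a b
    unfolding ze by (simp add: e_def plane_vec_def cos_diff)
  define f where "f t = measure (gauss d) (wedge d (e 0) (e t))" for t
  have W: "measure (gauss d) (wedge d (e a) (e b)) = f (b - a)" for a b
    unfolding f_def using d ee by (intro measure_wedge_gram_eq) auto
  have nz: "AE z in gauss d. sdot d z (e t) \<noteq> 0" for t using d ee by (intro AE_sdot_nonzero) auto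
  have add: "f (a + b) = f a + f b" if ab: "a > 0" "b > 0" "a + b \<le> pi" for a b
  proof -
    have AE: "AE z in gauss d. (z \<in> wedge d (e 0) (e (a+b)) \<longleftrightarrow> z \<in> wedge d (e 0) (e a) \<union> wedge d (e a) (e (a+b))) \<and>
       \<not> (z \<in> wedge d (e 0) (e a) \<and> z \<in> wedge d (e a) (e (a+b)))"
      using nz[of 0] nz[of a] nz[of "a+b"]
    proof eventually_elim
      case (elim z)
      have s: "sin a > 0" "sin b > 0" "sin (a + b) \<ge> 0" using ab by (auto intro!: sin_gt_zero sin_ge_zero)
      \<comment> \<open>\<open>e a\<close> lies in the cone spanned by \<open>e 0\<close> and
        \<open>e (a + b)\<close>, so the sign patterns + - + and - + - are impossible. In the
        boundary case a + b = pi the left side vanishes and the argument still works. The remaining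
        patterns put z into exactly as many small wedges as large ones.\<close>
      have key: "sin (a+b) * sdot d z (e a) = sin b * sdot d z (e 0) + sin a * sdot d z (e (a + b))"
      proof -
        have "sin (a+b) * cos a = sin b + sin a * cos (a+b)"
          using sin_diff[of "a+b" a] by simp
        then have "z 0 * (sin (a+b) * cos a) = z 0 * (sin b + sin a * cos (a+b))" by simp
        then show ?thesis unfolding ze by (simp add: algebra_simps)
      qed
      have 1: False if "sdot d z (e 0) > 0" "sdot d z (e (a+b)) > 0" "sdot d z (e a) < 0"
      proof -
        have "sin b * sdot d z (e 0) + sin a * sdot d z (e (a + b)) > 0" using that s by (intro add_pos_pos mult_pos_pos) auto
        moreover have "sin (a+b) * sdot d z (e a) \<le> 0" using that s by (intro mult_nonneg_nonpos) auto
        ultimately show False using key by simp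
      qed
      have 2: False if "sdot d z (e 0) < 0" "sdot d z (e (a+b)) < 0" "sdot d z (e a) > 0"
      proof -
        have "sin b * sdot d z (e 0) + sin a * sdot d z (e (a + b)) < 0" using that s by (intro add_neg_neg mult_pos_neg) auto
        moreover have "sin (a+b) * sdot d z (e a) \<ge> 0" using that s by (intro mult_nonneg_nonneg) auto
        ultimately show False using key by simp
      qed
      show ?case using 1 2 elim by (auto simp: wedge_def sgn_plus_def not_le split: if_splits)
    qed
    have "f (a + b) = measure (gauss d) (wedge d (e 0) (e a) \<union> wedge d (e a) (e (a+b)))"
      unfolding f_def using AE by (intro gauss.finite_measure_eq_AE) (auto elim: eventually_mono)
    also have "\<dots> = measure (gauss d) (wedge d (e 0) (e a)) + measure (gauss d) (wedge d (e a) (e (a+b)))"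
      using AE by (intro measure_Un_AE) (auto elim: eventually_mono simp: fmeasurable_def less_top[symmetric])
    finally show ?thesis using W[of 0 a] W[of a "a + b"] by simp
  qed
  have f0: "f 0 = 0" by (simp add: f_def wedge_def)
  \<comment> \<open>Antipodal vectors give opposite signs except on the hyperplane z.e_0 = 0, where
    \<open>sgn_plus\<close> is 1 for both.\<close>
  have "AE z in gauss d. z \<in> wedge d (e 0) (e pi)"
    using nz[of 0] AE_space by eventually_elim (auto simp: wedge_def ze sgn_plus_def)
  then have fpi: "f pi = 1" unfolding f_def by (subst gauss.prob_eq_1) auto
  define t where "t = sdot d x y"
  have t: "-1 \<le> t" "t \<le> 1" using sdot_unit_bounds[OF x y] by (auto simp: t_def)
  have "measure (gauss d) (wedge d x y) = f (arccos t)"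
    unfolding f_def using ee[of 0 "arccos t"] ee[of 0 0] ee[of "arccos t" "arccos t"] t
    by (intro measure_wedge_gram_eq d x y) (simp_all add: t_def)
  also have "\<dots> = arccos t / pi"
  proof -
    have "f x \<ge> 0" for x by (simp add: f_def)
    then have "f (arccos t) = arccos t / pi * f pi"
      using add f0 arccos_lbound[of t] arccos_ubound[of t] t by (intro additive_on_interval_linear) auto
    then show ?thesis using fpi by simp
  qed
  finally show ?thesis by (simp add: geo_dist_def t_def)
qed

section \<open>Gaussian mass near a hyperplane\<close>

lemma std_gauss_interval_le: "0 \<le> r \<Longrightarrow> emeasure std_gauss {-r..r} \<le> ennreal r"
proof -
  assume r: "0 \<le> r"
  have le: "std_normal_density x \<le> 1 / 2" for x
  proof -
    have "2\<^sup>2 \<le> 2 * pi" using pi_gt3 by simp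
    then have "2 \<le> sqrt (2 * pi)" by (simp add: real_le_rsqrt)
    then have "1 / sqrt (2 * pi) * exp (- x\<^sup>2 / 2) \<le> 1 / 2 * 1"
      by (intro mult_mono) (auto simp: field_simps)
    then show ?thesis by (simp add: std_normal_density_def)
  qed
  have "emeasure std_gauss {-r..r} = (\<integral>\<^sup>+ x. ennreal (std_normal_density x) * indicator {-r..r} x \<partial>lborel)"
    by (simp add: emeasure_density)
  also have "\<dots> \<le> (\<integral>\<^sup>+ x. ennreal (1 / 2) * indicator {-r..r} x \<partial>lborel)"
    using le by (intro nn_integral_mono mult_right_mono ennreal_leI) auto
  also have "\<dots> = ennreal (1 / 2) * ennreal (2 * r)" using r by (subst nn_integral_cmult_indicator) (auto simp: mult.commute)
  also have "\<dots> = ennreal r" using r by (subst ennreal_mult[symmetric]) auto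
  finally show ?thesis .
qed

lemma nn_integral_abs_std_gauss_le: "(\<integral>\<^sup>+ x. ennreal \<bar>x\<bar> \<partial>std_gauss) \<le> 1"
proof -
  have "(\<integral>\<^sup>+ x. ennreal \<bar>x\<bar> \<partial>std_gauss) = (\<integral>\<^sup>+ x. ennreal (std_normal_density x * \<bar>x\<bar>) \<partial>lborel)"
    by (subst nn_integral_density) (auto simp: ennreal_mult)
  also have "\<dots> = ennreal (sqrt (2 / pi))"
    using integral_std_normal_moment_abs_odd[of 0] integrable_std_normal_moment_abs[of 1]
    by (subst nn_integral_eq_integral) auto
  also have "\<dots> \<le> 1" using pi_gt3 by simp
  finally show ?thesis .
qed

lemma sqrt_sdot_self_le: "sqrt (sdot d z z) \<le> (\<Sum>i\<le>d. \<bar>z i\<bar>)"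
proof -
  have "sdot d z z = (\<Sum>i\<le>d. \<bar>z i\<bar>\<^sup>2)" by (simp add: sdot_def power2_eq_square)
  then show ?thesis using L2_set_le_sum[of "{..d}" "\<lambda>i. \<bar>z i\<bar>"] by (simp add: L2_set_def)
qed

text \<open>After a rotation x is the first basis vector. Bounding |z| by the l1 norm |z_0| + S and
  using t \<le> 1/2 turns the condition into |z_0| \<le> 2 t S with S independent of z_0, so Fubini
  and E|z_i| \<le> 1 give 2 d t. For t > 1/2 the right side exceeds 1.\<close>

proposition measure_tube_le:
  assumes d: "d \<ge> 2" and x: "sdot d x x = 1" and t: "t \<ge> 0"
  shows "measure (gauss d) {z \<in> space (gauss d). \<bar>sdot d z x\<bar> \<le> t * sqrt (sdot d z z)} \<le> 2 * real d * t"
proof (cases "t \<le> 1 / 2")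
  case False
  then have "2 * real d * t \<ge> 2 * 1 * (1 / 2)" using d by (intro mult_mono) auto
  then show ?thesis using order_trans[OF gauss.prob_le_1] by simp
next
  case True
  define S where "S z = (\<Sum>i\<in>{1..d}. \<bar>z i\<bar>)" for z :: "nat \<Rightarrow> real"
  have split: "{..d} = insert 0 {1..d}" by auto
  have S0: "S z \<ge> 0" for z unfolding S_def by (intro sum_nonneg) auto
  have u: "sdot d (plane_vec 1 0) (plane_vec 1 0) = 1" using d by (simp add: sdot_plane_vec) (simp add: plane_vec_def)
  let ?A = "{z \<in> space (gauss d). \<bar>z 0\<bar> \<le> 2 * t * S z}"
  have Am [measurable]: "?A \<in> sets (gauss d)" unfolding S_def by measurable
  have "measure (gauss d) {z \<in> space (gauss d). \<bar>sdot d z x\<bar> \<le> t * sqrt (sdot d z z)} =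
     measure (gauss d) {z \<in> space (gauss d). \<bar>z 0\<bar> \<le> t * sqrt (sdot d z z)}"
    using gauss_measure_gram_eq[OF d x x u u, of "\<lambda>p. \<bar>fst p\<bar> \<le> t * sqrt (snd (snd p))"] x u d
    by (simp add: sdot_plane_vec)
  also have "\<dots> \<le> measure (gauss d) ?A"
  proof (intro gauss.finite_measure_mono Am subsetI)
    fix z assume z: "z \<in> {z \<in> space (gauss d). \<bar>z 0\<bar> \<le> t * sqrt (sdot d z z)}"
    have "t * sqrt (sdot d z z) \<le> t * (\<bar>z 0\<bar> + S z)"
      using sqrt_sdot_self_le[of d z] t by (intro mult_left_mono) (auto simp: split S_def)
    also have "\<dots> \<le> 1 / 2 * \<bar>z 0\<bar> + t * S z" using mult_right_mono[OF True abs_ge_zero[of "z 0"]] by (simp add: distrib_left)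
    finally have "\<bar>z 0\<bar> \<le> 2 * t * S z" using z by simp
    then show "z \<in> ?A" using z by simp
  qed
  also have "emeasure (gauss d) ?A \<le> ennreal (2 * real d * t)"
  proof -
    let ?I = "PiM {1..d} (\<lambda>_. std_gauss)"
    have "emeasure (gauss d) ?A = (\<integral>\<^sup>+ z. indicator ?A z \<partial>gauss d)" using Am by simp
    also have "\<dots> = (\<integral>\<^sup>+ w. \<integral>\<^sup>+ y. indicator ?A (w(0 := y)) \<partial>std_gauss \<partial>?I)"
      using Am unfolding gauss_def split by (intro gauss_product.product_nn_integral_insert) auto
    also have "\<dots> \<le> (\<integral>\<^sup>+ w. ennreal (2 * t * S w) \<partial>?I)"
    proof (rule nn_integral_mono)
      fix w assume w: "w \<in> space ?I"
      have "S (w(0 := y)) = S w" for y unfolding S_def by (intro sum.cong) auto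
      then have "(\<integral>\<^sup>+ y. indicator ?A (w(0 := y)) \<partial>std_gauss) \<le> (\<integral>\<^sup>+ y. indicator {- (2 * t * S w)..2 * t * S w} y \<partial>std_gauss)"
        by (intro nn_integral_mono) (auto simp: indicator_def abs_le_iff)
      also have "\<dots> = emeasure std_gauss {- (2 * t * S w)..2 * t * S w}" by simp
      also have "\<dots> \<le> ennreal (2 * t * S w)" using t S0 by (intro std_gauss_interval_le) auto
      finally show "(\<integral>\<^sup>+ y. indicator ?A (w(0 := y)) \<partial>std_gauss) \<le> ennreal (2 * t * S w)" .
    qed
    also have "\<dots> = (\<integral>\<^sup>+ w. ennreal (2 * t) * (\<Sum>i\<in>{1..d}. ennreal \<bar>w i\<bar>) \<partial>?I)"
      using t S0 by (intro nn_integral_cong) (simp add: S_def ennreal_mult sum_nonneg sum_ennreal)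
    also have "\<dots> = ennreal (2 * t) * (\<Sum>i\<in>{1..d}. \<integral>\<^sup>+ w. ennreal \<bar>w i\<bar> \<partial>?I)"
      by (subst nn_integral_cmult) (auto simp: nn_integral_sum simp del: sum_ennreal)
    also have "\<dots> \<le> ennreal (2 * t) * (\<Sum>i\<in>{1..d}. 1)"
    proof (intro mult_left_mono sum_mono)
      fix i assume i: "i \<in> {1..d}"
      have "(\<integral>\<^sup>+ w. ennreal \<bar>w i\<bar> \<partial>?I) = (\<integral>\<^sup>+ y. ennreal \<bar>y\<bar> \<partial>distr ?I std_gauss (\<lambda>w. w i))"
        using i by (subst nn_integral_distr) auto
      also have "distr ?I std_gauss (\<lambda>w. w i) = std_gauss"
        using i prob_space_std_gauss by (intro distr_PiM_component) auto
      finally show "(\<integral>\<^sup>+ w. ennreal \<bar>w i\<bar> \<partial>?I) \<le> 1" using nn_integral_abs_std_gauss_le by simp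
    qed auto
    also have "\<dots> = ennreal (2 * real d * t)"
      using t by (simp add: ennreal_of_nat_eq_real_of_nat ennreal_mult[symmetric] mult_ac)
    finally show ?thesis .
  qed
  then have "measure (gauss d) ?A \<le> 2 * real d * t"
    using t by (simp add: gauss.emeasure_eq_measure)
  finally show ?thesis .
qed

section \<open>Columns over the faces of the cube\<close>

lemma AE_sdot_nonzero':
  assumes "d \<ge> 2" "sdot d x x \<noteq> 0"
  shows "AE z in gauss d. sdot d z x \<noteq> 0"
proof -
  define r where "r = sqrt (sdot d x x)"
  have r: "r \<noteq> 0" "r * r = sdot d x x" using assms sdot_self_nonneg[of d x] by (auto simp: r_def)
  have "sdot d (\<lambda>i. (1 / r) * x i) (\<lambda>i. (1 / r) * x i) = 1"
    unfolding sdot_scale_left sdot_scale_right r(2)[symmetric] using r(1) by simp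
  from AE_sdot_nonzero[OF assms(1) this] show ?thesis
    unfolding sdot_scale_right by (auto elim: eventually_mono)
qed

text \<open>LEAST breaks ties, so that every vector belongs to exactly one face.\<close>

definition face :: "nat \<Rightarrow> (nat \<Rightarrow> real) \<Rightarrow> nat" where
  "face d z = (LEAST k. k \<le> d \<and> (\<forall>i\<le>d. \<bar>z i\<bar> \<le> \<bar>z k\<bar>))"

definition fibre_index :: "nat \<Rightarrow> nat" where
  "fibre_index k = (if k = 0 then 1 else 0)"

text \<open>At the zero vector division by zero gives the value 0, so the bounds -1 and 1 hold
  without exception.\<close>

definition fibre_coord :: "nat \<Rightarrow> (nat \<Rightarrow> real) \<Rightarrow> real" where
  "fibre_coord d z = z (fibre_index (face d z)) / z (face d z)"

(* The minimum puts the endpoint v = 1 into the last of the m cells of [-1,1]. *)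
definition grid_cell :: "nat \<Rightarrow> real \<Rightarrow> nat" where
  "grid_cell m v = min (m - 1) (nat \<lfloor>(v + 1) * real m / 2\<rfloor>)"

(* A column consists of the z with given face k and given grid cells of z_j / z_k for all j except k
   and one further index, the coordinate along which the column is cut into pieces. *)
definition column_label :: "nat \<Rightarrow> nat \<Rightarrow> (nat \<Rightarrow> real) \<Rightarrow> nat \<times> (nat \<Rightarrow> nat)" where
  "column_label d m z = (face d z, \<lambda>j\<in>{..d} - {face d z, fibre_index (face d z)}. grid_cell m (z j / z (face d z)))"

lemma face_le: "face d z \<le> d" and face_max: "i \<le> d \<Longrightarrow> \<bar>z i\<bar> \<le> \<bar>z (face d z)\<bar>"
proof -
  have "finite ((\<lambda>i. \<bar>z i\<bar>) ` {..d})" "(\<lambda>i. \<bar>z i\<bar>) ` {..d} \<noteq> {}" by auto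
  then have "Max ((\<lambda>i. \<bar>z i\<bar>) ` {..d}) \<in> (\<lambda>i. \<bar>z i\<bar>) ` {..d}" by (rule Max_in)
  then obtain k where k: "k \<le> d" "\<bar>z k\<bar> = Max ((\<lambda>i. \<bar>z i\<bar>) ` {..d})" by (metis (lifting) atMost_iff imageE)
  then have "k \<le> d \<and> (\<forall>i\<le>d. \<bar>z i\<bar> \<le> \<bar>z k\<bar>)" by auto
  then have "face d z \<le> d \<and> (\<forall>i\<le>d. \<bar>z i\<bar> \<le> \<bar>z (face d z)\<bar>)" unfolding face_def by (rule LeastI)
  then show "face d z \<le> d" "i \<le> d \<Longrightarrow> \<bar>z i\<bar> \<le> \<bar>z (face d z)\<bar>" by auto
qed

lemma face_eqI:
  assumes "k \<le> d" "\<And>i. i \<le> d \<Longrightarrow> i \<noteq> k \<Longrightarrow> \<bar>z i\<bar> < \<bar>z k\<bar>"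
  shows "face d z = k"
  using face_max[of k d z] face_le[of d z] assms by (metis not_le)

lemma face_zero: "z (face d z) = 0 \<longleftrightarrow> (\<forall>i\<le>d. z i = 0)"
  using face_max[of _ d z] face_le[of d z] by auto

lemma fibre_index_le: "d \<ge> 1 \<Longrightarrow> fibre_index k \<le> d" and fibre_index_neq: "fibre_index k \<noteq> k"
  by (auto simp: fibre_index_def)

lemma measurable_coord: "i \<le> d \<Longrightarrow> (\<lambda>z. z i) \<in> borel_measurable (gauss d)"
  by (simp add: measurable_component_singleton)

lemma measurable_face [measurable]: "face d \<in> measurable (gauss d) (count_space UNIV)"
proof -
  have "Measurable.pred (gauss d) (\<lambda>z. k \<le> d \<and> (\<forall>i\<in>{..d}. \<bar>z i\<bar> \<le> \<bar>z k\<bar>))" for k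
  proof (cases "k \<le> d")
    case True
    have "Measurable.pred (gauss d) (\<lambda>z. \<bar>z i\<bar> \<le> \<bar>z k\<bar>)" if "i \<in> {..d}" for i
      using measurable_coord[of i d] measurable_coord[OF True] that
      by (intro borel_measurable_le[unfolded pred_def[symmetric]] borel_measurable_abs) auto
    then have "Measurable.pred (gauss d) (\<lambda>z. \<forall>i\<in>{..d}. \<bar>z i\<bar> \<le> \<bar>z k\<bar>)"
      by (intro pred_intros_finite) auto
    then show ?thesis using True by simp
  qed simp
  then have "Measurable.pred (gauss d) (\<lambda>z. k \<le> d \<and> (\<forall>i\<le>d. \<bar>z i\<bar> \<le> \<bar>z k\<bar>))" for k
    by (simp only: Ball_def atMost_iff)
  then show ?thesis unfolding face_def[abs_def] by (rule measurable_Least)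
qed

lemma abs_ratio_face_le: "i \<le> d \<Longrightarrow> \<bar>z i / z (face d z)\<bar> \<le> 1"
  using face_max[of i d z] by (cases "z (face d z) = 0") (auto simp: abs_divide field_simps)

lemma fibre_coord_bounds: "d \<ge> 1 \<Longrightarrow> -1 \<le> fibre_coord d z \<and> fibre_coord d z \<le> 1"
proof -
  assume "d \<ge> 1"
  then have "\<bar>fibre_coord d z\<bar> \<le> 1" unfolding fibre_coord_def by (intro abs_ratio_face_le fibre_index_le)
  then show ?thesis by linarith
qed

lemma measurable_fibre_coord [measurable]:
  assumes "d \<ge> 1"
  shows "fibre_coord d \<in> borel_measurable (gauss d)"
proof -
  have "fibre_coord d z = (\<Sum>k\<le>d. if face d z = k then z (fibre_index k) / z k else 0)" for z
    using face_le[of d z] by (simp add: fibre_coord_def)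
  moreover have "(\<lambda>z. \<Sum>k\<le>d. if face d z = k then z (fibre_index k) / z k else 0) \<in> borel_measurable (gauss d)"
    using fibre_index_le[OF assms] by (intro borel_measurable_sum) (auto intro!: measurable_If borel_measurable_divide measurable_component_singleton)
  ultimately show ?thesis by presburger
qed

lemma sdot_unit_vec: "k \<le> d \<Longrightarrow> sdot d z (\<lambda>i. if i = k then c else 0) = z k * c"
  by (simp add: sdot_def if_distrib cong: if_cong)

lemma AE_coord_nonzero:
  assumes "d \<ge> 2" "k \<le> d"
  shows "AE z in gauss d. z k \<noteq> 0"
  using AE_sdot_nonzero'[of d "\<lambda>i. if i = k then 1 else 0"] assms by (simp add: sdot_unit_vec)

text \<open>Up to null sets the level set lies in finitely many hyperplanes, one for each face. The
  condition z_k \<noteq> 0 excludes the vectors at which the ratio is a division by zero.\<close>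

lemma fibre_coord_null:
  assumes d: "d \<ge> 2"
  shows "measure (gauss d) {z \<in> space (gauss d). fibre_coord d z = t} = 0"
proof -
  have "AE z in gauss d. \<forall>k\<in>{..d}. z k \<noteq> 0 \<and> z (fibre_index k) - t * z k \<noteq> 0"
  proof (intro AE_finite_allI AE_conjI)
    fix k assume k: "k \<in> {..d}"
    show "AE z in gauss d. z k \<noteq> 0" using d k by (intro AE_coord_nonzero) auto
    define x where "x i = (if i = fibre_index k then 1 else 0) - (if i = k then t else 0)" for i
    have s: "sdot d z x = z (fibre_index k) - t * z k" for z
      unfolding x_def sdot_diff_right using k d fibre_index_le[of d k] by (simp add: sdot_unit_vec mult.commute)
    have "sdot d x x = 1 + t * t" unfolding s using fibre_index_neq[of k] by (auto simp: x_def)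
    then have "sdot d x x \<noteq> 0" by (metis add_le_same_cancel1 le_minus_one_simps(3) not_one_le_zero zero_le_square add_eq_0_iff)
    from AE_sdot_nonzero'[OF d this] show "AE z in gauss d. z (fibre_index k) - t * z k \<noteq> 0" by (simp add: s)
  qed auto
  then have "AE z in gauss d. fibre_coord d z \<noteq> t"
  proof eventually_elim
    case (elim z)
    then have "z (face d z) \<noteq> 0 \<and> z (fibre_index (face d z)) - t * z (face d z) \<noteq> 0" using face_le[of d z] by auto
    then show ?case by (auto simp: fibre_coord_def field_simps)
  qed
  then have "AE z in gauss d. z \<notin> {z \<in> space (gauss d). fibre_coord d z = t}" by (rule eventually_mono) auto
  moreover have "{z \<in> space (gauss d). fibre_coord d z = t} \<in> sets (gauss d)"
  proof -
    have [measurable]: "fibre_coord d \<in> borel_measurable (gauss d)" using d by (intro measurable_fibre_coord) auto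
    show ?thesis by measurable
  qed
  ultimately show ?thesis by (simp add: gauss.prob_eq_0)
qed

definition column :: "nat \<Rightarrow> nat \<Rightarrow> nat \<times> (nat \<Rightarrow> nat) \<Rightarrow> (nat \<Rightarrow> real) set" where
  "column d m l = {z \<in> space (gauss d). column_label d m z = l}"

definition column_labels :: "nat \<Rightarrow> nat \<Rightarrow> (nat \<times> (nat \<Rightarrow> nat)) set" where
  "column_labels d m = (SIGMA k:{..d}. ({..d} - {k, fibre_index k}) \<rightarrow>\<^sub>E {..<m})"

lemma column_label_in: "m \<ge> 1 \<Longrightarrow> column_label d m z \<in> column_labels d m"
  by (auto simp: column_label_def column_labels_def face_le grid_cell_def PiE_iff extensional_def)

lemma finite_column_labels: "finite (column_labels d m)"
  unfolding column_labels_def by (intro finite_SigmaI finite_PiE) auto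

lemma card_column_labels:
  assumes "d \<ge> 1"
  shows "card (column_labels d m) = (d + 1) * m ^ (d - 1)"
proof -
  have "card (({..d} - {k, fibre_index k}) \<rightarrow>\<^sub>E {..<m}) = m ^ (d - 1)" if "k \<in> {..d}" for k
  proof -
    have "card ({..d} - {k, fibre_index k}) = d - 1"
      using that assms fibre_index_le[of d k] fibre_index_neq[of k] by (subst card_Diff_subset) auto
    then show ?thesis by (simp add: card_PiE)
  qed
  then show ?thesis unfolding column_labels_def by (subst card_SigmaI) (auto intro: finite_PiE)
qed

lemma sets_column [measurable]: "column d m l \<in> sets (gauss d)"
proof -
  obtain k g where l: "l = (k, g)" by (cases l)
  define J where "J = {..d} - {k, fibre_index k}"
  show ?thesis
  proof (cases "k \<le> d \<and> g \<in> extensional J")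
    case True
    have e: "column d m l = {z \<in> space (gauss d). face d z = k \<and> (\<forall>j\<in>J. grid_cell m (z j / z k) = g j)}"
      using True unfolding l column_def column_label_def J_def
      by (auto simp: fun_eq_iff extensional_def restrict_def split: if_splits)
    show ?thesis unfolding e grid_cell_def using True by (measurable; auto simp: J_def)
  next
    case False
    then have "column d m l = {}"
      unfolding l column_def column_label_def J_def using face_le by auto
    then show ?thesis by simp
  qed
qed

text \<open>The standard normal density at 1, hence its minimum on [-1,1].\<close>

definition gauss_floor :: real where
  "gauss_floor = exp (- 1 / 2) / sqrt (2 * pi)"

lemma gauss_floor_pos: "gauss_floor > 0" by (simp add: gauss_floor_def)

lemma std_normal_density_ge: "\<bar>x\<bar> \<le> 1 \<Longrightarrow> std_normal_density x \<ge> gauss_floor"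
  unfolding std_normal_density_def gauss_floor_def
  by (auto simp: divide_right_mono abs_square_le_1)

lemma std_gauss_interval_ge:
  assumes "-1 \<le> a" "a \<le> b" "b \<le> 1"
  shows "emeasure std_gauss {a<..<b} \<ge> ennreal (gauss_floor * (b - a))"
proof -
  have "ennreal (gauss_floor * (b - a)) = (\<integral>\<^sup>+ x. ennreal gauss_floor * indicator {a<..<b} x \<partial>lborel)"
    using assms gauss_floor_pos by (subst nn_integral_cmult_indicator) (auto simp: ennreal_mult)
  also have "\<dots> \<le> (\<integral>\<^sup>+ x. ennreal (std_normal_density x) * indicator {a<..<b} x \<partial>lborel)"
    using assms std_normal_density_ge by (intro nn_integral_mono) (auto simp: indicator_def intro!: ennreal_leI)
  also have "\<dots> = emeasure std_gauss {a<..<b}" by (simp add: emeasure_density)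
  finally show ?thesis .
qed

lemma nn_integral_power_std_gauss_ge:
  "(\<integral>\<^sup>+ y. ennreal (y ^ n) * indicator {0<..<1} y \<partial>std_gauss) \<ge> ennreal (gauss_floor / (real n + 1))"
proof -
  have "ennreal (gauss_floor / (real n + 1)) = ennreal gauss_floor * ennreal (1 / (real n + 1))"
    using gauss_floor_pos by (simp add: ennreal_mult[symmetric])
  also have "ennreal (1 / (real n + 1)) = (\<integral>\<^sup>+ y. ennreal (y ^ n) * indicator {0..1} y \<partial>lborel)"
  proof -
    have "((\<lambda>y. y ^ Suc n / (real n + 1)) has_real_derivative y ^ n) (at y)" for y :: real
      using DERIV_cdivide[OF DERIV_pow[of "Suc n" y], of "real n + 1"] by (simp add: add.commute)
    then show ?thesis by (subst nn_integral_FTC_Icc[where F="\<lambda>y. y ^ Suc n / (real n + 1)"]) auto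
  qed
  also have "\<dots> = (\<integral>\<^sup>+ y. ennreal (y ^ n) * indicator {0<..<1} y \<partial>lborel)"
  proof (intro nn_integral_cong_AE)
    show "AE y in lborel. ennreal (y ^ n) * indicator {0..1} y = ennreal (y ^ n) * indicator {0<..<1} (y :: real)"
      using AE_lborel_singleton[of "0::real"] AE_lborel_singleton[of "1::real"]
      by eventually_elim (auto simp: indicator_def)
  qed
  also have "ennreal gauss_floor * \<dots> = (\<integral>\<^sup>+ y. ennreal gauss_floor * (ennreal (y ^ n) * indicator {0<..<1} y) \<partial>lborel)"
    by (intro nn_integral_cmult[symmetric]) auto
  also have "\<dots> \<le> (\<integral>\<^sup>+ y. ennreal (std_normal_density y) * (ennreal (y ^ n) * indicator {0<..<1} y) \<partial>lborel)"
    using std_normal_density_ge by (intro nn_integral_mono) (auto simp: indicator_def intro!: mult_right_mono ennreal_leI)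
  also have "\<dots> = (\<integral>\<^sup>+ y. ennreal (y ^ n) * indicator {0<..<1} y \<partial>std_gauss)"
    by (subst nn_integral_density) auto
  finally show ?thesis .
qed

text \<open>At height z_k = y in (0,1) the slice is a box with sides (b_j - a_j) y inside [-1,1]^d,
  where the density of each coordinate is at least \<open>gauss_floor\<close>. The slices scale like
  y^d, and integrating over y produces the factor 1/(d+1).\<close>

lemma gauss_cone_ge:
  assumes k: "k \<le> d" and ab: "\<And>j. j \<in> {..d} - {k} \<Longrightarrow> -1 \<le> a j \<and> a j \<le> b j \<and> b j \<le> 1"
  shows "measure (gauss d) {z \<in> space (gauss d). 0 < z k \<and> z k < 1 \<and> (\<forall>j\<in>{..d} - {k}. a j * z k < z j \<and> z j < b j * z k)}
     \<ge> gauss_floor ^ (d + 1) / (real d + 1) * (\<Prod>j\<in>{..d} - {k}. b j - a j)"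
proof -
  define J where "J = {..d} - {k}"
  have J: "{..d} = insert k J" "finite J" "k \<notin> J" "card J = d" using k by (auto simp: J_def)
  let ?A = "{z \<in> space (gauss d). 0 < z k \<and> z k < 1 \<and> (\<forall>j\<in>J. a j * z k < z j \<and> z j < b j * z k)}"
  let ?I = "PiM J (\<lambda>_. std_gauss)"
  define p where "p = gauss_floor ^ d * (\<Prod>j\<in>J. b j - a j)"
  have p0: "(\<Prod>j\<in>J. b j - a j) \<ge> 0" using ab by (intro prod_nonneg) (auto simp: J_def)
  have p: "p \<ge> 0" using p0 gauss_floor_pos by (simp add: p_def)
  have Am [measurable]: "?A \<in> sets (gauss d)" unfolding J_def by (measurable; use k in auto)
  have "ennreal (gauss_floor ^ (d + 1) / (real d + 1) * (\<Prod>j\<in>J. b j - a j)) = ennreal p * ennreal (gauss_floor / (real d + 1))"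
    using p gauss_floor_pos by (subst ennreal_mult[symmetric]) (auto simp: p_def mult_ac)
  also have "\<dots> \<le> ennreal p * (\<integral>\<^sup>+ y. ennreal (y ^ d) * indicator {0<..<1} y \<partial>std_gauss)"
    by (intro mult_left_mono nn_integral_power_std_gauss_ge) auto
  also have "\<dots> = (\<integral>\<^sup>+ y. ennreal p * (ennreal (y ^ d) * indicator {0<..<1} y) \<partial>std_gauss)"
    by (intro nn_integral_cmult[symmetric]) auto
  also have "\<dots> \<le> (\<integral>\<^sup>+ y. \<integral>\<^sup>+ w. indicator ?A (w(k := y)) \<partial>?I \<partial>std_gauss)"
  proof (rule nn_integral_mono)
    fix y :: real
    show "ennreal p * (ennreal (y ^ d) * indicator {0<..<1} y) \<le> (\<integral>\<^sup>+ w. indicator ?A (w(k := y)) \<partial>?I)"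
    proof (cases "0 < y \<and> y < 1")
      case False then show ?thesis by auto
    next
      case True
      have cb: "-1 \<le> a j * y" "a j * y \<le> b j * y" "b j * y \<le> 1" if "j \<in> J" for j
      proof -
        have ab': "-1 \<le> a j" "a j \<le> b j" "b j \<le> 1" using ab[of j] that by (auto simp: J_def)
        show "a j * y \<le> b j * y" using ab' True by (intro mult_right_mono) auto
        have "b j * y \<le> 1 * y" using ab' True by (intro mult_right_mono) auto
        then show "b j * y \<le> 1" using True by linarith
        have "-1 * y \<le> a j * y" using ab' True by (intro mult_right_mono) auto
        then show "-1 \<le> a j * y" using True by linarith
      qed
      have "ennreal p * (ennreal (y ^ d) * indicator {0<..<1} y) = ennreal (\<Prod>j\<in>J. gauss_floor * (b j * y - a j * y))"
      proof -
        have "(\<Prod>j\<in>J. gauss_floor * (b j * y - a j * y)) = (\<Prod>j\<in>J. (gauss_floor * (b j - a j)) * y)"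
          by (simp add: algebra_simps)
        also have "\<dots> = p * y ^ d" by (simp only: prod.distrib prod_constant J(4) p_def)
        finally show ?thesis using True p by (simp add: ennreal_mult)
      qed
      also have "\<dots> = (\<Prod>j\<in>J. ennreal (gauss_floor * (b j * y - a j * y)))"
        using cb gauss_floor_pos by (intro prod_ennreal[symmetric]) auto
      also have "\<dots> \<le> (\<Prod>j\<in>J. emeasure std_gauss {a j * y<..<b j * y})"
        using cb by (intro prod_mono_ennreal std_gauss_interval_ge)
      also have "\<dots> = emeasure ?I (Pi\<^sub>E J (\<lambda>j. {a j * y<..<b j * y}))"
        using J(2) by (intro gauss_product.emeasure_PiM[symmetric]) auto
      also have "\<dots> = (\<integral>\<^sup>+ w. indicator (Pi\<^sub>E J (\<lambda>j. {a j * y<..<b j * y})) w \<partial>?I)"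
        using J(2) by (intro nn_integral_indicator[symmetric] sets_PiM_I_finite) auto
      also have "\<dots> \<le> (\<integral>\<^sup>+ w. indicator ?A (w(k := y)) \<partial>?I)"
      proof (rule nn_integral_mono)
        fix w assume w: "w \<in> space ?I"
        then have "w(k := y) \<in> space (gauss d)" by (auto simp: space_gauss J(1) space_PiM PiE_iff extensional_def)
        then show "indicator (Pi\<^sub>E J (\<lambda>j. {a j * y<..<b j * y})) w \<le> (indicator ?A (w(k := y)) :: ennreal)"
          using True J(3) by (auto simp: indicator_def PiE_iff)
      qed
      finally show ?thesis .
    qed
  qed
  also have "\<dots> = (\<integral>\<^sup>+ z. indicator ?A z \<partial>gauss d)"
  proof -
    have "indicator ?A \<in> borel_measurable (PiM (insert k J) (\<lambda>_. std_gauss))"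
      using Am unfolding gauss_def J(1) by (rule borel_measurable_indicator)
    from gauss_product.product_nn_integral_insert_rev[OF J(2,3) this] show ?thesis
      unfolding gauss_def J(1) by (rule sym)
  qed
  also have "\<dots> = ennreal (measure (gauss d) ?A)" using Am by (simp add: gauss.emeasure_eq_measure)
  finally show ?thesis unfolding J_def[symmetric] by (simp add: measure_nonneg)
qed

section \<open>Pieces crossing a wedge\<close>

lemma grid_cell_eqI:
  assumes "g < m" "-1 + 2 * real g / real m < v" "v < -1 + 2 * (real g + 1) / real m"
  shows "grid_cell m v = g"
proof -
  have m: "real m > 0" using assms(1) by simp
  have "real g < (v + 1) * real m / 2" "(v + 1) * real m / 2 < real g + 1"
    using assms(2,3) m by (auto simp: field_simps)
  then have "\<lfloor>(v + 1) * real m / 2\<rfloor> = int g" by (intro floor_unique) auto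
  then show ?thesis using assms(1) by (simp add: grid_cell_def)
qed

lemma grid_cell_bounds:
  assumes "m \<ge> 1" "-1 \<le> v" "v \<le> 1"
  shows "-1 + 2 * real (grid_cell m v) / real m \<le> v" "v \<le> -1 + 2 * (real (grid_cell m v) + 1) / real m"
proof -
  define t where "t = (v + 1) * real m / 2"
  have m: "real m > 0" using assms(1) by simp
  have "0 \<le> (v + 1) * real m" using assms by simp
  moreover have "(v + 1) * real m \<le> 2 * real m" using assms by (intro mult_right_mono) auto
  ultimately have t: "0 \<le> t" "t \<le> real m" by (auto simp: t_def)
  have fl: "real (nat \<lfloor>t\<rfloor>) \<le> t" "t < real (nat \<lfloor>t\<rfloor>) + 1" using t floor_correct[of t] by auto
  have c: "real (grid_cell m v) \<le> t \<and> t \<le> real (grid_cell m v) + 1"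
  proof (cases "nat \<lfloor>t\<rfloor> \<le> m - 1")
    case True then show ?thesis using fl by (simp add: grid_cell_def t_def[symmetric] min_absorb2)
  next
    case False
    then have "real m \<le> real (nat \<lfloor>t\<rfloor>)" using assms(1) by linarith
    moreover have "grid_cell m v = m - 1" using False by (simp add: grid_cell_def t_def[symmetric] min_absorb1)
    moreover have "real m \<le> t" using calculation(1) fl(1) by linarith
    ultimately show ?thesis using t assms(1) by (simp add: of_nat_diff)
  qed
  have v: "v = -1 + 2 * t / real m" using m by (simp add: t_def)
  show "-1 + 2 * real (grid_cell m v) / real m \<le> v" using c m by (subst (2) v) (simp add: divide_right_mono)
  show "v \<le> -1 + 2 * (real (grid_cell m v) + 1) / real m" using c m by (subst (1) v) (simp add: divide_right_mono)
qed

text \<open>Read in reverse, this bounds the length b - a of a piece of mass 1/N from above. The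
  piece contains a cone with z_k in (0,1) whose strict inequalities fix both the face and the grid
  cells.\<close>

lemma column_piece_ge:
  assumes d: "d \<ge> 2" and m: "m \<ge> 1" and l: "(k, g) \<in> column_labels d m" and ab: "-1 \<le> a" "a \<le> b" "b \<le> 1"
  shows "measure (gauss d) {z \<in> column d m (k, g). a < fibre_coord d z \<and> fibre_coord d z \<le> b}
     \<ge> gauss_floor ^ (d + 1) / (real d + 1) * (2 / real m) ^ (d - 1) * (b - a)"
proof -
  have k: "k \<le> d" and g: "g \<in> ({..d} - {k, fibre_index k}) \<rightarrow>\<^sub>E {..<m}" using l by (auto simp: column_labels_def)
  define J where "J = {..d} - {k, fibre_index k}"
  have fk: "fibre_index k \<le> d" "fibre_index k \<noteq> k" using fibre_index_le[of d k] fibre_index_neq d by auto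
  have J: "{..d} - {k} = insert (fibre_index k) J" "fibre_index k \<notin> J" "finite J" using fk by (auto simp: J_def)
  have cJ: "card J = d - 1" unfolding J_def using k fk by (subst card_Diff_subset) auto
  have gm: "g j < m" if "j \<in> J" for j using g that by (auto simp: J_def PiE_iff)
  define \<alpha> where "\<alpha> j = (if j = fibre_index k then a else -1 + 2 * real (g j) / real m)" for j
  define \<beta> where "\<beta> j = (if j = fibre_index k then b else -1 + 2 * (real (g j) + 1) / real m)" for j
  have \<alpha>\<beta>: "-1 \<le> \<alpha> j \<and> \<alpha> j \<le> \<beta> j \<and> \<beta> j \<le> 1" if "j \<in> {..d} - {k}" for j
  proof (cases "j = fibre_index k")
    case True then show ?thesis using ab by (simp add: \<alpha>_def \<beta>_def)
  next
    case False
    then have "g j < m" using that gm by (auto simp: J_def)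
    then have "real (g j) + 1 \<le> real m" by linarith
    then have "2 * (real (g j) + 1) / real m \<le> 2" using m by (simp add: field_simps)
    then show ?thesis using False m by (simp add: \<alpha>_def \<beta>_def divide_right_mono)
  qed
  let ?A = "{z \<in> space (gauss d). 0 < z k \<and> z k < 1 \<and> (\<forall>j\<in>{..d} - {k}. \<alpha> j * z k < z j \<and> z j < \<beta> j * z k)}"
  have "gauss_floor ^ (d + 1) / (real d + 1) * (2 / real m) ^ (d - 1) * (b - a) =
     gauss_floor ^ (d + 1) / (real d + 1) * (\<Prod>j\<in>{..d} - {k}. \<beta> j - \<alpha> j)"
  proof -
    have "(\<Prod>j\<in>{..d} - {k}. \<beta> j - \<alpha> j) = (b - a) * (\<Prod>j\<in>J. \<beta> j - \<alpha> j)"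
      unfolding J(1) using J by (subst prod.insert) (auto simp: \<alpha>_def \<beta>_def)
    also have "(\<Prod>j\<in>J. \<beta> j - \<alpha> j) = (\<Prod>j\<in>J. 2 / real m)"
      using J(2) m by (intro prod.cong refl) (auto simp: \<alpha>_def \<beta>_def field_simps)
    finally show ?thesis by (simp add: cJ mult_ac)
  qed
  also have "\<dots> \<le> measure (gauss d) ?A" using k \<alpha>\<beta> by (rule gauss_cone_ge)
  also have "\<dots> \<le> measure (gauss d) {z \<in> column d m (k, g). a < fibre_coord d z \<and> fibre_coord d z \<le> b}"
  proof (intro gauss.finite_measure_mono subsetI)
    fix z assume z: "z \<in> ?A"
    then have zk: "0 < z k" by simp
    have r: "\<alpha> j < z j / z k" "z j / z k < \<beta> j" if "j \<in> {..d} - {k}" for j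
      using z that zk by (auto simp: field_simps)
    have face: "face d z = k"
    proof (rule face_eqI[OF k])
      fix i assume i: "i \<le> d" "i \<noteq> k"
      then have "-1 < z i / z k" "z i / z k < 1" using r[of i] \<alpha>\<beta>[of i] by auto
      then have "- z k < z i" "z i < z k" using zk by (auto simp: field_simps)
      then show "\<bar>z i\<bar> < \<bar>z k\<bar>" by auto
    qed
    have "grid_cell m (z j / z k) = g j" if "j \<in> J" for j
    proof (rule grid_cell_eqI[OF gm[OF that]])
      have j: "j \<in> {..d} - {k}" "j \<noteq> fibre_index k" using that by (auto simp: J_def)
      show "- 1 + 2 * real (g j) / real m < z j / z k" "z j / z k < - 1 + 2 * (real (g j) + 1) / real m"
        using r[OF j(1)] j(2) by (auto simp: \<alpha>_def \<beta>_def)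
    qed
    then have "column_label d m z = (k, g)"
      using g unfolding column_label_def face J_def[symmetric] by (auto simp: fun_eq_iff PiE_iff extensional_def)
    moreover have "fibre_index k \<in> {..d} - {k}" using fk by auto
    then have "a < fibre_coord d z" "fibre_coord d z < b"
      using r[of "fibre_index k"] by (auto simp: fibre_coord_def face \<alpha>_def \<beta>_def)
    ultimately show "z \<in> {z \<in> column d m (k, g). a < fibre_coord d z \<and> fibre_coord d z \<le> b}"
      using z by (auto simp: column_def)
  next
    have [measurable]: "fibre_coord d \<in> borel_measurable (gauss d)" using d by (intro measurable_fibre_coord) auto
    have "{z \<in> space (gauss d). a < fibre_coord d z \<and> fibre_coord d z \<le> b} \<in> sets (gauss d)" by measurable
    moreover have "{z \<in> column d m (k, g). a < fibre_coord d z \<and> fibre_coord d z \<le> b} =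
      column d m (k, g) \<inter> {z \<in> space (gauss d). a < fibre_coord d z \<and> fibre_coord d z \<le> b}" by (auto simp: column_def)
    ultimately show "{z \<in> column d m (k, g). a < fibre_coord d z \<and> fibre_coord d z \<le> b} \<in> sets (gauss d)"
      using sets_column[of d m] by auto
  qed
  finally show ?thesis .
qed

section \<open>Tubes, and the signs taken on a small piece\<close>

definition snorm :: "nat \<Rightarrow> (nat \<Rightarrow> real) \<Rightarrow> real" where
  "snorm d x = sqrt (sdot d x x)"

lemma snorm_L2_set: "snorm d x = L2_set x {..d}"
  by (simp add: snorm_def sdot_def L2_set_def power2_eq_square)

lemma snorm_nonneg [simp]: "snorm d x \<ge> 0"
  by (simp add: snorm_def sdot_self_nonneg)

lemma snorm_scale: "snorm d (\<lambda>i. c * x i) = \<bar>c\<bar> * snorm d x"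
  unfolding snorm_def sdot_scale_left sdot_scale_right by (simp add: real_sqrt_mult mult.assoc[symmetric])

lemma snorm_triangle: "snorm d x \<le> snorm d y + snorm d (\<lambda>i. x i - y i)"
  using L2_set_triangle_ineq[of y "\<lambda>i. x i - y i" "{..d}"] by (simp add: snorm_L2_set)

lemma abs_sdot_le: "\<bar>sdot d x y\<bar> \<le> snorm d x * snorm d y"
  using sdot_Cauchy_Schwarz by (simp add: snorm_def)

lemma snorm_ge_coord: "i \<le> d \<Longrightarrow> \<bar>x i\<bar> \<le> snorm d x"
  using member_le_sum[of i "{..d}" "\<lambda>i. x i * x i"] by (simp add: snorm_def sdot_def real_le_rsqrt power2_eq_square)

lemma snorm_le_bound:
  assumes "\<And>i. i \<le> d \<Longrightarrow> i \<noteq> k \<Longrightarrow> \<bar>x i\<bar> \<le> c" "k \<le> d" "x k = 0" "c \<ge> 0"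
  shows "snorm d x \<le> c * sqrt (real d)"
proof -
  have "sdot d x x = (\<Sum>i\<in>{..d} - {k}. (x i)\<^sup>2)"
    unfolding sdot_def using assms by (subst sum.remove[of _ k]) (auto simp: power2_eq_square)
  also have "\<dots> \<le> (\<Sum>i\<in>{..d} - {k}. c\<^sup>2)" using assms by (intro sum_mono abs_le_square_iff[THEN iffD1]) auto
  also have "\<dots> = c\<^sup>2 * real d" using assms(2) by (simp add: card_Diff_subset)
  finally have "sqrt (sdot d x x) \<le> sqrt (c\<^sup>2 * real d)" by simp
  then show ?thesis using assms(4) by (simp add: snorm_def real_sqrt_mult)
qed

text \<open>For a unit vector x, the directions whose angle with the hyperplane orthogonal to x has
  sine at most t. The vector x is left unnormalised because net points are only roughly unit
  vectors.\<close>

definition tube :: "nat \<Rightarrow> real \<Rightarrow> (nat \<Rightarrow> real) \<Rightarrow> (nat \<Rightarrow> real) set" where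
  "tube d t x = {z \<in> space (gauss d). \<bar>sdot d z x\<bar> \<le> t * snorm d z}"

lemma sets_tube [measurable]: "tube d t x \<in> sets (gauss d)"
  unfolding tube_def snorm_def by measurable

text \<open>Normalising a vector of length at least 1/2 at most doubles the width of its
  tube.\<close>

lemma measure_tube_le':
  assumes d: "d \<ge> 2" and x: "snorm d x \<ge> 1 / 2" and t: "t \<ge> 0"
  shows "measure (gauss d) (tube d t x) \<le> 4 * real d * t"
proof -
  define r where "r = snorm d x"
  have r: "r \<ge> 1 / 2" using x by (simp add: r_def)
  have rr: "sdot d x x = r * r" by (simp add: r_def snorm_def sdot_self_nonneg)
  have u: "sdot d (\<lambda>i. (1 / r) * x i) (\<lambda>i. (1 / r) * x i) = 1"
    unfolding sdot_scale_left sdot_scale_right rr using r by simp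
  have "measure (gauss d) (tube d t x) \<le> measure (gauss d) {z \<in> space (gauss d). \<bar>sdot d z (\<lambda>i. (1 / r) * x i)\<bar> \<le> (2 * t) * sqrt (sdot d z z)}"
  proof (intro gauss.finite_measure_mono subsetI)
    fix z assume z: "z \<in> tube d t x"
    have "\<bar>sdot d z x\<bar> \<le> t * snorm d z" using z by (simp add: tube_def)
    also have "\<dots> = 2 * t * snorm d z * (1 / 2)" by simp
    also have "\<dots> \<le> 2 * t * snorm d z * r" using r t by (intro mult_left_mono) auto
    finally have "\<bar>sdot d z (\<lambda>i. (1 / r) * x i)\<bar> \<le> (2 * t) * snorm d z"
      unfolding sdot_scale_right using r by (simp add: abs_mult field_simps)
    then show "z \<in> {z \<in> space (gauss d). \<bar>sdot d z (\<lambda>i. (1 / r) * x i)\<bar> \<le> (2 * t) * sqrt (sdot d z z)}"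
      using z by (simp add: tube_def snorm_def)
  qed measurable
  also have "\<dots> \<le> 2 * real d * (2 * t)" using d u t by (intro measure_tube_le) auto
  finally show ?thesis by simp
qed

lemma wedge_iff:
  assumes "z \<in> space (gauss d)" "sdot d z x \<noteq> 0" "sdot d z y \<noteq> 0"
  shows "z \<in> wedge d x y \<longleftrightarrow> sdot d z x * sdot d z y < 0"
  using assms by (auto simp: wedge_def sgn_plus_def mult_less_0_iff)

definition piece :: "nat \<Rightarrow> nat \<Rightarrow> nat \<times> (nat \<Rightarrow> nat) \<Rightarrow> real \<Rightarrow> real \<Rightarrow> (nat \<Rightarrow> real) set" where
  "piece d m l a b = {z \<in> column d m l. a < fibre_coord d z \<and> fibre_coord d z \<le> b}"

text \<open>After division by the k-th coordinate the k-th entries are both 1, and each other entry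
  varies by at most one grid cell, 2/m, or by the fibre interval, b - a. Both are at most 2h, and d
  such entries give the factor sqrt d.\<close>

lemma piece_close:
  assumes d: "d \<ge> 2" and m: "m \<ge> 1" "1 / real m \<le> h" "b - a \<le> 2 * h"
    and z: "z \<in> piece d m (k, g) a b" "snorm d z \<noteq> 0" and w: "w \<in> piece d m (k, g) a b" "snorm d w \<noteq> 0"
  shows "k \<le> d" "z k \<noteq> 0" "w k \<noteq> 0" "snorm d (\<lambda>i. z i / z k - w i / w k) \<le> 2 * h * sqrt (real d)"
proof -
  have lz: "column_label d m z = (k, g)" and lw: "column_label d m w = (k, g)" using z w by (auto simp: piece_def column_def)
  have fz: "face d z = k" and fw: "face d w = k" using lz lw by (auto simp: column_label_def)
  show k: "k \<le> d" using fz face_le by metis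
  have nz: "x (face d x) \<noteq> 0" if "snorm d x \<noteq> 0" for x
  proof
    assume "x (face d x) = 0"
    then have "sdot d x x = 0" unfolding face_zero by (simp add: sdot_def)
    then show False using that by (simp add: snorm_def)
  qed
  show zk: "z k \<noteq> 0" and wk: "w k \<noteq> 0" using nz[of z] nz[of w] fz fw z w by auto
  have h: "h \<ge> 0" using m(2) by (smt (verit) divide_nonneg_nonneg of_nat_0_le_iff)
  have "\<bar>z i / z k - w i / w k\<bar> \<le> 2 * h" if i: "i \<le> d" "i \<noteq> k" for i
  proof (cases "i = fibre_index k")
    case True
    have "z i / z k = fibre_coord d z" "w i / w k = fibre_coord d w" using True fz fw by (auto simp: fibre_coord_def)
    then show ?thesis using z(1) w(1) m(3) by (auto simp: piece_def)
  next
    case False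
    then have iJ: "i \<in> {..d} - {k, fibre_index k}" using i by auto
    have "snd (column_label d m z) i = g i" "snd (column_label d m w) i = g i" using lz lw by simp_all
    then have "grid_cell m (z i / z k) = g i" "grid_cell m (w i / w k) = g i"
      using iJ unfolding column_label_def fz fw by simp_all
    moreover have "-1 \<le> z i / z k \<and> z i / z k \<le> 1" "-1 \<le> w i / w k \<and> w i / w k \<le> 1"
      using abs_ratio_face_le[OF i(1), of z] abs_ratio_face_le[OF i(1), of w] unfolding fz fw by linarith+
    ultimately have "-1 + 2 * real (g i) / real m \<le> z i / z k" "z i / z k \<le> -1 + 2 * (real (g i) + 1) / real m"
       "-1 + 2 * real (g i) / real m \<le> w i / w k" "w i / w k \<le> -1 + 2 * (real (g i) + 1) / real m"
      using grid_cell_bounds[OF m(1)] by metis+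
    then have "\<bar>z i / z k - w i / w k\<bar> \<le> 2 * (real (g i) + 1) / real m - 2 * real (g i) / real m" by linarith
    also have "\<dots> = 2 * (1 / real m)" using m(1) by (simp add: field_simps)
    finally show ?thesis using m(2) by linarith
  qed
  then show "snorm d (\<lambda>i. z i / z k - w i / w k) \<le> 2 * h * sqrt (real d)"
    using k zk wk h by (intro snorm_le_bound[of d k]) auto
qed

text \<open>The width 6 h sqrt d is three times the diameter H of the piece in projective
  coordinates U, V: passing from U to V changes the product with x by at most 2H, as |x| \<le> 2,
  and changes \<eta>|U| by at most H, while |U| \<ge> 1. Signs are compared after division by the
  k-th coordinates because z and w may lie in opposite halves of the piece.\<close>

lemma piece_side:
  assumes d: "d \<ge> 2" and m: "m \<ge> 1" "1 / real m \<le> h" "b - a \<le> 2 * h"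
    and z: "z \<in> piece d m (k, g) a b" "snorm d z \<noteq> 0" and w: "w \<in> piece d m (k, g) a b" "snorm d w \<noteq> 0"
    and x: "snorm d x \<le> 2" and \<eta>: "0 \<le> \<eta>" "\<eta> \<le> 1" and out: "z \<notin> tube d (\<eta> + 6 * h * sqrt (real d)) x"
  shows "w \<notin> tube d \<eta> x" "(sdot d z x / z k) * (sdot d w x / w k) > 0"
proof -
  note c = piece_close[OF d m z w]
  define H where "H = 2 * h * sqrt (real d)"
  define U where "U i = z i / z k" for i
  define V where "V i = w i / w k" for i
  have Us: "U = (\<lambda>i. (1 / z k) * z i)" and Vs: "V = (\<lambda>i. (1 / w k) * w i)" by (auto simp: U_def V_def)
  have Ux: "sdot d U x = sdot d z x / z k" and Vx: "sdot d V x = sdot d w x / w k" unfolding Us Vs sdot_scale_left by simp_all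
  have nU: "snorm d U = snorm d z / \<bar>z k\<bar>" and nV: "snorm d V = snorm d w / \<bar>w k\<bar>"
    unfolding Us Vs snorm_scale by (auto simp: abs_divide)
  have H: "snorm d (\<lambda>i. U i - V i) \<le> H" using c(4) by (simp add: U_def V_def H_def)
  have H0: "H \<ge> 0" using H snorm_nonneg order_trans by blast
  have "\<bar>U k\<bar> \<le> snorm d U" by (intro snorm_ge_coord c)
  then have U1: "snorm d U \<ge> 1" using c(2) by (simp add: U_def)
  have zs: "z \<in> space (gauss d)" "w \<in> space (gauss d)" using z w by (auto simp: piece_def column_def)
  have "\<bar>sdot d z x\<bar> > (\<eta> + 3 * H) * snorm d z"
  proof -
    have "3 * H = 6 * h * sqrt (real d)" by (simp add: H_def)
    then show ?thesis using out zs(1) unfolding tube_def by (simp only: mem_Collect_eq simp_thms not_le)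
  qed
  then have "\<bar>sdot d z x\<bar> / \<bar>z k\<bar> > (\<eta> + 3 * H) * snorm d z / \<bar>z k\<bar>" using c(2) by (simp add: divide_strict_right_mono)
  then have big: "\<bar>sdot d U x\<bar> > (\<eta> + 3 * H) * snorm d U" by (simp add: Ux nU abs_divide)
  have "\<bar>sdot d U x - sdot d V x\<bar> \<le> snorm d (\<lambda>i. U i - V i) * snorm d x"
    using abs_sdot_le[of d "\<lambda>i. U i - V i" x] by (simp add: sdot_diff_left)
  also have "\<dots> \<le> H * 2" using H x H0 by (intro mult_mono) auto
  finally have diff: "\<bar>sdot d U x - sdot d V x\<bar> \<le> H * 2" .
  have "snorm d V \<le> snorm d U + snorm d (\<lambda>i. V i - U i)" by (rule snorm_triangle)
  also have "snorm d (\<lambda>i. V i - U i) = snorm d (\<lambda>i. U i - V i)"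
    using snorm_scale[of d "-1" "\<lambda>i. U i - V i"] by simp
  finally have "snorm d V \<le> snorm d U + H" using H by simp
  then have "\<eta> * snorm d V \<le> \<eta> * (snorm d U + H)" using \<eta> by (intro mult_left_mono)
  also have "\<dots> \<le> \<eta> * snorm d U + 1 * H" using mult_right_mono[OF \<eta>(2) H0] by (simp add: distrib_left)
  finally have etaV: "\<eta> * snorm d V \<le> \<eta> * snorm d U + H" by simp
  have "3 * H * 1 \<le> 3 * H * snorm d U" using U1 H0 by (intro mult_left_mono) auto
  then have big2: "\<bar>sdot d U x\<bar> > \<eta> * snorm d U + 3 * H" using big by (simp add: distrib_right)
  then have "\<bar>sdot d V x\<bar> > \<eta> * snorm d V" using etaV diff by linarith
  then have "\<bar>sdot d w x\<bar> > \<eta> * snorm d w" using c(3) by (simp add: Vx nV abs_divide divide_strict_right_mono field_simps)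
  then show "w \<notin> tube d \<eta> x" by (simp add: tube_def)
  have "\<eta> * snorm d U \<ge> 0" using \<eta> by simp
  then have "\<bar>sdot d U x - sdot d V x\<bar> < \<bar>sdot d U x\<bar>" using big2 diff H0 by linarith
  then have "sdot d U x * sdot d V x > 0"
    by (cases "sdot d U x > 0") (auto simp: zero_less_mult_iff abs_if split: if_splits)
  then show "(sdot d z x / z k) * (sdot d w x / w k) > 0" by (simp add: Ux Vx)
qed

text \<open>Outside the tubes a perturbation of x and y by at most \<eta> does not change a sign, so
  the brackets of finitely many pairs enclose all wedges.\<close>

definition inner_bracket :: "nat \<Rightarrow> real \<Rightarrow> (nat \<Rightarrow> real) \<Rightarrow> (nat \<Rightarrow> real) \<Rightarrow> (nat \<Rightarrow> real) set" where
  "inner_bracket d \<eta> x y = wedge d x y - (tube d \<eta> x \<union> tube d \<eta> y)"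

definition outer_bracket :: "nat \<Rightarrow> real \<Rightarrow> (nat \<Rightarrow> real) \<Rightarrow> (nat \<Rightarrow> real) \<Rightarrow> (nat \<Rightarrow> real) set" where
  "outer_bracket d \<eta> x y = wedge d x y \<union> (tube d \<eta> x \<union> tube d \<eta> y)"

lemma sets_inner_bracket [measurable]: "inner_bracket d \<eta> x y \<in> sets (gauss d)"
  and sets_outer_bracket [measurable]: "outer_bracket d \<eta> x y \<in> sets (gauss d)"
  unfolding inner_bracket_def outer_bracket_def by measurable

text \<open>One point outside both thickened tubes keeps all of R outside the \<eta>-tubes, where
  brackets and wedge coincide, and fixes both signs on R up to a common flip. Wedge membership
  depends only on the product of the signs, so it is constant on R and R cannot cross E.\<close>

lemma crossing_piece_in_tubes:
  assumes d: "d \<ge> 2" and m: "m \<ge> 1" "1 / real m \<le> h" "b - a \<le> 2 * h"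
    and R: "R \<subseteq> piece d m l a b" "\<And>z. z \<in> R \<Longrightarrow> snorm d z \<noteq> 0"
    and x: "snorm d x \<le> 2" and y: "snorm d y \<le> 2" and \<eta>: "0 \<le> \<eta>" "\<eta> \<le> 1"
    and E: "E = inner_bracket d \<eta> x y \<or> E = outer_bracket d \<eta> x y"
    and cross: "R \<inter> E \<noteq> {}" "\<not> R \<subseteq> E"
  shows "R \<subseteq> tube d (\<eta> + 6 * h * sqrt (real d)) x \<union> tube d (\<eta> + 6 * h * sqrt (real d)) y"
proof (rule ccontr)
  assume "\<not> ?thesis"
  then obtain z where z: "z \<in> R" "z \<notin> tube d (\<eta> + 6 * h * sqrt (real d)) x" "z \<notin> tube d (\<eta> + 6 * h * sqrt (real d)) y" by auto
  obtain k g where l: "l = (k, g)" by (cases l)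
  have zp: "z \<in> piece d m (k, g) a b" "snorm d z \<noteq> 0" using z R l by auto
  have same: "w \<in> E \<longleftrightarrow> sdot d z x / z k * (sdot d z y / z k) < 0" if w: "w \<in> R" for w
  proof -
    have wp: "w \<in> piece d m (k, g) a b" "snorm d w \<noteq> 0" using w R l by auto
    note sx = piece_side[OF d m zp wp x \<eta> z(2)] and sy = piece_side[OF d m zp wp y \<eta> z(3)]
    have ws: "w \<in> space (gauss d)" using wp by (auto simp: piece_def column_def)
    have "w \<in> E \<longleftrightarrow> w \<in> wedge d x y" using E sx(1) sy(1) by (auto simp: inner_bracket_def outer_bracket_def)
    also have "\<dots> \<longleftrightarrow> sdot d w x * sdot d w y < 0" using sx(2) sy(2) by (intro wedge_iff ws) auto
    also have "\<dots> \<longleftrightarrow> sdot d w x / w k * (sdot d w y / w k) < 0"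
    proof -
      have "w k * w k > 0" using piece_close(3)[OF d m zp wp] by (metis not_real_square_gt_zero)
      then show ?thesis by (simp add: divide_less_0_iff)
    qed
    also have "\<dots> \<longleftrightarrow> sdot d z x / z k * (sdot d z y / z k) < 0"
      using sx(2) sy(2) by (metis linorder_neqE mult_less_0_iff not_less_iff_gr_or_eq zero_less_mult_iff)
    finally show ?thesis .
  qed
  then show False using cross by blast
qed

lemma gauss_floor_ge: "gauss_floor \<ge> 1 / 5"
proof -
  have "(exp (1 / 2) * sqrt (2 * pi))\<^sup>2 = exp 1 * (2 * pi)"
    by (simp add: power_mult_distrib exp_double[symmetric])
  also have "\<dots> \<le> 3 * (2 * 4)" using exp_le pi_less_4 by (intro mult_mono) auto
  also have "\<dots> \<le> 5\<^sup>2" by simp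
  finally have "exp (1 / 2) * sqrt (2 * pi) \<le> 5" by (rule power2_le_imp_le) simp
  then have "1 / 5 \<le> 1 / (exp (1 / 2) * sqrt (2 * pi))" by (intro divide_left_mono) auto
  also have "\<dots> = gauss_floor" by (simp add: gauss_floor_def exp_minus field_simps)
  finally show ?thesis .
qed

text \<open>Puts the mass constant in the form c^d, so that it can be absorbed by scaling the mesh
  with a factor independent of d.\<close>

lemma gauss_floor_power_ge:
  assumes "d \<ge> 2"
  shows "gauss_floor ^ (d + 1) / (real d + 1) \<ge> (1 / 30) ^ d"
proof -
  have "5 * (real d + 1) \<le> 6 ^ d"
    using assms by (induction d rule: nat_induct_at_least) auto
  then have "5 * (real d + 1) * 5 ^ d \<le> 6 ^ d * 5 ^ d" by (intro mult_right_mono) auto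
  also have "\<dots> = 30 ^ d" by (simp add: power_mult_distrib[symmetric])
  finally have "5 ^ (d + 1) * (real d + 1) \<le> 30 ^ d" by (simp add: algebra_simps)
  then have "1 / 30 ^ d \<le> 1 / (5 ^ (d + 1) * (real d + 1))" by (intro divide_left_mono) auto
  also have "\<dots> = (1 / 5) ^ (d + 1) / (real d + 1)" by (simp add: power_divide)
  also have "\<dots> \<le> gauss_floor ^ (d + 1) / (real d + 1)" using gauss_floor_ge by (intro divide_right_mono power_mono) auto
  finally show ?thesis by (simp add: power_divide)
qed

lemma column_label_scale:
  assumes "d \<ge> 1" "c > 0" "\<And>k. k \<le> d \<Longrightarrow> w k = c * z k"
  shows "column_label d m w = column_label d m z" "fibre_coord d w = fibre_coord d z"
proof -
  have "(k \<le> d \<and> (\<forall>i\<le>d. \<bar>w i\<bar> \<le> \<bar>w k\<bar>)) \<longleftrightarrow> (k \<le> d \<and> (\<forall>i\<le>d. \<bar>z i\<bar> \<le> \<bar>z k\<bar>))" for k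
    using assms by (auto simp: abs_mult)
  then have f: "face d w = face d z" by (simp add: face_def)
  have r: "w i / w (face d z) = z i / z (face d z)" if "i \<le> d" for i
    using assms face_le[of d z] that by simp
  show "column_label d m w = column_label d m z" using r unfolding column_label_def f by (auto simp: fun_eq_iff)
  show "fibre_coord d w = fibre_coord d z" using r[OF fibre_index_le[OF assms(1)]] unfolding fibre_coord_def f .
qed

text \<open>Crossing pieces are either bad, at most one per column, or contained in two tubes of
  width of order sqrt d / M with M = N^(1/d). As the pieces have mass 1/N and are disjoint, the tube
  estimate counts the latter.\<close>

proposition ex_jittered_pieces:
  assumes d: "d \<ge> 2" and N: "N \<ge> 1" and \<eta>: "0 \<le> \<eta>" "\<eta> \<le> 1 / real N powr (1 / real d)"
  obtains P where "\<And>i. i \<in> {1..N} \<Longrightarrow> P i \<in> sets (gauss d)" "\<And>i. i \<in> {1..N} \<Longrightarrow> measure (gauss d) (P i) = 1 / real N"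
    "disjoint_family_on P {1..N}" "\<And>i z. i \<in> {1..N} \<Longrightarrow> z \<in> P i \<Longrightarrow> snorm d z \<noteq> 0"
    "\<And>i j z w c. i \<in> {1..N} \<Longrightarrow> j \<in> {1..N} \<Longrightarrow> z \<in> P i \<Longrightarrow> w \<in> P j \<Longrightarrow> c > 0 \<Longrightarrow> \<forall>k\<le>d. w k = c * z k \<Longrightarrow> i = j"
    "\<And>x y E. 1 / 2 \<le> snorm d x \<Longrightarrow> snorm d x \<le> 2 \<Longrightarrow> 1 / 2 \<le> snorm d y \<Longrightarrow> snorm d y \<le> 2 \<Longrightarrow>
       E = inner_bracket d \<eta> x y \<or> E = outer_bracket d \<eta> x y \<Longrightarrow>
       real (card {i \<in> {1..N}. P i \<inter> E \<noteq> {} \<and> \<not> P i \<subseteq> E}) \<le> 1500 * (real d * sqrt (real d)) * real N / real N powr (1 / real d)"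
proof -
  define M where "M = real N powr (1 / real d)"
  have M1: "M \<ge> 1" using N by (simp add: M_def ge_one_powr_ge_zero)
  have Md: "M ^ d = real N" using N d by (simp add: M_def powr_realpow[symmetric] powr_powr)
  \<comment> \<open>The 15 makes 2/m \<ge> 30/M, which compensates the base 30 in the lower bound
    for masses, and still leaves 1/m \<le> 30/M once M \<ge> 15.\<close>
  define m where "m = max 1 (nat \<lfloor>M / 15\<rfloor>)"
  have m1: "m \<ge> 1" by (simp add: m_def)
  define n where "n = (d + 1) * m ^ (d - 1)"
  have n: "card (column_labels d m) = n" using card_column_labels[of d m] d by (simp add: n_def)
  obtain e where e: "bij_betw e {0..<n} (column_labels d m)"
    using ex_bij_betw_nat_finite[OF finite_column_labels[of d m]] n by auto
  define Q where "Q c = column d m (e c)" for c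
  have em: "e c \<in> column_labels d m" if "c < n" for c using e that by (auto simp: bij_betw_def)
  have cover: "(\<Union>c<n. Q c) = space (gauss d)"
  proof -
    have "\<exists>c<n. z \<in> Q c" if "z \<in> space (gauss d)" for z
    proof -
      have "column_label d m z \<in> e ` {0..<n}" using column_label_in[OF m1] e by (simp add: bij_betw_def)
      then show ?thesis using that by (auto simp: Q_def column_def)
    qed
    then show ?thesis by (auto simp: Q_def column_def)
  qed
  have disjQ: "disjoint_family_on Q {..<n}"
  proof -
    have "e c \<noteq> e c'" if "c < n" "c' < n" "c \<noteq> c'" for c c'
      using e that by (auto simp: bij_betw_def inj_on_def)
    then show ?thesis by (auto simp: disjoint_family_on_def Q_def column_def)
  qed
  obtain P0 where P0: "\<And>i. i \<in> {1..N} \<Longrightarrow> P0 i \<in> sets (gauss d)" "\<And>i. i \<in> {1..N} \<Longrightarrow> measure (gauss d) (P0 i) = 1 / real N"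
    and disj: "disjoint_family_on P0 {1..N}"
    and inv: "\<And>i x y. (\<forall>c<n. x \<in> Q c \<longleftrightarrow> y \<in> Q c) \<Longrightarrow> fibre_coord d x = fibre_coord d y \<Longrightarrow> i \<in> {1..N} \<Longrightarrow> x \<in> P0 i \<Longrightarrow> y \<in> P0 i"
    and bad: "card {i \<in> {1..N}. \<not> (\<exists>c<n. \<exists>a b. -1 \<le> a \<and> a \<le> b \<and> b \<le> 1 \<and> P0 i = {x \<in> Q c. a < fibre_coord d x \<and> fibre_coord d x \<le> b})} \<le> n"
  proof -
    have "\<exists>P. (\<forall>i\<in>{1..N}. P i \<in> sets (gauss d) \<and> measure (gauss d) (P i) = 1 / real N) \<and> disjoint_family_on P {1..N} \<and>
    (\<forall>i x y. (\<forall>c<n. x \<in> Q c \<longleftrightarrow> y \<in> Q c) \<longrightarrow> fibre_coord d x = fibre_coord d y \<longrightarrow> i \<in> {1..N} \<longrightarrow> x \<in> P i \<longrightarrow> y \<in> P i) \<and>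
    card {i \<in> {1..N}. \<not> (\<exists>c<n. \<exists>a b. -1 \<le> a \<and> a \<le> b \<and> b \<le> 1 \<and> P i = {x \<in> Q c. a < fibre_coord d x \<and> fibre_coord d x \<le> b})} \<le> n"
    proof (rule gauss.equal_mass_pieces[OF N _ disjQ cover])
      show "Q c \<in> sets (gauss d)" for c by (simp add: Q_def sets_column)
      show "fibre_coord d \<in> borel_measurable (gauss d)" using d by (intro measurable_fibre_coord) auto
      show "-1 \<le> fibre_coord d x \<and> fibre_coord d x \<le> 1" for x using d by (intro fibre_coord_bounds) auto
      show "measure (gauss d) {x \<in> space (gauss d). fibre_coord d x = t} = 0" for t by (rule fibre_coord_null[OF d])
    qed
    then show ?thesis using that by blast
  qed
  \<comment> \<open>Removing the null set of zero vectors gives every point of a piece a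
    direction.\<close>
  define Z where "Z = {z \<in> space (gauss d). snorm d z \<noteq> 0}"
  have Zm: "Z \<in> sets (gauss d)" unfolding Z_def snorm_def by measurable
  have "AE z in gauss d. z 0 \<noteq> 0" using d by (intro AE_coord_nonzero) auto
  then have AEZ: "AE z in gauss d. z \<in> Z"
    using AE_space
  proof eventually_elim
    case (elim z)
    have "\<bar>z 0\<bar> \<le> snorm d z" by (rule snorm_ge_coord) simp
    then show ?case using elim by (auto simp: Z_def)
  qed
  define P where "P i = P0 i \<inter> Z" for i
  have P: "P i \<in> sets (gauss d)" "measure (gauss d) (P i) = 1 / real N" if "i \<in> {1..N}" for i
  proof -
    show Pm: "P i \<in> sets (gauss d)" using P0(1)[OF that] Zm by (simp add: P_def)
    have "measure (gauss d) (P i) = measure (gauss d) (P0 i)"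
      using Pm P0(1)[OF that] AEZ by (intro gauss.finite_measure_eq_AE) (auto simp: P_def elim: eventually_mono)
    then show "measure (gauss d) (P i) = 1 / real N" using P0(2)[OF that] by simp
  qed
  have Pdisj: "disjoint_family_on P {1..N}" using disj by (auto simp: P_def disjoint_family_on_def)
  \<comment> \<open>Label and fibre coordinate depend only on ratios of coordinates, so a ray never
    meets two pieces. This makes the N sampled points distinct on the sphere.\<close>
  have direction: "i = j" if "i \<in> {1..N}" "j \<in> {1..N}" "z \<in> P i" "w \<in> P j" "c > 0" "\<forall>k\<le>d. w k = c * z k" for i j z w c
  proof -
    have s: "z \<in> space (gauss d)" "w \<in> space (gauss d)" using that by (auto simp: P_def Z_def)
    have l: "column_label d m w = column_label d m z" "fibre_coord d w = fibre_coord d z"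
      using column_label_scale(1)[of d c w z m] column_label_scale(2)[of d c w z] that d by auto
    have "w \<in> P0 i" using that by (intro inv[of z w]) (use s l in \<open>auto simp: Q_def column_def P_def\<close>)
    moreover have "w \<in> P0 j" using that by (simp add: P_def)
    ultimately show ?thesis using disj that(1,2) unfolding disjoint_family_on_def by blast
  qed
  have crossing: "real (card {i \<in> {1..N}. P i \<inter> E \<noteq> {} \<and> \<not> P i \<subseteq> E}) \<le> 1500 * (real d * sqrt (real d)) * real N / M"
    if x: "1 / 2 \<le> snorm d x" "snorm d x \<le> 2" and y: "1 / 2 \<le> snorm d y" "snorm d y \<le> 2"
      and E: "E = inner_bracket d \<eta> x y \<or> E = outer_bracket d \<eta> x y" for x y E
  proof -
    define C where "C = {i \<in> {1..N}. P i \<inter> E \<noteq> {} \<and> \<not> P i \<subseteq> E}"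
    have CN: "C \<subseteq> {1..N}" by (auto simp: C_def)
    then have finC: "finite C" by (rule finite_subset) simp
    have sd: "sqrt (real d) \<ge> 1" "real d \<ge> 1" using d by auto
    have dsd: "1 \<le> real d * sqrt (real d)" "real d \<le> real d * sqrt (real d)" using mult_mono[of 1 "real d" 1 "sqrt (real d)"] sd by auto
    show ?thesis
    proof (cases "M < 15")
      case True
      have "card C \<le> card {1..N}" using CN by (intro card_mono) auto
      then have "real (card C) \<le> real N" by simp
      also have "\<dots> \<le> real N * (1500 / M)" using mult_left_mono[of 1 "1500 / M" "real N"] True M1 by simp
      also have "\<dots> \<le> 1500 * (real d * sqrt (real d)) * real N / M"
        using mult_right_mono[OF dsd(1), of "1500 * real N / M"] M1 by (simp add: mult_ac)
      finally show ?thesis by (simp add: C_def)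
    next
      case False
      then have M15: "M \<ge> 15" by simp
      define h where "h = 30 / M"
      have h: "h > 0" using M1 by (simp add: h_def)
      have mfl: "real m \<le> M / 15" "M / 15 < real m + 1"
      proof -
        have "1 \<le> \<lfloor>M / 15\<rfloor>" using M15 by simp
        then have "real m = of_int \<lfloor>M / 15\<rfloor>" by (simp add: m_def max_absorb2 nat_le_iff le_nat_iff)
        then show "real m \<le> M / 15" "M / 15 < real m + 1" using floor_correct[of "M / 15"] by auto
      qed
      have mh: "1 / real m \<le> h"
      proof -
        have "M / 15 < 2 * real m" using mfl m1 by linarith
        then show ?thesis using M1 m1 by (simp add: h_def field_simps)
      qed
      define Bad where "Bad = {i \<in> {1..N}. \<not> (\<exists>c<n. \<exists>a b. -1 \<le> a \<and> a \<le> b \<and> b \<le> 1 \<and> P0 i = {x \<in> Q c. a < fibre_coord d x \<and> fibre_coord d x \<le> b})}"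
      have Bad: "card Bad \<le> n" using bad unfolding Bad_def .
      have finBad: "finite Bad" unfolding Bad_def by (rule finite_subset[of _ "{1..N}"]) blast+
      define \<tau> where "\<tau> = \<eta> + 6 * h * sqrt (real d)"
      define T where "T = tube d \<tau> x \<union> tube d \<tau> y"
      have Tm: "T \<in> sets (gauss d)" by (simp add: T_def sets_tube sets.Un)
      \<comment> \<open>181 = 1 + 6 * 30: one unit bounds \<eta>, the rest is 6 h sqrt d with h =
        30/M. The two tubes then give 8 * 181 = 1448.\<close>
      have \<tau>: "0 \<le> \<tau>" "\<tau> \<le> 181 * sqrt (real d) / M"
      proof -
        show "0 \<le> \<tau>" using \<eta> h by (simp add: \<tau>_def)
        have "1 / M \<le> sqrt (real d) / M" using sd(1) M1 by (intro divide_right_mono) auto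
        then have "\<eta> \<le> sqrt (real d) / M" using \<eta>(2) unfolding M_def[symmetric] by linarith
        moreover have "\<tau> = \<eta> + 180 * (sqrt (real d) / M)" by (simp add: \<tau>_def h_def)
        ultimately show "\<tau> \<le> 181 * sqrt (real d) / M" by simp
      qed
      have PT: "P i \<subseteq> T" if i: "i \<in> C - Bad" for i
      proof -
        have iN: "i \<in> {1..N}" using i CN by blast
        have "\<exists>c<n. \<exists>a b. -1 \<le> a \<and> a \<le> b \<and> b \<le> 1 \<and> P0 i = {x \<in> Q c. a < fibre_coord d x \<and> fibre_coord d x \<le> b}"
          using i iN unfolding Bad_def by blast
        then obtain c a b where c: "c < n" and ab: "-1 \<le> a" "a \<le> b" "b \<le> 1" and Pi: "P0 i = {x \<in> Q c. a < fibre_coord d x \<and> fibre_coord d x \<le> b}" by blast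
        obtain k g where kg: "e c = (k, g)" by (cases "e c")
        have "gauss_floor ^ (d + 1) / (real d + 1) * (2 / real m) ^ (d - 1) * (b - a) \<le> measure (gauss d) (P0 i)"
          unfolding Pi Q_def kg using em[OF c] kg by (intro column_piece_ge d m1 ab) simp
        then have len: "gauss_floor ^ (d + 1) / (real d + 1) * (2 / real m) ^ (d - 1) * (b - a) \<le> 1 / real N" using P0(2)[OF iN] by simp
        \<comment> \<open>Comparison of masses: of the d factors 30, d - 1 are absorbed by the mesh
          through 30/M \<le> 2/m, and the last one remains in h = 30/M.\<close>
        have "b - a = (1 / 30) ^ d * 30 ^ d * (b - a)" by (simp add: power_mult_distrib[symmetric])
        also have "30 ^ d = (30 / M) ^ (d - 1) * 30 * M ^ (d - 1)"
        proof -
          have "(30 :: real) ^ d = 30 ^ (d - 1) * 30" using d by (metis power_minus_mult zero_less_numeral less_le_trans)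
          then show ?thesis using M1 by (simp add: power_divide)
        qed
        also have "(1 / 30) ^ d * \<dots> * (b - a) = 30 * M ^ (d - 1) * ((1 / 30) ^ d * (30 / M) ^ (d - 1) * (b - a))" by simp
        also have "\<dots> \<le> 30 * M ^ (d - 1) * (gauss_floor ^ (d + 1) / (real d + 1) * (2 / real m) ^ (d - 1) * (b - a))"
        proof (intro mult_left_mono mult_right_mono mult_mono gauss_floor_power_ge d power_mono)
          show "30 / M \<le> 2 / real m" using mfl M1 m1 by (simp add: field_simps)
        qed (use M1 ab gauss_floor_pos in auto)
        also have "\<dots> \<le> 30 * M ^ (d - 1) * (1 / real N)" using len M1 by (intro mult_left_mono) auto
        also have "\<dots> = h"
        proof -
          have "real N = M ^ (d - 1) * M" using Md d by (metis power_minus_mult zero_less_numeral less_le_trans)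
          then show ?thesis using M1 by (simp add: h_def)
        qed
        finally have ba: "b - a \<le> 2 * h" using h by simp
        have "P i \<subseteq> piece d m (e c) a b" by (auto simp: P_def Pi piece_def Q_def)
        then show ?thesis unfolding T_def \<tau>_def
        proof (rule crossing_piece_in_tubes[OF d m1 mh ba])
          show "snorm d z \<noteq> 0" if "z \<in> P i" for z using that by (simp add: P_def Z_def)
          show "\<eta> \<le> 1" using \<eta>(2) M1 unfolding M_def[symmetric] by (smt (verit) divide_le_eq_1)
          show "P i \<inter> E \<noteq> {}" "\<not> P i \<subseteq> E" using i by (auto simp: C_def)
        qed (use x y E \<eta> in auto)
      qed
      have "real (card (C - Bad)) * (1 / real N) = (\<Sum>i\<in>C - Bad. measure (gauss d) (P i))"
        using P(2) CN by (simp add: subset_iff)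
      also have "\<dots> = measure (gauss d) (\<Union>i\<in>C - Bad. P i)"
      proof (intro gauss.finite_measure_finite_Union[symmetric])
        show "P ` (C - Bad) \<subseteq> sets (gauss d)" using P(1) CN by auto
        show "disjoint_family_on P (C - Bad)" using CN by (intro disjoint_family_on_mono[OF _ Pdisj]) auto
      qed (use finC in simp)
      also have "\<dots> \<le> measure (gauss d) T" using PT by (intro gauss.finite_measure_mono Tm) auto
      also have "\<dots> \<le> measure (gauss d) (tube d \<tau> x) + measure (gauss d) (tube d \<tau> y)"
        unfolding T_def by (intro measure_Un_le sets_tube)
      also have "\<dots> \<le> 4 * real d * \<tau> + 4 * real d * \<tau>" by (intro add_mono measure_tube_le' d x(1) y(1) \<tau>(1))
      also have "\<dots> = 8 * real d * \<tau>" by simp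
      also have "\<dots> \<le> 8 * real d * (181 * sqrt (real d) / M)" using \<tau>(2) by (intro mult_left_mono) auto
      finally have "real (card (C - Bad)) \<le> real N * (8 * real d * (181 * sqrt (real d) / M))"
        using N by (simp add: field_simps)
      also have "\<dots> = 1448 * (real d * sqrt (real d)) * (real N / M)" by simp
      finally have good: "real (card (C - Bad)) \<le> 1448 * (real d * sqrt (real d)) * (real N / M)" .
      \<comment> \<open>The bad pieces number at most (d + 1) M^(d-1) = (d + 1) N/M, within the
        order already reached by the good ones.\<close>
      have "real n \<le> (real d + 1) * M ^ (d - 1)"
        unfolding n_def of_nat_mult of_nat_power using mfl(1) M1 by (intro mult_mono power_mono) auto
      also have "M ^ (d - 1) = real N / M"
      proof -
        have "real N = M ^ (d - 1) * M" using Md d by (metis power_minus_mult zero_less_numeral less_le_trans)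
        then show ?thesis using M1 by simp
      qed
      also have "(real d + 1) * (real N / M) \<le> 2 * (real d * sqrt (real d)) * (real N / M)"
        using dsd M1 by (intro mult_right_mono) auto
      finally have n': "real n \<le> 2 * (real d * sqrt (real d)) * (real N / M)" .
      have "card C \<le> card ((C - Bad) \<union> Bad)" using finC finBad by (intro card_mono) auto
      also have "\<dots> \<le> card (C - Bad) + card Bad" by (rule card_Un_le)
      finally have "real (card C) \<le> real (card (C - Bad)) + real n" using Bad by linarith
      also have "\<dots> \<le> 1450 * (real d * sqrt (real d)) * (real N / M)" using add_mono[OF good n'] by (simp add: algebra_simps)
      also have "\<dots> \<le> 1500 * (real d * sqrt (real d)) * (real N / M)" using M1 by (intro mult_right_mono) auto
      finally show ?thesis by (simp add: C_def)
    qed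
  qed
  show thesis
  proof (rule that[of P])
    show "snorm d z \<noteq> 0" if "i \<in> {1..N}" "z \<in> P i" for i z using that by (simp add: P_def Z_def)
    show "i = j" if "i \<in> {1..N}" "j \<in> {1..N}" "z \<in> P i" "w \<in> P j" "c > 0" "\<forall>k\<le>d. w k = c * z k" for i j z w c
      using that by (rule direction)
    show "real (card {i \<in> {1..N}. P i \<inter> E \<noteq> {} \<and> \<not> P i \<subseteq> E}) \<le> 1500 * (real d * sqrt (real d)) * real N / real N powr (1 / real d)"
      if "1 / 2 \<le> snorm d x" "snorm d x \<le> 2" "1 / 2 \<le> snorm d y" "snorm d y \<le> 2"
       "E = inner_bracket d \<eta> x y \<or> E = outer_bracket d \<eta> x y" for x y E
      using crossing[OF that] by (simp only: M_def)
  qed (use P Pdisj in blast)+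
qed

section \<open>The upper bound\<close>

lemma unit_sphere_iff: "x \<in> unit_sphere d \<longleftrightarrow> sdot d x x = 1 \<and> (\<forall>i>d. x i = 0)"
  by (simp add: nsphere sdot_def power2_eq_square)

lemma unit_sphere_nonempty: "unit_sphere d \<noteq> {}"
proof -
  have "(\<lambda>i. if i = 0 then 1 else 0) \<in> unit_sphere d"
    using sdot_unit_vec[of 0 d _ 1] by (simp add: unit_sphere_iff)
  then show ?thesis by blast
qed

text \<open>Points of \<open>space (gauss d)\<close> are undefined beyond coordinate d, whereas
  points of the sphere are zero there.\<close>

definition unit_direction :: "nat \<Rightarrow> (nat \<Rightarrow> real) \<Rightarrow> nat \<Rightarrow> real" where
  "unit_direction d z = (\<lambda>i. if i \<le> d then (1 / snorm d z) * z i else 0)"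

lemma sdot_unit_direction: "sdot d (unit_direction d z) x = sdot d z x / snorm d z"
proof -
  have "sdot d (unit_direction d z) x = sdot d (\<lambda>i. (1 / snorm d z) * z i) x"
    by (intro sdot_cong) (auto simp: unit_direction_def)
  then show ?thesis unfolding sdot_scale_left by simp
qed

lemma snorm_square: "snorm d z * snorm d z = sdot d z z"
  by (simp add: snorm_def sdot_self_nonneg)

lemma unit_direction_in_sphere:
  assumes "snorm d z \<noteq> 0"
  shows "unit_direction d z \<in> unit_sphere d"
proof -
  have "sdot d (unit_direction d z) (unit_direction d z) = sdot d z z / snorm d z / snorm d z"
    unfolding sdot_unit_direction[of d z "unit_direction d z"] sdot_commute[of d z "unit_direction d z"] sdot_unit_direction ..
  also have "\<dots> = 1" using assms by (simp add: snorm_square[symmetric])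
  finally show ?thesis by (simp add: unit_sphere_iff unit_direction_def)
qed

lemma sgn_plus_unit_direction: "sgn_plus (sdot d (unit_direction d z) x) = sgn_plus (sdot d z x)" if "snorm d z \<noteq> 0"
proof -
  have "snorm d z > 0" using that snorm_nonneg[of d z] by linarith
  then show ?thesis by (simp add: sgn_plus_def sdot_unit_direction zero_le_divide_iff)
qed

section \<open>A finite net of rounded vectors\<close>

definition grid_point :: "nat \<Rightarrow> real \<Rightarrow> (nat \<Rightarrow> real) \<Rightarrow> nat \<Rightarrow> real" where
  "grid_point d q x = (\<lambda>i\<in>{..d}. q * of_int \<lfloor>x i / q\<rfloor>)"

definition grid :: "nat \<Rightarrow> real \<Rightarrow> (nat \<Rightarrow> real) set" where
  "grid d q = {..d} \<rightarrow>\<^sub>E (\<lambda>j::int. q * of_int j) ` {-\<lceil>1 / q\<rceil>..\<lceil>1 / q\<rceil>}"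

lemma finite_grid: "finite (grid d q)"
  unfolding grid_def by (intro finite_PiE) auto

lemma card_grid_le:
  assumes "q > 0"
  shows "real (card (grid d q)) \<le> (2 / q + 3) ^ (d + 1)"
proof -
  have pos: "\<lceil>1 / q\<rceil> \<ge> 0" using assms by (simp add: zero_le_ceiling) (smt (verit) divide_pos_pos)
  have "card ((\<lambda>j::int. q * of_int j) ` {-\<lceil>1 / q\<rceil>..\<lceil>1 / q\<rceil>}) \<le> card {-\<lceil>1 / q\<rceil>..\<lceil>1 / q\<rceil>}"
    by (intro card_image_le) simp
  also have "\<dots> = nat (2 * \<lceil>1 / q\<rceil> + 1)" by simp
  finally have "real (card ((\<lambda>j::int. q * of_int j) ` {-\<lceil>1 / q\<rceil>..\<lceil>1 / q\<rceil>})) \<le> 2 * of_int \<lceil>1 / q\<rceil> + 1"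
    using pos by linarith
  also have "\<dots> \<le> 2 * (1 / q + 1) + 1" using of_int_ceiling_le_add_one[of "1 / q"] by (simp add: ceiling_le_iff) linarith
  also have "\<dots> = 2 / q + 3" by simp
  finally have c: "real (card ((\<lambda>j::int. q * of_int j) ` {-\<lceil>1 / q\<rceil>..\<lceil>1 / q\<rceil>})) \<le> 2 / q + 3" .
  have "card (grid d q) = card ((\<lambda>j::int. q * of_int j) ` {-\<lceil>1 / q\<rceil>..\<lceil>1 / q\<rceil>}) ^ (d + 1)"
    unfolding grid_def by (simp add: card_PiE)
  then show ?thesis using c by (simp add: power_mono del: power_Suc)
qed

lemma unit_coord_le:
  assumes "sdot d x x = 1" "i \<le> d"
  shows "\<bar>x i\<bar> \<le> 1"
  using snorm_ge_coord[OF assms(2), of x] assms(1) by (simp add: snorm_def)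

lemma grid_point_in:
  assumes q: "q > 0" and x: "sdot d x x = 1"
  shows "grid_point d q x \<in> grid d q"
proof -
  have "\<lfloor>x i / q\<rfloor> \<in> {-\<lceil>1 / q\<rceil>..\<lceil>1 / q\<rceil>}" if "i \<le> d" for i
  proof -
    have "x i / q \<le> 1 / q" "- (1 / q) \<le> x i / q"
      using unit_coord_le[OF x that] q by (auto simp: field_simps abs_le_iff)
    then have "\<lfloor>x i / q\<rfloor> \<le> \<lfloor>1 / q\<rfloor>" "\<lfloor>- (1 / q)\<rfloor> \<le> \<lfloor>x i / q\<rfloor>" by (auto intro: floor_mono)
    moreover have "\<lfloor>1 / q\<rfloor> \<le> \<lceil>1 / q\<rceil>" by (rule floor_le_ceiling)
    ultimately have "\<lfloor>x i / q\<rfloor> \<le> \<lceil>1 / q\<rceil>" "-\<lceil>1 / q\<rceil> \<le> \<lfloor>x i / q\<rfloor>" unfolding floor_minus by linarith+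
    then show ?thesis by simp
  qed
  then show ?thesis by (auto simp: grid_def grid_point_def)
qed

lemma grid_point_close:
  assumes q: "q > 0"
  shows "snorm d (\<lambda>i. x i - grid_point d q x i) \<le> (real d + 1) * q"
proof -
  have "snorm d (\<lambda>i. x i - grid_point d q x i) \<le> (\<Sum>i\<le>d. \<bar>x i - grid_point d q x i\<bar>)"
    unfolding snorm_def by (rule sqrt_sdot_self_le)
  also have "\<dots> \<le> (\<Sum>i\<le>d. q)"
  proof (intro sum_mono)
    fix i assume i: "i \<in> {..d}"
    have "x i - grid_point d q x i = q * (x i / q - of_int \<lfloor>x i / q\<rfloor>)"
      using q i by (simp add: grid_point_def algebra_simps)
    also have "\<bar>\<dots>\<bar> = q * \<bar>x i / q - of_int \<lfloor>x i / q\<rfloor>\<bar>" using q by (simp add: abs_mult)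
    also have "\<dots> \<le> q * 1"
    proof (intro mult_left_mono)
      show "\<bar>x i / q - of_int \<lfloor>x i / q\<rfloor>\<bar> \<le> 1" using floor_correct[of "x i / q"] by linarith
    qed (use q in simp)
    finally show "\<bar>x i - grid_point d q x i\<bar> \<le> q" by simp
  qed
  finally show ?thesis by (simp add: add.commute)
qed

lemma sgn_plus_outside_tube:
  assumes z: "z \<in> space (gauss d)" "z \<notin> tube d \<eta> x'" and c: "snorm d (\<lambda>i. x i - x' i) \<le> \<eta>"
  shows "sgn_plus (sdot d z x) = sgn_plus (sdot d z x')"
proof -
  have "\<bar>sdot d z x - sdot d z x'\<bar> \<le> snorm d z * snorm d (\<lambda>i. x i - x' i)"
    using abs_sdot_le[of d z "\<lambda>i. x i - x' i"] by (simp add: sdot_diff_right)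
  also have "\<dots> \<le> snorm d z * \<eta>" using c by (intro mult_left_mono) auto
  also have "\<dots> < \<bar>sdot d z x'\<bar>" using z by (simp add: tube_def mult.commute not_le)
  finally show ?thesis by (auto simp: sgn_plus_def)
qed

lemma brackets_wedge:
  assumes "snorm d (\<lambda>i. x i - x' i) \<le> \<eta>" "snorm d (\<lambda>i. y i - y' i) \<le> \<eta>"
  shows "inner_bracket d \<eta> x' y' \<subseteq> wedge d x y" "wedge d x y \<subseteq> outer_bracket d \<eta> x' y'"
proof -
  have w: "z \<in> wedge d x y \<longleftrightarrow> z \<in> wedge d x' y'" if "z \<in> space (gauss d)" "z \<notin> tube d \<eta> x'" "z \<notin> tube d \<eta> y'" for z
    using that sgn_plus_outside_tube[OF that(1,2) assms(1)] sgn_plus_outside_tube[OF that(1,3) assms(2)] by (simp add: wedge_def)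
  then show "inner_bracket d \<eta> x' y' \<subseteq> wedge d x y" "wedge d x y \<subseteq> outer_bracket d \<eta> x' y'"
    by (auto simp: inner_bracket_def outer_bracket_def) (auto simp: wedge_def)
qed

text \<open>Error budget in units of \<open>\<epsilon>\<close> = \<delta> N / 4: sampling costs less
  than one unit, and the tubes between the two brackets have mass at most 8 d \<eta>, which times N
  is \<epsilon> / N and hence at most another unit. The factor 1/N in \<eta> also keeps \<eta> below
  N^(-1/d) and later enters only through a logarithm. The 12000 is 8 * 1500, from 2 \<epsilon>^2 /
  K.\<close>

proposition sign_linear_RIP_of_bound:
  fixes d N :: nat and \<delta> :: real
  defines "M \<equiv> real N powr (1 / real d)"
  defines "\<eta> \<equiv> \<delta> / (32 * real d * real N)"
  assumes d: "d \<ge> 2" and N: "N \<ge> 1" and \<delta>: "0 < \<delta>" "\<delta> < 1"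
    and small: "2 * ((2 * (real d + 1) / \<eta> + 3) ^ (d + 1))\<^sup>2 * (2 * exp (- (\<delta>\<^sup>2 * real N * M) / (12000 * (real d * sqrt (real d))))) < 1"
  shows "sign_linear_RIP d \<delta> N"
proof -
  \<comment> \<open>Rounding d + 1 coordinates to mesh q moves a vector by at most (d + 1) q =
    \<eta>.\<close>
  define q where "q = \<eta> / (real d + 1)"
  have \<eta>: "0 < \<eta>" using d N \<delta> by (simp add: \<eta>_def)
  have q: "q > 0" using \<eta> by (simp add: q_def)
  have M: "1 \<le> M" "M \<le> real N"
    using N d powr_mono[of "1 / real d" 1 "real N"] by (auto simp: M_def ge_one_powr_ge_zero)
  have dN: "1 \<le> real d * real N" using d N mult_mono[of 1 "real d" 1 "real N"] by auto
  have "\<eta> \<le> 1 / (32 * real d * real N)" using \<delta> d N by (simp add: \<eta>_def divide_right_mono)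
  also have "\<dots> \<le> 1 / M" using M d N mult_mono[of 1 "32 * real d" M "real N"] by (intro divide_left_mono) auto
  finally have \<eta>M: "\<eta> \<le> 1 / M" .
  have "\<eta> \<le> 1 / (32 * (real d * real N))" using \<delta> d N by (simp add: \<eta>_def divide_right_mono mult.assoc)
  also have "\<dots> \<le> 1 / 32" using dN by (intro divide_left_mono) auto
  finally have \<eta>2: "\<eta> \<le> 1 / 2" by simp
  \<comment> \<open>Rounded unit vectors satisfy both norm bounds because \<eta> \<le> 1/2; the tube
    estimates need them.\<close>
  define G where "G = {x \<in> grid d q. 1 / 2 \<le> snorm d x \<and> snorm d x \<le> 2}"
  have G: "finite G" "real (card G) \<le> (2 * (real d + 1) / \<eta> + 3) ^ (d + 1)"
  proof -
    show "finite G" unfolding G_def using finite_grid by simp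
    have "real (card G) \<le> real (card (grid d q))" unfolding G_def by (simp add: card_mono finite_grid)
    also have "\<dots> \<le> (2 / q + 3) ^ (d + 1)" by (rule card_grid_le[OF q])
    also have "2 / q = 2 * (real d + 1) / \<eta>" by (simp add: q_def)
    finally show "real (card G) \<le> (2 * (real d + 1) / \<eta> + 3) ^ (d + 1)" .
  qed
  define \<E> where "\<E> = (\<lambda>(x, y). inner_bracket d \<eta> x y) ` (G \<times> G) \<union> (\<lambda>(x, y). outer_bracket d \<eta> x y) ` (G \<times> G)"
  have cE: "real (card \<E>) \<le> 2 * ((2 * (real d + 1) / \<eta> + 3) ^ (d + 1))\<^sup>2"
  proof -
    have "card \<E> \<le> card ((\<lambda>(x, y). inner_bracket d \<eta> x y) ` (G \<times> G)) + card ((\<lambda>(x, y). outer_bracket d \<eta> x y) ` (G \<times> G))"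
      unfolding \<E>_def by (rule card_Un_le)
    also have "\<dots> \<le> card (G \<times> G) + card (G \<times> G)" using G by (intro add_mono card_image_le) auto
    also have "\<dots> = 2 * (card G)\<^sup>2" by (simp add: card_cartesian_product power2_eq_square)
    finally have "real (card \<E>) \<le> real (2 * (card G)\<^sup>2)" by (simp only: of_nat_le_iff)
    also have "\<dots> = 2 * (real (card G))\<^sup>2" by simp
    also have "\<dots> \<le> 2 * ((2 * (real d + 1) / \<eta> + 3) ^ (d + 1))\<^sup>2" using G(2) by (intro mult_left_mono power_mono) auto
    finally show ?thesis .
  qed
  obtain P where P: "\<And>i. i \<in> {1..N} \<Longrightarrow> P i \<in> sets (gauss d)" "\<And>i. i \<in> {1..N} \<Longrightarrow> measure (gauss d) (P i) = 1 / real N"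
    and disj: "disjoint_family_on P {1..N}" and nz: "\<And>i z. i \<in> {1..N} \<Longrightarrow> z \<in> P i \<Longrightarrow> snorm d z \<noteq> 0"
    and dir: "\<And>i j z w c. i \<in> {1..N} \<Longrightarrow> j \<in> {1..N} \<Longrightarrow> z \<in> P i \<Longrightarrow> w \<in> P j \<Longrightarrow> c > 0 \<Longrightarrow> \<forall>k\<le>d. w k = c * z k \<Longrightarrow> i = j"
    and cross: "\<And>x y E. 1 / 2 \<le> snorm d x \<Longrightarrow> snorm d x \<le> 2 \<Longrightarrow> 1 / 2 \<le> snorm d y \<Longrightarrow> snorm d y \<le> 2 \<Longrightarrow>
       E = inner_bracket d \<eta> x y \<or> E = outer_bracket d \<eta> x y \<Longrightarrow>
       real (card {i \<in> {1..N}. P i \<inter> E \<noteq> {} \<and> \<not> P i \<subseteq> E}) \<le> 1500 * (real d * sqrt (real d)) * real N / M"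
    by (rule ex_jittered_pieces[OF d N less_imp_le[OF \<eta>] \<eta>M[unfolded M_def], folded M_def]) (rule that)
  define K where "K = 1500 * (real d * sqrt (real d)) * real N / M"
  define \<epsilon> where "\<epsilon> = \<delta> * real N / 4"
  have K: "K > 0" using d N M by (simp add: K_def)
  have \<epsilon>: "\<epsilon> > 0" using \<delta> N by (simp add: \<epsilon>_def)
  have "\<exists>z. (\<forall>i\<in>{1..N}. z i \<in> P i) \<and> (\<forall>E\<in>\<E>. \<bar>real (card {i \<in> {1..N}. z i \<in> E}) - real N * measure (gauss d) E\<bar> < \<epsilon>)"
  proof (rule gauss.jittered_sampling[OF N P disj _ _ _ K \<epsilon>])
    show "finite \<E>" unfolding \<E>_def using G(1) by auto
    show "E \<in> sets (gauss d)" if "E \<in> \<E>" for E using that by (auto simp: \<E>_def)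
    show "real (card {i \<in> {1..N}. P i \<inter> E \<noteq> {} \<and> \<not> P i \<subseteq> E}) \<le> K" if EE: "E \<in> \<E>" for E
    proof -
      obtain x y where "x \<in> G" "y \<in> G" "E = inner_bracket d \<eta> x y \<or> E = outer_bracket d \<eta> x y" using EE by (auto simp: \<E>_def)
      then show ?thesis unfolding K_def by (intro cross[of x y]) (auto simp: G_def)
    qed
    have "2 * \<epsilon>\<^sup>2 / K = (\<delta>\<^sup>2 * real N * M) / (12000 * (real d * sqrt (real d)))"
      using N M d by (simp add: \<epsilon>_def K_def power2_eq_square field_simps)
    then have "real (card \<E>) * (2 * exp (- 2 * \<epsilon>\<^sup>2 / K)) = real (card \<E>) * (2 * exp (- (\<delta>\<^sup>2 * real N * M) / (12000 * (real d * sqrt (real d)))))" by simp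
    also have "\<dots> \<le> 2 * ((2 * (real d + 1) / \<eta> + 3) ^ (d + 1))\<^sup>2 * (2 * exp (- (\<delta>\<^sup>2 * real N * M) / (12000 * (real d * sqrt (real d)))))"
      using cE by (intro mult_right_mono) auto
    also have "\<dots> < 1" by (rule small)
    finally show "real (card \<E>) * (2 * exp (- 2 * \<epsilon>\<^sup>2 / K)) < 1" .
  qed auto
  then obtain z where z: "\<And>i. i \<in> {1..N} \<Longrightarrow> z i \<in> P i"
    and disc: "\<And>E. E \<in> \<E> \<Longrightarrow> \<bar>real (card {i \<in> {1..N}. z i \<in> E}) - real N * measure (gauss d) E\<bar> < \<epsilon>" by blast
  have zs: "z i \<in> space (gauss d)" and znz: "snorm d (z i) \<noteq> 0" if "i \<in> {1..N}" for i
    using z[OF that] P(1)[OF that] sets.sets_into_space nz[OF that] by auto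
  define p where "p i = unit_direction d (z i)" for i
  have pS: "p i \<in> unit_sphere d" if "i \<in> {1..N}" for i using unit_direction_in_sphere[OF znz[OF that]] by (simp add: p_def)
  have inj: "inj_on p {1..N}"
  proof (rule inj_onI)
    fix i j assume ij: "i \<in> {1..N}" "j \<in> {1..N}" "p i = p j"
    have pos: "snorm d (z i) > 0" "snorm d (z j) > 0" using znz[OF ij(1)] znz[OF ij(2)] snorm_nonneg[of d "z i"] snorm_nonneg[of d "z j"] by linarith+
    have "z j k = (snorm d (z j) / snorm d (z i)) * z i k" if "k \<le> d" for k
      using fun_cong[OF ij(3), of k] that pos by (simp add: p_def unit_direction_def field_simps)
    then show "i = j" using pos by (intro dir[OF ij(1,2) z[OF ij(1)] z[OF ij(2)], of "snorm d (z j) / snorm d (z i)"]) auto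
  qed
  have bound: "\<bar>hamming_dist N (sign_linear_map d N p x) (sign_linear_map d N p y) - geo_dist d x y\<bar> \<le> \<delta> / 2"
    if x: "x \<in> unit_sphere d" and y: "y \<in> unit_sphere d" for x y
  proof -
    have x1: "sdot d x x = 1" and y1: "sdot d y y = 1" using x y by (auto simp: unit_sphere_iff)
    define x' where "x' = grid_point d q x"
    define y' where "y' = grid_point d q y"
    have close: "snorm d (\<lambda>i. v i - grid_point d q v i) \<le> \<eta>" for v
      using grid_point_close[OF q, of d v] by (simp add: q_def)
    have inG: "grid_point d q v \<in> G" if v: "sdot d v v = 1" for v
    proof -
      have n1: "snorm d v = 1" using v by (simp add: snorm_def)
      have "snorm d v \<le> snorm d (grid_point d q v) + snorm d (\<lambda>i. v i - grid_point d q v i)" by (rule snorm_triangle)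
      then have 1: "1 / 2 \<le> snorm d (grid_point d q v)" using n1 close[of v] \<eta>2 by linarith
      have "snorm d (grid_point d q v) \<le> snorm d v + snorm d (\<lambda>i. grid_point d q v i - v i)" by (rule snorm_triangle)
      also have "snorm d (\<lambda>i. grid_point d q v i - v i) = snorm d (\<lambda>i. v i - grid_point d q v i)"
        using snorm_scale[of d "-1" "\<lambda>i. v i - grid_point d q v i"] by simp
      finally have 2: "snorm d (grid_point d q v) \<le> 2" using n1 close[of v] \<eta>2 by linarith
      show ?thesis using 1 2 grid_point_in[OF q v] by (simp add: G_def)
    qed
    have x'G: "x' \<in> G" and y'G: "y' \<in> G" using inG x1 y1 by (auto simp: x'_def y'_def)
    have br: "inner_bracket d \<eta> x' y' \<subseteq> wedge d x y" "wedge d x y \<subseteq> outer_bracket d \<eta> x' y'"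
      unfolding x'_def y'_def by (intro brackets_wedge close)+
    define W where "W = measure (gauss d) (wedge d x y)"
    define cW where "cW = real (card {i \<in> {1..N}. z i \<in> wedge d x y})"
    have Wd: "W = geo_dist d x y" unfolding W_def by (rule measure_wedge[OF d x1 y1])
    have tubes: "measure (gauss d) (tube d \<eta> x' \<union> tube d \<eta> y') \<le> 8 * real d * \<eta>"
    proof -
      have "measure (gauss d) (tube d \<eta> x' \<union> tube d \<eta> y') \<le> measure (gauss d) (tube d \<eta> x') + measure (gauss d) (tube d \<eta> y')"
        by (intro measure_Un_le sets_tube)
      also have "\<dots> \<le> 4 * real d * \<eta> + 4 * real d * \<eta>"
        using x'G y'G \<eta> by (intro add_mono measure_tube_le' d) (auto simp: G_def)
      finally show ?thesis by linarith
    qed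
    have ob: "outer_bracket d \<eta> x' y' = inner_bracket d \<eta> x' y' \<union> (tube d \<eta> x' \<union> tube d \<eta> y')"
      by (auto simp: inner_bracket_def outer_bracket_def)
    have oi: "measure (gauss d) (outer_bracket d \<eta> x' y') \<le> measure (gauss d) (inner_bracket d \<eta> x' y') + 8 * real d * \<eta>"
      unfolding ob using tubes measure_Un_le[OF sets_inner_bracket[of d \<eta> x' y'] sets.Un[OF sets_tube[of d \<eta> x'] sets_tube[of d \<eta> y']]] by linarith
    have iW: "measure (gauss d) (inner_bracket d \<eta> x' y') \<le> W" unfolding W_def by (intro gauss.finite_measure_mono br sets_wedge)
    have Wo: "W \<le> measure (gauss d) (outer_bracket d \<eta> x' y')" unfolding W_def by (intro gauss.finite_measure_mono br sets_outer_bracket)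
    have ci: "real (card {i \<in> {1..N}. z i \<in> inner_bracket d \<eta> x' y'}) \<le> cW"
      unfolding cW_def using br(1) by (intro of_nat_mono card_mono) auto
    have co: "cW \<le> real (card {i \<in> {1..N}. z i \<in> outer_bracket d \<eta> x' y'})"
      unfolding cW_def using br(2) by (intro of_nat_mono card_mono) auto
    have inE: "inner_bracket d \<eta> x' y' \<in> \<E>" "outer_bracket d \<eta> x' y' \<in> \<E>" using x'G y'G by (auto simp: \<E>_def)
    have e8: "real N * (8 * real d * \<eta>) = \<epsilon> / real N" using N d by (simp add: \<eta>_def \<epsilon>_def field_simps)
    have "\<epsilon> / real N \<le> \<epsilon> / 1" using N \<epsilon> by (intro divide_left_mono) auto
    then have e9: "real N * (8 * real d * \<eta>) \<le> \<epsilon>" using e8 by simp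
    have "cW < real N * measure (gauss d) (outer_bracket d \<eta> x' y') + \<epsilon>" using co disc[OF inE(2)] by linarith
    also have "\<dots> \<le> real N * (W + 8 * real d * \<eta>) + \<epsilon>" using oi iW by (intro add_right_mono mult_left_mono) auto
    finally have up: "cW \<le> real N * W + 2 * \<epsilon>" using e9 by (simp add: distrib_left)
    have "real N * W - real N * (8 * real d * \<eta>) \<le> real N * measure (gauss d) (inner_bracket d \<eta> x' y')"
      unfolding right_diff_distrib[symmetric] using oi Wo by (intro mult_left_mono) auto
    then have lo: "real N * W - 2 * \<epsilon> \<le> cW" using ci disc[OF inE(1)] e9 by linarith
    have "cW / real N - W = (cW - real N * W) / real N" using N by (simp add: diff_divide_distrib)
    then have "\<bar>cW / real N - W\<bar> = \<bar>cW - real N * W\<bar> / real N" by (simp add: abs_divide)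
    also have "\<dots> \<le> 2 * \<epsilon> / real N" using up lo by (intro divide_right_mono) auto
    also have "\<dots> = \<delta> / 2" using N by (simp add: \<epsilon>_def)
    finally have fin: "\<bar>cW / real N - W\<bar> \<le> \<delta> / 2" .
    have "{j \<in> {1..N}. sign_linear_map d N p x j \<noteq> sign_linear_map d N p y j} = {i \<in> {1..N}. z i \<in> wedge d x y}"
      using zs znz by (auto simp: sign_linear_map_def wedge_def p_def sgn_plus_unit_direction)
    then have "hamming_dist N (sign_linear_map d N p x) (sign_linear_map d N p y) = cW / real N"
      by (simp add: hamming_dist_def cW_def)
    then show ?thesis using fin Wd by simp
  qed
  \<comment> \<open>The pointwise bound leaves a margin of \<delta>/2, so the strict inequality
    survives the passage to the supremum.\<close>
  have "(SUP (x, y) \<in> unit_sphere d \<times> unit_sphere d.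
        \<bar>hamming_dist N (sign_linear_map d N p x) (sign_linear_map d N p y) - geo_dist d x y\<bar>) \<le> \<delta> / 2"
    using unit_sphere_nonempty[of d] bound by (intro cSUP_least) auto
  also have "\<delta> / 2 < \<delta>" using \<delta> by simp
  finally have "RIP d N \<delta> (sign_linear_map d N p)"
    by (auto simp: RIP_def hamming_cube_def sign_linear_map_def sgn_plus_def)
  moreover have "bij_betw p {1..N} (p ` {1..N})" using inj by (rule inj_on_imp_bij_betw)
  ultimately show ?thesis unfolding sign_linear_RIP_def using pS by blast
qed

section \<open>Choice of the number of points\<close>

lemma two_power_le_exp: "2 ^ n \<le> exp (real n)"
proof -
  have "(2::real) ^ n \<le> exp 1 ^ n" using exp_ge_add_one_self[of "1::real"] by (intro power_mono) auto
  then show ?thesis by (simp add: exp_of_nat_mult[symmetric])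
qed

text \<open>In logarithmic form, d = e^a, \<delta> = e^(-b) and X = e^x with N the integer part of
  X. The squared net bound is at most e^(93 d L), and Hoeffding's exponent is at least 300 d L, so
  the product is below 1.\<close>

lemma upper_bound_arithmetic:
  fixes d :: nat and \<delta> :: real
  assumes d: "d \<ge> 2" and \<delta>: "0 < \<delta>" "\<delta> < 1"
  defines "L \<equiv> 1 + ln (real d) + ln (1 / \<delta>)"
  defines "X \<equiv> exp 24 * real d powr (5 / 2 - 2 / (real d + 1)) * \<delta> powr (- 2 + 2 / (real d + 1)) * L powr (real d / (real d + 1))"
  obtains N :: nat where "N \<ge> 1" "real N \<le> X"
    "2 * ((2 * (real d + 1) / (\<delta> / (32 * real d * real N)) + 3) ^ (d + 1))\<^sup>2 *
       (2 * exp (- (\<delta>\<^sup>2 * real N * real N powr (1 / real d)) / (12000 * (real d * sqrt (real d))))) < 1"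
proof -
  define a where "a = ln (real d)"
  define b where "b = ln (1 / \<delta>)"
  have da: "real d = exp a" using d by (simp add: a_def)
  have db: "\<delta> = exp (- b)" using \<delta> by (simp add: b_def ln_div)
  have a0: "a \<ge> 0" using d by (simp add: a_def)
  have b0: "b \<ge> 0" using \<delta> by (simp add: b_def)
  have L: "L = 1 + a + b" by (simp add: L_def a_def b_def)
  have L1: "L \<ge> 1" using a0 b0 by (simp add: L)
  have lnL: "0 \<le> ln L" "ln L \<le> a + b" using L1 ln_le_minus_one[of L] by (auto simp: L)
  define x where "x = 24 + (5 / 2 - 2 / (real d + 1)) * a + (2 - 2 / (real d + 1)) * b + real d / (real d + 1) * ln L"
  have X: "X = exp x"
  proof -
    have "real d powr (5 / 2 - 2 / (real d + 1)) = exp ((5 / 2 - 2 / (real d + 1)) * a)"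
      using d by (simp add: powr_def a_def)
    moreover have "\<delta> powr (- 2 + 2 / (real d + 1)) = exp ((2 - 2 / (real d + 1)) * b)"
    proof -
      have "ln \<delta> = - b" by (simp add: db)
      then have "\<delta> powr (- 2 + 2 / (real d + 1)) = exp ((- 2 + 2 / (real d + 1)) * - b)" using \<delta> by (simp add: powr_def)
      also have "(- 2 + 2 / (real d + 1)) * - b = (2 - 2 / (real d + 1)) * b" by (simp only: minus_mult_right[symmetric] minus_mult_left minus_add_distrib) simp
      finally show ?thesis .
    qed
    moreover have "L powr (real d / (real d + 1)) = exp (real d / (real d + 1) * ln L)"
      using L1 by (simp add: powr_def)
    ultimately show ?thesis by (simp only: X_def x_def exp_add)
  qed
  define c where "c = 2 / (real d + 1)"
  define t where "t = real d / (real d + 1)"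
  have ct: "0 \<le> c" "c \<le> 1" "0 \<le> t" "t \<le> 1" using d by (auto simp: c_def t_def)
  have xc: "x = 24 + (5 / 2 - c) * a + (2 - c) * b + t * ln L" by (simp add: x_def c_def t_def)
  have x_ge: "x \<ge> 24"
  proof -
    have "0 \<le> (5 / 2 - c) * a" "0 \<le> (2 - c) * b" "0 \<le> t * ln L"
      using ct a0 b0 lnL by (auto intro!: mult_nonneg_nonneg)
    then show ?thesis unfolding xc by linarith
  qed
  have x_le: "x \<le> 24 + 7 / 2 * a + 3 * b"
  proof -
    have "(5 / 2 - c) * a \<le> 5 / 2 * a" "(2 - c) * b \<le> 2 * b" "t * ln L \<le> 1 * ln L"
      using ct a0 b0 lnL by (intro mult_right_mono; simp)+
    then show ?thesis using lnL unfolding xc by linarith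
  qed
  have e24: "exp (24::real) \<ge> 16777216" using two_power_le_exp[of 24] by simp
  have X2: "X \<ge> 2" unfolding X using e24 x_ge by (smt (verit) exp_le_cancel_iff)
  define N where "N = nat \<lfloor>X\<rfloor>"
  have N: "real N \<le> X" "X / 2 \<le> real N"
  proof -
    have "real N = of_int \<lfloor>X\<rfloor>" using X2 by (simp add: N_def)
    then show "real N \<le> X" "X / 2 \<le> real N" using floor_correct[of X] X2 by linarith+
  qed
  have N1: "N \<ge> 1" using N(2) X2 by (cases N) auto
  have "2 * (real d + 1) / (\<delta> / (32 * real d * real N)) + 3 = 64 * (real d + 1) * (real d * real N * (1 / \<delta>)) + 3"
    using \<delta> by (simp add: field_simps)
  \<comment> \<open>As d \<ge> 2, d + 1 is at most 3d/2, and the summand 3 is absorbed because d^2 N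
    / \<delta> \<ge> 1. The resulting 96 + 3 = 99 is below 2^7 \<le> e^7.\<close>
  also have "\<dots> \<le> 64 * (3 / 2 * real d) * (real d * real N * (1 / \<delta>)) + 3 * (real d * (real d * real N * (1 / \<delta>)))"
  proof -
    have "1 \<le> real d * real N" using d N1 mult_mono[of 1 "real d" 1 "real N"] by auto
    then have "1 \<le> real d * real N * (1 / \<delta>)" using \<delta> mult_mono[of 1 "real d * real N" 1 "1 / \<delta>"] by auto
    then have "1 \<le> real d * (real d * real N * (1 / \<delta>))" using d mult_mono[of 1 "real d" 1 "real d * real N * (1 / \<delta>)"] by auto
    moreover have "64 * (real d + 1) * (real d * real N * (1 / \<delta>)) \<le> 64 * (3 / 2 * real d) * (real d * real N * (1 / \<delta>))"
      using d \<delta> by (intro mult_right_mono) auto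
    ultimately show ?thesis by linarith
  qed
  also have "\<dots> = 99 * (real d * real d * (1 / \<delta>)) * real N" by (simp add: field_simps)
  also have "\<dots> \<le> exp 7 * (real d * real d * (1 / \<delta>)) * X"
    using two_power_le_exp[of 7] N(1) d \<delta> by (intro mult_mono mult_right_mono) auto
  also have "\<dots> = exp (7 + 2 * a + b + x)"
  proof -
    have "1 / \<delta> = exp b" by (simp add: db exp_minus inverse_eq_divide)
    then show ?thesis unfolding X da by (simp add: mult_exp_exp algebra_simps)
  qed
  \<comment> \<open>31 = 7 + 24, and \<open>x_le\<close> keeps the coefficients of a and b below 31
    as well. Two powers of d + 1 \<le> 3d/2 factors then give 93.\<close>
  also have "\<dots> \<le> exp (31 * L)" using x_le a0 b0 by (simp add: L)
  finally have v: "2 * (real d + 1) / (\<delta> / (32 * real d * real N)) + 3 \<le> exp (31 * L)" .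
  have "(2 * (real d + 1) / (\<delta> / (32 * real d * real N)) + 3) ^ (d + 1) \<le> exp (31 * L) ^ (d + 1)"
    using \<delta> by (intro power_mono v) simp
  then have "((2 * (real d + 1) / (\<delta> / (32 * real d * real N)) + 3) ^ (d + 1))\<^sup>2 \<le> (exp (31 * L) ^ (d + 1))\<^sup>2"
    by (rule power_mono) (use \<delta> in \<open>simp del: power_Suc add: zero_le_power\<close>)
  also have "\<dots> = exp (62 * L * (real d + 1))"
    by (simp add: exp_of_nat_mult[symmetric] exp_double[symmetric] algebra_simps del: power_Suc)
  also have "\<dots> \<le> exp (93 * (real d * L))" using d L1 mult_right_mono[of "62 * (real d + 1)" "93 * real d" L] by (simp add: algebra_simps)
  finally have B: "((2 * (real d + 1) / (\<delta> / (32 * real d * real N)) + 3) ^ (d + 1))\<^sup>2 \<le> exp (93 * (real d * L))" .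
  \<comment> \<open>With e = (d+1)/d the exponents of X become 5/2 + 1/(2d), 2 and 1, that is,
    N^(1+1/d) is at least of order d^(5/2) \<delta>^(-2) L. The 4 bounds 2^e, the loss from N \<ge>
    X/2.\<close>
  have NM: "real N * real N powr (1 / real d) \<ge> exp (24 + 5 / 2 * a + 2 * b + ln L) / 4"
  proof -
    define e where "e = 1 + 1 / real d"
    have e: "1 \<le> e" "e \<le> 2" using d by (auto simp: e_def)
    have "e * x = 24 * e + (5 / 2 + 1 / (2 * real d)) * a + 2 * b + ln L"
    proof -
      have r: "e * (5 / 2 - 2 / (real d + 1)) = 5 / 2 + 1 / (2 * real d)" "e * (2 - 2 / (real d + 1)) = 2" "e * (real d / (real d + 1)) = 1"
      proof -
        define D where "D = real d"
        have D: "D \<noteq> 0" "D + 1 \<noteq> 0" using d by (auto simp: D_def)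
        have e': "e = (D + 1) / D" using D by (simp add: e_def D_def add_divide_distrib)
        have "5 / 2 - 2 / (D + 1) = (5 * D + 1) / (2 * (D + 1))" "2 - 2 / (D + 1) = 2 * D / (D + 1)"
          using D(2) by (simp_all add: divide_simps) 
        then have p: "e * (5 / 2 - 2 / (D + 1)) = (5 * D + 1) / (2 * D)" "e * (2 - 2 / (D + 1)) = 2" "e * (D / (D + 1)) = 1"
          unfolding e' using D by (auto simp: divide_simps) (auto simp: algebra_simps)
        have "(5 * D + 1) / (2 * D) = 5 / 2 + 1 / (2 * D)" using D(1) by (simp add: add_divide_distrib)
        then show "e * (5 / 2 - 2 / (real d + 1)) = 5 / 2 + 1 / (2 * real d)" "e * (2 - 2 / (real d + 1)) = 2" "e * (real d / (real d + 1)) = 1"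
          using p(2,3) trans[OF p(1)] unfolding D_def by blast+
      qed
      have "e * x = 24 * e + e * (5 / 2 - 2 / (real d + 1)) * a + e * (2 - 2 / (real d + 1)) * b + e * (real d / (real d + 1)) * ln L"
        unfolding x_def by (simp only: distrib_left mult.assoc mult.commute[of e 24])
      then show ?thesis unfolding r by simp
    qed
    moreover have "24 * e \<ge> 24" using e by simp
    moreover have "(5 / 2 + 1 / (2 * real d)) * a \<ge> 5 / 2 * a" using a0 by (intro mult_right_mono) auto
    ultimately have "exp (24 + 5 / 2 * a + 2 * b + ln L) / 4 \<le> exp (e * x) / 4" by simp
    also have "exp (e * x) = X powr e" by (simp add: X powr_def)
    also have "X powr e / 4 \<le> X powr e / 2 powr e"
      using powr_mono[of e 2 "2::real"] e by (intro divide_left_mono) auto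
    also have "\<dots> = (X / 2) powr e" using X2 by (simp add: powr_divide)
    also have "\<dots> \<le> real N powr e" using N X2 e by (intro powr_mono2) auto
    also have "\<dots> = real N * real N powr (1 / real d)" using N1 by (simp add: e_def powr_add)
    finally show ?thesis .
  qed
  have "\<delta>\<^sup>2 * (real N * real N powr (1 / real d)) \<ge> \<delta>\<^sup>2 * (exp (24 + 5 / 2 * a + 2 * b + ln L) / 4)"
    by (intro mult_left_mono NM) auto
  moreover have "\<delta>\<^sup>2 * (exp (24 + 5 / 2 * a + 2 * b + ln L) / 4) = exp 24 / 4 * L * (real d * (real d * sqrt (real d)))"
  proof -
    have sq: "sqrt (real d) = exp (a / 2)" unfolding da by (rule real_sqrt_unique) (simp_all flip: exp_double)
    have "\<delta>\<^sup>2 = exp (- 2 * b)" by (simp add: db exp_double[symmetric])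
    then have "\<delta>\<^sup>2 * exp (24 + 5 / 2 * a + 2 * b + ln L) = exp (24 + a + a + a / 2 + ln L)"
      by (simp add: exp_add[symmetric])
    also have "\<dots> = exp 24 * real d * real d * sqrt (real d) * L" unfolding exp_add sq da[symmetric] using L1 by (simp add: sq)
    finally show ?thesis by simp
  qed
  ultimately have "\<delta>\<^sup>2 * real N * real N powr (1 / real d) \<ge> exp 24 / 4 * L * (real d * (real d * sqrt (real d)))" by (simp add: mult.assoc)
  then have "\<delta>\<^sup>2 * real N * real N powr (1 / real d) / (12000 * (real d * sqrt (real d))) \<ge> exp 24 / 4 * L * (real d * (real d * sqrt (real d))) / (12000 * (real d * sqrt (real d)))"
    using d by (intro divide_right_mono) auto
  moreover have "exp 24 / 4 * L * (real d * (real d * sqrt (real d))) / (12000 * (real d * sqrt (real d))) = exp 24 / 48000 * (real d * L)"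
    using d by (simp add: field_simps)
  \<comment> \<open>Here the constant e^24 is used: 2^24 / 48000 exceeds 300, where 48000 = 4 *
    12000.\<close>
  moreover have "300 * (real d * L) \<le> exp 24 / 48000 * (real d * L)" using e24 L1 d by (intro mult_right_mono) auto
  ultimately have E: "\<delta>\<^sup>2 * real N * real N powr (1 / real d) / (12000 * (real d * sqrt (real d))) \<ge> 300 * (real d * L)" by linarith
  have dL: "real d * L \<ge> 1" using d L1 mult_mono[of 1 "real d" 1 L] by auto
  have "2 * ((2 * (real d + 1) / (\<delta> / (32 * real d * real N)) + 3) ^ (d + 1))\<^sup>2 *
       (2 * exp (- (\<delta>\<^sup>2 * real N * real N powr (1 / real d)) / (12000 * (real d * sqrt (real d)))))
    \<le> 2 * exp (93 * (real d * L)) * (2 * exp (- (300 * (real d * L))))"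
    using B E by (intro mult_mono mult_left_mono) auto
  also have "\<dots> = 4 * exp (- 207 * (real d * L))" by (simp add: exp_add[symmetric])
  also have "\<dots> \<le> 4 * exp (- 3)"
  proof -
    have "- 207 * (real d * L) \<le> - 3" using dL by linarith
    then show ?thesis by simp
  qed
  also have "\<dots> < 1" using two_power_le_exp[of 3] by (simp add: exp_minus field_simps)
  finally show thesis using N1 N(1) by (intro that)
qed

section \<open>Power series of the squared arcsine\<close>

(* These are the numbers (2n choose n) / 4^n. *)
definition cbin :: "nat \<Rightarrow> real" where
  "cbin n = (- 1 / 2 gchoose n) * (- 1) ^ n"

lemma cbin_0 [simp]: "cbin 0 = 1" by (simp add: cbin_def)

lemma cbin_Suc: "cbin (Suc n) = cbin n * ((2 * real n + 1) / (2 * real n + 2))"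
proof -
  define g where "g = (- 1 / 2 :: real) gchoose n"
  define g' where "g' = (- 1 / 2 :: real) gchoose (Suc n)"
  have "(- 1 / 2) * g = real n * g + real (Suc n) * g'"
    unfolding g_def g'_def by (rule gbinomial_mult_1)
  then have "g' = - (g * ((2 * real n + 1) / (2 * real n + 2)))" by (simp add: field_simps)
  then show ?thesis by (simp add: cbin_def g_def g'_def)
qed

lemma cbin_pos: "cbin n > 0"
  by (induction n) (simp_all add: cbin_Suc)

text \<open>Squaring gives a rational induction: n (cbin n)^2 equals 1/4 at n = 1 and does not
  decrease, since (2n+1)^2 \<ge> 4n(n+1).\<close>

lemma cbin_ge: "n \<ge> 1 \<Longrightarrow> cbin n \<ge> 1 / (2 * sqrt (real n))"
proof -
  assume n: "n \<ge> 1"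
  have "1 / (4 * real n) \<le> (cbin n)\<^sup>2" using n
  proof (induction n rule: nat_induct_at_least)
    case base
    have "cbin 1 = 1 / 2" using cbin_Suc[of 0] by simp
    then show ?case by (simp only: power2_eq_square)
  next
    case (Suc n)
    define q where "q = ((2 * real n + 1) / (2 * real n + 2))\<^sup>2"
    have n0: "real n > 0" using Suc by simp
    have "1 / (4 * (real n + 1)) \<le> 1 / (4 * real n) * q"
    proof -
      have "4 * real n * (2 * real n + 2)\<^sup>2 \<le> (2 * real n + 1)\<^sup>2 * (4 * (real n + 1))"
        using n0 by (simp add: power2_eq_square algebra_simps)
      then have "1 / (4 * (real n + 1)) \<le> (2 * real n + 1)\<^sup>2 / (4 * real n * (2 * real n + 2)\<^sup>2)"
        using n0 by (subst pos_divide_le_eq, simp, subst times_divide_eq_left, subst pos_le_divide_eq) (auto simp: mult.commute)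
      then show ?thesis by (simp add: q_def power_divide mult.commute)
    qed
    also have "\<dots> \<le> (cbin n)\<^sup>2 * q" using Suc.IH by (intro mult_right_mono) (auto simp: q_def)
    also have "\<dots> = (cbin (Suc n))\<^sup>2" by (simp only: q_def cbin_Suc power_mult_distrib)
    finally show ?case by (simp add: add.commute)
  qed
  then have "sqrt (1 / (4 * real n)) \<le> cbin n" using cbin_pos[of n] by (intro real_le_lsqrt) auto
  then show ?thesis by (simp add: real_sqrt_divide real_sqrt_mult)
qed

lemma cbin_sums: "\<bar>t\<bar> < 1 \<Longrightarrow> (\<lambda>n. cbin n * t ^ (2 * n)) sums (inverse (sqrt (1 - t\<^sup>2)))"
proof -
  assume t: "\<bar>t\<bar> < 1"
  then have t2: "\<bar>- (t\<^sup>2)\<bar> < 1" by (simp add: abs_square_less_1)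
  have "(\<lambda>n. (- 1 / 2 gchoose n) * (- (t\<^sup>2)) ^ n) sums (1 + - (t\<^sup>2)) powr (- 1 / 2)"
    by (rule gen_binomial_real[OF t2])
  moreover have "(- 1 / 2 gchoose n) * (- (t\<^sup>2)) ^ n = cbin n * t ^ (2 * n)" for n
    by (simp add: cbin_def power_minus[of "t\<^sup>2"] power_mult)
  moreover have "(1 + - (t\<^sup>2)) powr (- 1 / 2) = inverse (sqrt (1 - t\<^sup>2))"
    using t2 by (simp add: powr_minus powr_half_sqrt[symmetric])
  ultimately show ?thesis by simp
qed

definition arcsin_coeff :: "nat \<Rightarrow> real" where
  "arcsin_coeff n = cbin n / (2 * real n + 1)"

lemma arcsin_coeff_pos: "arcsin_coeff n > 0"
  by (simp add: arcsin_coeff_def cbin_pos add_pos_pos)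

text \<open>Termwise differentiation, justified by uniform convergence on an interval [-r,r] with
  |x| < r < 1, gives the binomial series of the derivative of arcsin; both functions vanish at
  0.\<close>

lemma arcsin_sums_interior:
  assumes t: "\<bar>t\<bar> < 1"
  shows "(\<lambda>n. arcsin_coeff n * t ^ (2 * n + 1)) sums arcsin t"
proof -
  have D: "summable (\<lambda>n. arcsin_coeff n * x ^ (2 * n + 1)) \<and>
    ((\<lambda>x. \<Sum>n. arcsin_coeff n * x ^ (2 * n + 1)) has_field_derivative inverse (sqrt (1 - x\<^sup>2))) (at x)" if x: "\<bar>x\<bar> < 1" for x
  proof -
    define r where "r = (\<bar>x\<bar> + 1) / 2"
    have r: "\<bar>x\<bar> < r" "r < 1" "0 < r" using x by (auto simp: r_def)
    have sr: "summable (\<lambda>n. cbin n * r ^ (2 * n))" using cbin_sums[of r] r by (auto simp: sums_iff)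
    have u: "uniformly_convergent_on {-r..r} (\<lambda>n y. \<Sum>i<n. cbin i * y ^ (2 * i))"
    proof (rule Weierstrass_m_test'[OF _ sr])
      fix n y assume "y \<in> {-r..r}"
      then have "\<bar>y\<bar> ^ (2 * n) \<le> r ^ (2 * n)" by (intro power_mono) auto
      then show "norm (cbin n * y ^ (2 * n)) \<le> cbin n * r ^ (2 * n)"
        using cbin_pos[of n] by (simp add: abs_mult power_abs)
    qed
    have d: "((\<lambda>x. arcsin_coeff n * x ^ (2 * n + 1)) has_field_derivative cbin n * y ^ (2 * n)) (at y within {-r..r})" for n y
    proof -
      have "2 * real n + 1 \<noteq> 0" by linarith
      then have "arcsin_coeff n * (real (2 * n + 1) * y ^ (2 * n + 1 - Suc 0)) = cbin n * y ^ (2 * n)"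
        by (simp add: arcsin_coeff_def add.commute)
      then show ?thesis by (rule DERIV_cong[OF DERIV_cmult[OF DERIV_pow]])
    qed
    have s0: "summable (\<lambda>n. arcsin_coeff n * 0 ^ (2 * n + 1))" by simp
    have xi: "x \<in> interior {-r..r}" using r by auto
    have "summable (\<lambda>n. arcsin_coeff n * x ^ (2 * n + 1))"
      "((\<lambda>x. \<Sum>n. arcsin_coeff n * x ^ (2 * n + 1)) has_field_derivative (\<Sum>n. cbin n * x ^ (2 * n))) (at x)"
      using has_field_derivative_series'[of "{-r..r}" "\<lambda>n x. arcsin_coeff n * x ^ (2 * n + 1)" "\<lambda>n x. cbin n * x ^ (2 * n)" 0 x]
        d u s0 xi r by auto
    then show ?thesis using cbin_sums[OF x] by (simp add: sums_iff)
  qed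
  define h where "h x = (\<Sum>n. arcsin_coeff n * x ^ (2 * n + 1)) - arcsin x" for x
  have "(h has_field_derivative 0) (at x within {-1<..<1})" if "x \<in> {-1<..<1}" for x
  proof -
    have "\<bar>x\<bar> < 1" using that by auto
    then have "(h has_field_derivative inverse (sqrt (1 - x\<^sup>2)) - inverse (sqrt (1 - x\<^sup>2))) (at x)"
      unfolding h_def using D[of x] that by (intro DERIV_diff DERIV_arcsin) auto
    then show ?thesis by (simp add: has_field_derivative_at_within)
  qed
  then obtain c where c: "\<And>x. x \<in> {-1<..<1} \<Longrightarrow> h x = c"
    using has_field_derivative_zero_constant[of "{-1<..<1}" h] by auto
  have "h 0 = 0" by (simp add: h_def)
  then have "h t = 0" using c[of 0] c[of t] t by (auto simp: abs_less_iff)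
  then show ?thesis using D[OF t] by (simp add: h_def sums_iff)
qed

text \<open>The terms are nonnegative on [0,1), so each partial sum there is at most arcsin t \<le>
  pi/2; let t tend to 1 from the left. This gives the majorant for uniform convergence up to the
  endpoints.\<close>

lemma summable_arcsin_coeff: "summable arcsin_coeff"
proof (rule summableI_nonneg_bounded)
  show "0 \<le> arcsin_coeff n" for n using arcsin_coeff_pos[of n] by simp
  fix n
  have "(\<Sum>i<n. arcsin_coeff i * t ^ (2 * i + 1)) \<le> pi / 2" if t: "t \<in> {0..<1}" for t :: real
  proof -
    have t1: "\<bar>t\<bar> < 1" using t by auto
    have "(\<Sum>i<n. arcsin_coeff i * t ^ (2 * i + 1)) \<le> arcsin t"
    proof -
      have "summable (\<lambda>i. arcsin_coeff i * t ^ (2 * i + 1))" "arcsin t = (\<Sum>i. arcsin_coeff i * t ^ (2 * i + 1))"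
        using arcsin_sums_interior[OF t1] by (auto simp: sums_iff)
      moreover have "0 \<le> arcsin_coeff i * t ^ (2 * i + 1)" for i
        using arcsin_coeff_pos[of i] t by (intro mult_nonneg_nonneg zero_le_power) auto
      ultimately show ?thesis using sum_le_suminf[of "\<lambda>i. arcsin_coeff i * t ^ (2 * i + 1)" "{..<n}"] by simp
    qed
    also have "\<dots> \<le> pi / 2" using t by (intro arcsin_ubound) auto
    finally show ?thesis .
  qed
  then have ev: "\<forall>\<^sub>F t in at_left (1::real). (\<Sum>i<n. arcsin_coeff i * t ^ (2 * i + 1)) \<le> pi / 2"
    by (intro eventually_mono[OF eventually_at_left_real[of 0 1]]) auto
  have "((\<lambda>t. \<Sum>i<n. arcsin_coeff i * t ^ (2 * i + 1)) \<longlongrightarrow> (\<Sum>i<n. arcsin_coeff i * 1 ^ (2 * i + 1))) (at_left 1)"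
    by (intro tendsto_intros)
  then have "(\<Sum>i<n. arcsin_coeff i * 1 ^ (2 * i + 1)) \<le> pi / 2"
    using ev by (rule tendsto_upperbound) simp
  then show "(\<Sum>i<n. arcsin_coeff i) \<le> pi / 2" by simp
qed

lemma arcsin_term_bound: "\<bar>t\<bar> \<le> 1 \<Longrightarrow> norm (arcsin_coeff n * t ^ (2 * n + 1)) \<le> arcsin_coeff n"
  using power_le_one[of "\<bar>t\<bar>" "2 * n + 1"] arcsin_coeff_pos[of n]
  by (simp add: abs_mult power_abs mult_left_le del: power_Suc)

text \<open>The endpoints matter because the diagonal terms of the energy have t = 1. By uniform
  convergence the sum is continuous on [-1,1], so the identity extends from the open
  interval.\<close>

lemma arcsin_sums:
  assumes t: "\<bar>t\<bar> \<le> 1"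
  shows "(\<lambda>n. arcsin_coeff n * t ^ (2 * n + 1)) sums arcsin t"
proof -
  define F where "F x = (\<Sum>n. arcsin_coeff n * x ^ (2 * n + 1))" for x
  have "uniform_limit {-1..1} (\<lambda>n x. \<Sum>i<n. arcsin_coeff i * x ^ (2 * i + 1)) F sequentially"
    unfolding F_def by (rule Weierstrass_m_test[OF _ summable_arcsin_coeff]) (use arcsin_term_bound in auto)
  then have "continuous_on {-1..1} F"
    by (rule uniform_limit_theorem[rotated]) (auto intro!: always_eventually continuous_intros)
  then have cont: "continuous_on (closure {-1<..<1}) (\<lambda>x. F x - arcsin x)"
    by (simp add: continuous_on_diff continuous_on_arcsin')
  have "F t - arcsin t = 0"
  proof (rule continuous_constant_on_closure[OF cont])
    fix x :: real assume "x \<in> {-1<..<1}"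
    then have "\<bar>x\<bar> < 1" by auto
    from arcsin_sums_interior[OF this] show "F x - arcsin x = 0" by (simp add: F_def sums_iff)
  qed (use t in auto)
  moreover have "summable (\<lambda>n. arcsin_coeff n * t ^ (2 * n + 1))"
    using arcsin_term_bound[OF t] by (intro summable_comparison_test'[OF summable_arcsin_coeff]) auto
  ultimately show ?thesis by (simp add: F_def sums_iff)
qed

definition arcsin_sq_coeff :: "nat \<Rightarrow> real" where
  "arcsin_sq_coeff k = (\<Sum>i\<le>k. arcsin_coeff i * arcsin_coeff (k - i))"

lemma arcsin_sq_sums:
  assumes t: "\<bar>t\<bar> \<le> 1"
  shows "(\<lambda>k. arcsin_sq_coeff k * t ^ (2 * k + 2)) sums (arcsin t)\<^sup>2"
proof -
  let ?f = "\<lambda>n. arcsin_coeff n * t ^ (2 * n + 1)"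
  have s: "summable (\<lambda>n. norm (?f n))"
    using arcsin_term_bound[OF t] by (intro summable_comparison_test'[OF summable_arcsin_coeff]) auto
  have "(\<lambda>k. \<Sum>i\<le>k. ?f i * ?f (k - i)) sums ((\<Sum>k. ?f k) * (\<Sum>k. ?f k))"
    by (rule Cauchy_product_sums[OF s s])
  moreover have "(\<Sum>i\<le>k. ?f i * ?f (k - i)) = arcsin_sq_coeff k * t ^ (2 * k + 2)" for k
    unfolding arcsin_sq_coeff_def sum_distrib_right
  proof (intro sum.cong refl)
    fix i assume i: "i \<in> {..k}"
    have "t ^ (2 * i + 1) * t ^ (2 * (k - i) + 1) = t ^ (2 * k + 2)"
      unfolding power_add[symmetric] using i by (intro arg_cong[where f="power t"]) auto
    then show "?f i * ?f (k - i) = arcsin_coeff i * arcsin_coeff (k - i) * t ^ (2 * k + 2)"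
      by (metis (no_types, lifting) mult.assoc mult.left_commute)
  qed
  moreover have "(\<Sum>k. ?f k) = arcsin t" using arcsin_sums[OF t] by (simp add: sums_iff)
  ultimately show ?thesis by (simp add: power2_eq_square)
qed

lemma arcsin_sq_coeff_nonneg: "arcsin_sq_coeff k \<ge> 0"
  unfolding arcsin_sq_coeff_def using arcsin_coeff_pos by (intro sum_nonneg mult_nonneg_nonneg) (auto intro: less_imp_le)

lemma summable_arcsin_sq_coeff: "summable arcsin_sq_coeff"
  using arcsin_sq_sums[of 1] by (simp add: sums_iff)

text \<open>The summand i = 0 of the convolution already has the order k^(-3/2).\<close>

lemma arcsin_sq_coeff_ge:
  assumes "k \<ge> 1"
  shows "arcsin_sq_coeff k \<ge> 1 / (6 * real k * sqrt (real k))"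
proof -
  have "1 / (6 * real k * sqrt (real k)) = 1 / (2 * sqrt (real k)) / (3 * real k)" by simp
  also have "\<dots> \<le> cbin k / (3 * real k)" using cbin_ge[OF assms] by (intro divide_right_mono) auto
  also have "\<dots> \<le> arcsin_coeff k"
    unfolding arcsin_coeff_def using assms cbin_pos[of k] by (intro divide_left_mono) auto
  also have "\<dots> = arcsin_coeff 0 * arcsin_coeff (k - 0)" by (simp add: arcsin_coeff_def)
  also have "\<dots> \<le> arcsin_sq_coeff k"
    unfolding arcsin_sq_coeff_def using arcsin_coeff_pos
    by (intro member_le_sum[of 0 "{..k}" "\<lambda>i. arcsin_coeff i * arcsin_coeff (k - i)"]) (auto intro: less_imp_le mult_nonneg_nonneg)
  finally show ?thesis .
qed

text \<open>A dyadic block has K terms of order K^(-3/2), enough for the order K^(-1/2). The 20 is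
  12 * 5/3, where 5/3 bounds sqrt 2.\<close>

lemma sum_arcsin_sq_coeff_ge:
  assumes "K \<ge> 1"
  shows "(\<Sum>k\<in>{K..<2*K}. arcsin_sq_coeff k) \<ge> 1 / (20 * sqrt (real K))"
proof -
  have K: "real K > 0" using assms by simp
  have s2: "sqrt 2 \<le> 3 / 2" by (rule real_le_lsqrt) (auto simp: power2_eq_square)
  have "1 / (20 * sqrt (real K)) = real K * (1 / (20 * real K * sqrt (real K)))" using K by simp
  also have "\<dots> \<le> real K * (1 / (6 * (2 * real K) * sqrt (2 * real K)))"
  proof (intro mult_left_mono divide_left_mono)
    have "12 * real K * (sqrt 2 * sqrt (real K)) \<le> 12 * real K * (5 / 3 * sqrt (real K))"
      using s2 K by (intro mult_left_mono mult_right_mono) auto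
    then show "6 * (2 * real K) * sqrt (2 * real K) \<le> 20 * real K * sqrt (real K)" by (simp add: real_sqrt_mult)
  qed (use K in auto)
  also have "\<dots> = (\<Sum>k\<in>{K..<2*K}. 1 / (6 * (2 * real K) * sqrt (2 * real K)))" by simp
  also have "\<dots> \<le> (\<Sum>k\<in>{K..<2*K}. arcsin_sq_coeff k)"
  proof (intro sum_mono)
    fix k assume k: "k \<in> {K..<2*K}"
    then have k': "k \<ge> 1" "real k \<le> 2 * real K" using assms by auto
    have "1 / (6 * (2 * real K) * sqrt (2 * real K)) \<le> 1 / (6 * real k * sqrt (real k))"
      using k' by (intro divide_left_mono mult_mono) auto
    also have "\<dots> \<le> arcsin_sq_coeff k" by (rule arcsin_sq_coeff_ge[OF k'(1)])
    finally show "1 / (6 * (2 * real K) * sqrt (2 * real K)) \<le> arcsin_sq_coeff k" .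
  qed
  finally show ?thesis .
qed

section \<open>Moments of a random direction\<close>

text \<open>The energy of the uniform measure for the kernel t^m: by rotation invariance one of the
  two points can be fixed at the first basis vector.\<close>

definition dir_moment :: "nat \<Rightarrow> nat \<Rightarrow> real" where
  "dir_moment d m = (\<integral>z. (z 0 / snorm d z) ^ m \<partial>gauss d)"

lemma measurable_snorm [measurable (raw)]:
  assumes "\<And>i. i \<le> d \<Longrightarrow> (\<lambda>x. f x i) \<in> borel_measurable M"
  shows "(\<lambda>x. snorm d (f x)) \<in> borel_measurable M"
proof -
  have [measurable]: "(\<lambda>x. sdot d (f x) (f x)) \<in> borel_measurable M" by (intro measurable_sdot assms)
  show ?thesis unfolding snorm_def by measurable
qed

lemma sdot_plane_unit: "d \<ge> 1 \<Longrightarrow> sdot d (plane_vec 1 0) (plane_vec 1 0) = 1"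
  by (simp only: sdot_plane_vec) (simp add: plane_vec_def)

lemma AE_snorm_nonzero: "d \<ge> 2 \<Longrightarrow> AE z in gauss d. snorm d z \<noteq> 0"
  using AE_coord_nonzero[of d 0] by (auto elim!: eventually_mono) (metis abs_le_zero_iff snorm_ge_coord zero_le)

lemma integral_dir_power:
  assumes d: "d \<ge> 2" and x: "sdot d x x = 1"
  shows "(\<integral>z. (sdot d z x / snorm d z) ^ m \<partial>gauss d) = dir_moment d m"
proof -
  have "(\<integral>z. (\<lambda>p. (fst p / sqrt (snd (snd p))) ^ m) (sdot d z x, sdot d z x, sdot d z z) \<partial>gauss d) =
    (\<integral>z. (\<lambda>p. (fst p / sqrt (snd (snd p))) ^ m) (sdot d z (plane_vec 1 0), sdot d z (plane_vec 1 0), sdot d z z) \<partial>gauss d)"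
    using d x sdot_plane_unit[of d] by (intro gauss_integral_gram_eq) auto
  then show ?thesis using d by (simp add: dir_moment_def snorm_def sdot_plane_vec)
qed

lemma abs_dir_le:
  assumes "sdot d x x = 1"
  shows "\<bar>sdot d z x / snorm d z\<bar> \<le> 1"
proof -
  have "\<bar>sdot d z x\<bar> \<le> snorm d z" using abs_sdot_le[of d z x] assms by (simp add: snorm_def)
  then show ?thesis using snorm_nonneg[of d z] by (cases "snorm d z = 0") (auto simp: abs_divide divide_le_eq_1)
qed

text \<open>The coordinate with multi-index \<alpha> of the m-fold tensor power of x.\<close>

definition tensor_coord :: "nat \<Rightarrow> (nat \<Rightarrow> nat) \<Rightarrow> (nat \<Rightarrow> real) \<Rightarrow> real" where
  "tensor_coord m \<alpha> x = (\<Prod>i<m. x (\<alpha> i))"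

lemma sdot_power_tensor:
  "sdot d x y ^ m = (\<Sum>\<alpha>\<in>{..<m} \<rightarrow>\<^sub>E {..d}. tensor_coord m \<alpha> x * tensor_coord m \<alpha> y)"
proof -
  have "sdot d x y ^ m = (\<Prod>i\<in>{..<m}. \<Sum>k\<in>{..d}. x k * y k)" by (simp add: sdot_def)
  also have "\<dots> = (\<Sum>\<alpha>\<in>{..<m} \<rightarrow>\<^sub>E {..d}. \<Prod>i\<in>{..<m}. x (\<alpha> i) * y (\<alpha> i))"
    by (rule prod_sum_PiE) auto
  finally show ?thesis by (simp add: tensor_coord_def prod.distrib)
qed

lemma unit_direction_coord_le: "i \<le> d \<Longrightarrow> \<bar>unit_direction d z i\<bar> \<le> 1"
  using snorm_ge_coord[of i d z] snorm_nonneg[of d z]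
  by (cases "snorm d z = 0") (auto simp: unit_direction_def abs_divide divide_le_eq_1)

text \<open>Let S be the mean tensor of the points and I that of a random direction. Then |S|^2 is
  the energy of the points, while both <S, I> and |I|^2 equal \<open>dir_moment d m\<close>, because
  averaging over a random direction does not depend on the other vector. Now expand |S - I|^2 \<ge>
  0.\<close>

proposition dir_moment_le_average:
  assumes d: "d \<ge> 2" and N: "N \<ge> 1" and z: "\<And>j. j \<in> {1..N} \<Longrightarrow> sdot d (z j) (z j) = 1"
  shows "dir_moment d m \<le> (\<Sum>j\<in>{1..N}. \<Sum>l\<in>{1..N}. sdot d (z j) (z l) ^ m) / (real N)\<^sup>2"
proof -
  define A where "A = {..<m} \<rightarrow>\<^sub>E {..d}"
  define I where "I \<alpha> = (\<integral>w. tensor_coord m \<alpha> (unit_direction d w) \<partial>gauss d)" for \<alpha>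
  define S where "S \<alpha> = (\<Sum>j\<in>{1..N}. tensor_coord m \<alpha> (z j)) / real N" for \<alpha>
  have int: "integrable (gauss d) (\<lambda>w. tensor_coord m \<alpha> (unit_direction d w))" if \<alpha>: "\<alpha> \<in> A" for \<alpha>
  proof (rule gauss.integrable_const_bound[where B=1])
    have \<alpha>d: "\<alpha> i \<le> d" if "i < m" for i using \<alpha> that by (auto simp: A_def PiE_iff)
    have "\<bar>tensor_coord m \<alpha> (unit_direction d w)\<bar> \<le> 1" for w
      unfolding tensor_coord_def abs_prod using \<alpha>d unit_direction_coord_le by (intro prod_le_1) auto
    then show "AE w in gauss d. norm (tensor_coord m \<alpha> (unit_direction d w)) \<le> 1" by simp
    have "(\<lambda>w. unit_direction d w (\<alpha> i)) \<in> borel_measurable (gauss d)" if "i < m" for i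
      using \<alpha>d[OF that] unfolding unit_direction_def by (simp add: measurable_coord)
    then show "(\<lambda>w. tensor_coord m \<alpha> (unit_direction d w)) \<in> borel_measurable (gauss d)"
      unfolding tensor_coord_def by (intro borel_measurable_prod) auto
  qed
  have cross: "(\<Sum>\<alpha>\<in>A. tensor_coord m \<alpha> x * I \<alpha>) = dir_moment d m" if x: "sdot d x x = 1" for x
  proof -
    have "(\<Sum>\<alpha>\<in>A. tensor_coord m \<alpha> x * I \<alpha>) = (\<integral>w. (\<Sum>\<alpha>\<in>A. tensor_coord m \<alpha> x * tensor_coord m \<alpha> (unit_direction d w)) \<partial>gauss d)"
      unfolding I_def using int by (subst Bochner_Integration.integral_sum) auto
    also have "\<dots> = (\<integral>w. (sdot d w x / snorm d w) ^ m \<partial>gauss d)"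
      by (simp add: A_def sdot_power_tensor[symmetric] sdot_commute[of d x] sdot_unit_direction)
    finally show ?thesis using integral_dir_power[OF d x] by simp
  qed
  have II: "(\<Sum>\<alpha>\<in>A. I \<alpha> * I \<alpha>) = dir_moment d m"
  proof -
    have "(\<Sum>\<alpha>\<in>A. I \<alpha> * I \<alpha>) = (\<Sum>\<alpha>\<in>A. (\<integral>w. tensor_coord m \<alpha> (unit_direction d w) * I \<alpha> \<partial>gauss d))"
      by (simp add: I_def)
    also have "\<dots> = (\<integral>w. (\<Sum>\<alpha>\<in>A. tensor_coord m \<alpha> (unit_direction d w) * I \<alpha>) \<partial>gauss d)"
      using int by (subst Bochner_Integration.integral_sum) auto
    also have "\<dots> = (\<integral>w. dir_moment d m \<partial>gauss d)"
    proof (rule integral_cong_AE)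
      show "AE w in gauss d. (\<Sum>\<alpha>\<in>A. tensor_coord m \<alpha> (unit_direction d w) * I \<alpha>) = dir_moment d m"
        using AE_snorm_nonzero[OF d]
      proof eventually_elim
        case (elim w)
        then show ?case using unit_direction_in_sphere[of d w] by (intro cross) (auto simp: unit_sphere_iff)
      qed
      show "(\<lambda>w. \<Sum>\<alpha>\<in>A. tensor_coord m \<alpha> (unit_direction d w) * I \<alpha>) \<in> borel_measurable (gauss d)"
        using int by (intro borel_measurable_sum borel_measurable_times) (auto dest: borel_measurable_integrable)
    qed simp
    finally show ?thesis by (simp add: gauss.prob_space)
  qed
  have SI: "(\<Sum>\<alpha>\<in>A. S \<alpha> * I \<alpha>) = dir_moment d m"
  proof -
    have "(\<Sum>\<alpha>\<in>A. S \<alpha> * I \<alpha>) = (\<Sum>\<alpha>\<in>A. \<Sum>j\<in>{1..N}. tensor_coord m \<alpha> (z j) * I \<alpha>) / real N"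
      by (simp add: S_def sum_distrib_right sum_divide_distrib)
    also have "\<dots> = (\<Sum>j\<in>{1..N}. \<Sum>\<alpha>\<in>A. tensor_coord m \<alpha> (z j) * I \<alpha>) / real N"
      by (subst sum.swap) simp
    also have "\<dots> = (\<Sum>j\<in>{1..N}. dir_moment d m) / real N" using z cross by (intro arg_cong2[where f="(/)"] sum.cong) auto
    finally show ?thesis using N by simp
  qed
  have SS: "(\<Sum>\<alpha>\<in>A. S \<alpha> * S \<alpha>) = (\<Sum>j\<in>{1..N}. \<Sum>l\<in>{1..N}. sdot d (z j) (z l) ^ m) / (real N)\<^sup>2"
  proof -
    have "S \<alpha> * S \<alpha> = (\<Sum>j\<in>{1..N}. \<Sum>l\<in>{1..N}. tensor_coord m \<alpha> (z j) * tensor_coord m \<alpha> (z l)) / (real N)\<^sup>2" for \<alpha>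
      by (simp add: S_def power2_eq_square sum_product)
    then have "(\<Sum>\<alpha>\<in>A. S \<alpha> * S \<alpha>) = (\<Sum>\<alpha>\<in>A. \<Sum>j\<in>{1..N}. \<Sum>l\<in>{1..N}. tensor_coord m \<alpha> (z j) * tensor_coord m \<alpha> (z l)) / (real N)\<^sup>2"
      by (simp add: sum_divide_distrib)
    also have "(\<Sum>\<alpha>\<in>A. \<Sum>j\<in>{1..N}. \<Sum>l\<in>{1..N}. tensor_coord m \<alpha> (z j) * tensor_coord m \<alpha> (z l)) =
      (\<Sum>j\<in>{1..N}. \<Sum>l\<in>{1..N}. \<Sum>\<alpha>\<in>A. tensor_coord m \<alpha> (z j) * tensor_coord m \<alpha> (z l))"
      by (subst sum.swap, intro sum.cong refl, subst sum.swap) simp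
    finally show ?thesis by (simp add: A_def sdot_power_tensor)
  qed
  have "0 \<le> (\<Sum>\<alpha>\<in>A. (S \<alpha> - I \<alpha>)\<^sup>2)" by (intro sum_nonneg) auto
  also have "\<dots> = (\<Sum>\<alpha>\<in>A. S \<alpha> * S \<alpha> - 2 * (S \<alpha> * I \<alpha>) + I \<alpha> * I \<alpha>)"
    by (intro sum.cong refl) (simp add: power2_eq_square algebra_simps)
  also have "\<dots> = (\<Sum>\<alpha>\<in>A. S \<alpha> * S \<alpha>) - 2 * (\<Sum>\<alpha>\<in>A. S \<alpha> * I \<alpha>) + (\<Sum>\<alpha>\<in>A. I \<alpha> * I \<alpha>)"
    by (simp add: sum.distrib sum_subtractf sum_distrib_left)
  finally show ?thesis unfolding SS SI II by simp
qed

section \<open>Decay of the even moments\<close>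

lemma nn_integral_exp_std_gauss_le:
  assumes "\<sigma> > 0"
  shows "(\<integral>\<^sup>+ y. ennreal (exp (- (y\<^sup>2 / (2 * \<sigma>\<^sup>2)))) \<partial>std_gauss) \<le> ennreal \<sigma>"
proof -
  have "(\<integral>\<^sup>+ y. ennreal (exp (- (y\<^sup>2 / (2 * \<sigma>\<^sup>2)))) \<partial>std_gauss)
    = (\<integral>\<^sup>+ y. ennreal (std_normal_density y) * ennreal (exp (- (y\<^sup>2 / (2 * \<sigma>\<^sup>2)))) \<partial>lborel)"
    by (subst nn_integral_density) auto
  also have "\<dots> \<le> (\<integral>\<^sup>+ y. ennreal \<sigma> * ennreal (normal_density 0 \<sigma> y) \<partial>lborel)"
  proof (intro nn_integral_mono)
    fix y :: real
    have "std_normal_density y * exp (- (y\<^sup>2 / (2 * \<sigma>\<^sup>2))) \<le> 1 / sqrt (2 * pi) * exp (- (y\<^sup>2 / (2 * \<sigma>\<^sup>2)))"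
      by (intro mult_right_mono) (auto simp: std_normal_density_def divide_right_mono)
    also have "\<dots> = \<sigma> * normal_density 0 \<sigma> y"
      using assms by (simp add: normal_density_def real_sqrt_mult)
    finally show "ennreal (std_normal_density y) * ennreal (exp (- (y\<^sup>2 / (2 * \<sigma>\<^sup>2)))) \<le> ennreal \<sigma> * ennreal (normal_density 0 \<sigma> y)"
      using assms by (simp add: ennreal_mult[symmetric] ennreal_leI)
  qed
  also have "\<dots> = ennreal \<sigma> * (\<integral>\<^sup>+ y. ennreal (normal_density 0 \<sigma> y) \<partial>lborel)"
    by (intro nn_integral_cmult) auto
  also have "(\<integral>\<^sup>+ y. ennreal (normal_density 0 \<sigma> y) \<partial>lborel) = 1"
    using assms by (subst nn_integral_eq_integral) auto
  finally show ?thesis by simp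
qed

text \<open>With u = s/r the base is 1/(1+u). For u \<le> 1 it is at most e^(-u/2), and otherwise at
  most 1/2; adding the two bounds avoids splitting the integral.\<close>

lemma ratio_power_le:
  fixes r s :: real
  assumes "r > 0" "s \<ge> 0"
  shows "(r / (r + s)) ^ k \<le> exp (- (real k * s / (2 * r))) + (1 / 2) ^ k"
proof (cases "s \<le> r")
  case True
  define u where "u = s / r"
  have u: "0 \<le> u" "u \<le> 1" using assms True by (auto simp: u_def)
  have "exp (u / 2) \<le> 1 + u / 2 + (u / 2)\<^sup>2" using u by (intro exp_bound) auto
  also have "\<dots> \<le> 1 + u" using u mult_left_mono[of u 1 u] by (simp add: power2_eq_square)
  finally have e: "exp (u / 2) \<le> 1 + u" .
  have "r / (r + s) = 1 / (1 + u)" using assms by (simp add: u_def field_simps)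
  also have "\<dots> \<le> 1 / exp (u / 2)" using e u by (intro divide_left_mono) auto
  also have "\<dots> = exp (- (u / 2))" by (simp add: exp_minus inverse_eq_divide)
  finally have "(r / (r + s)) ^ k \<le> exp (- (u / 2)) ^ k" using assms by (intro power_mono) auto
  also have "\<dots> = exp (- (real k * s / (2 * r)))" by (simp add: exp_of_nat_mult[symmetric] u_def)
  finally show ?thesis by (smt (verit) zero_le_power divide_nonneg_nonneg)
next
  case False
  then have "r / (r + s) \<le> 1 / 2" using assms by (simp add: field_simps)
  then have "(r / (r + s)) ^ k \<le> (1 / 2) ^ k" using assms by (intro power_mono) auto
  then show ?thesis by (smt (verit) exp_ge_zero)
qed

text \<open>Apply \<open>ratio_power_le\<close> with r = z_0^2 and s the sum of the other squares.
  Its exponential is a Gaussian of width |z_0| / sqrt k in each of d coordinates and integrates to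
  at most (|z_0| / sqrt k)^d, so the d-th absolute moment of z_0 appears as constant. The remainder
  2^(-k) is smaller than any power of k, up to a constant.\<close>

proposition dir_moment_bound:
  assumes d: "d \<ge> 2"
  shows "\<exists>C\<ge>1. \<forall>k\<ge>1. dir_moment d (2 * k) \<le> C * (1 / sqrt (real k)) ^ d"
proof -
  define c1 where "c1 = (\<integral>y. std_normal_density y * \<bar>y\<bar> ^ d \<partial>lborel)"
  have c1: "c1 \<ge> 0" unfolding c1_def by (intro integral_nonneg_AE) auto
  have nc1: "(\<integral>\<^sup>+ y. ennreal (\<bar>y\<bar> ^ d) \<partial>std_gauss) = ennreal c1"
  proof -
    have "(\<integral>\<^sup>+ y. ennreal (\<bar>y\<bar> ^ d) \<partial>std_gauss) = (\<integral>\<^sup>+ y. ennreal (std_normal_density y * \<bar>y\<bar> ^ d) \<partial>lborel)"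
      by (subst nn_integral_density) (auto simp: ennreal_mult)
    also have "\<dots> = ennreal c1" unfolding c1_def by (intro nn_integral_eq_integral integrable_std_normal_moment_abs) auto
    finally show ?thesis .
  qed
  \<comment> \<open>From a single term of the exponential series: (k ln 2)^d / d! is at most e^(k ln
    2) = 2^k.\<close>
  define c2 :: real where "c2 = fact d / (ln 2) ^ d"
  have c2: "(1 / 2) ^ k \<le> c2 * (1 / sqrt (real k)) ^ d" if k: "k \<ge> 1" for k :: nat
  proof -
    have x: "real k * ln 2 > 0" using k by simp
    have "(real k * ln 2) ^ d / fact d \<le> exp (real k * ln 2)"
    proof -
      have s: "(\<lambda>n. (real k * ln 2) ^ n / fact n) sums exp (real k * ln 2)"
        using exp_converges[of "real k * ln 2"] by (simp add: divide_inverse mult.commute)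
      then have "(\<Sum>n\<in>{d}. (real k * ln 2) ^ n / fact n) \<le> (\<Sum>n. (real k * ln 2) ^ n / fact n)"
        using x by (intro sum_le_suminf) (auto simp: sums_iff)
      then show ?thesis using s by (simp add: sums_iff)
    qed
    also have "\<dots> = 2 ^ k" by (simp add: exp_of_nat_mult)
    finally have "(1 / 2) ^ k * ((real k) ^ d * ((ln 2) ^ d / fact d)) \<le> 1"
      by (simp add: power_mult_distrib field_simps)
    then have "(1 / 2) ^ k \<le> c2 * (1 / real k) ^ d"
      using k by (simp add: c2_def power_divide field_simps)
    also have "\<dots> \<le> c2 * (1 / sqrt (real k)) ^ d"
    proof (intro mult_left_mono power_mono divide_left_mono)
      show "sqrt (real k) \<le> real k" using k by (intro real_le_lsqrt) (auto simp: power2_eq_square)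
    qed (use k in \<open>auto simp: c2_def\<close>)
    finally show ?thesis .
  qed
  have c20: "c2 \<ge> 0" by (simp add: c2_def)
  have main: "dir_moment d (2 * k) \<le> (c1 + c2) * (1 / sqrt (real k)) ^ d" if k: "k \<ge> 1" for k
  proof -
    define q where "q = (1 / sqrt (real k)) ^ d"
    have q: "q \<ge> 0" by (simp add: q_def)
    define G where "G z = (\<Prod>i\<in>{1..d}. exp (- ((z i)\<^sup>2 / (2 * (\<bar>z 0\<bar> / sqrt (real k))\<^sup>2))))" for z :: "nat \<Rightarrow> real"
    have split: "{..d} = insert 0 {1..d}" by auto
    have Gm [measurable]: "G \<in> borel_measurable (gauss d)"
      unfolding G_def by (intro borel_measurable_prod) (auto intro!: measurable_coord)
    let ?I = "PiM {1..d} (\<lambda>_. std_gauss)"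
    have "(\<integral>\<^sup>+ z. ennreal (G z) \<partial>gauss d) \<le> ennreal (c1 * q)"
    proof -
      have mG: "(\<lambda>z. ennreal (G z)) \<in> borel_measurable (PiM (insert 0 {1..d}) (\<lambda>_. std_gauss))"
        using Gm unfolding gauss_def split by measurable
      have "(\<integral>\<^sup>+ z. ennreal (G z) \<partial>gauss d) = (\<integral>\<^sup>+ y. \<integral>\<^sup>+ w. ennreal (G (w(0 := y))) \<partial>?I \<partial>std_gauss)"
        unfolding gauss_def split by (rule gauss_product.product_nn_integral_insert_rev[OF _ _ mG]) auto
      also have "\<dots> \<le> (\<integral>\<^sup>+ y. ennreal q * ennreal (\<bar>y\<bar> ^ d) \<partial>std_gauss)"
      proof (rule nn_integral_mono_AE)
        have "AE y in lborel. y \<noteq> (0::real)" by (rule AE_lborel_singleton)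
        then have "AE y in std_gauss. y \<noteq> 0" by (subst AE_density) (auto elim: eventually_mono)
        then show "AE y in std_gauss. (\<integral>\<^sup>+ w. ennreal (G (w(0 := y))) \<partial>?I) \<le> ennreal q * ennreal (\<bar>y\<bar> ^ d)"
        proof eventually_elim
          case (elim y)
          define \<sigma> where "\<sigma> = \<bar>y\<bar> / sqrt (real k)"
          have \<sigma>: "\<sigma> > 0" using elim k by (simp add: \<sigma>_def)
          have "(\<integral>\<^sup>+ w. ennreal (G (w(0 := y))) \<partial>?I) = (\<integral>\<^sup>+ w. (\<Prod>i\<in>{1..d}. ennreal (exp (- ((w i)\<^sup>2 / (2 * \<sigma>\<^sup>2))))) \<partial>?I)"
          proof (rule nn_integral_cong)
            fix w :: "nat \<Rightarrow> real"
            have "G (w(0 := y)) = (\<Prod>i\<in>{1..d}. exp (- ((w i)\<^sup>2 / (2 * \<sigma>\<^sup>2))))"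
              unfolding G_def \<sigma>_def by (intro prod.cong) auto
            then show "ennreal (G (w(0 := y))) = (\<Prod>i\<in>{1..d}. ennreal (exp (- ((w i)\<^sup>2 / (2 * \<sigma>\<^sup>2)))))"
              by (simp add: prod_ennreal)
          qed
          also have "\<dots> = (\<Prod>i\<in>{1..d}. \<integral>\<^sup>+ u. ennreal (exp (- (u\<^sup>2 / (2 * \<sigma>\<^sup>2)))) \<partial>std_gauss)"
            by (intro gauss_product.product_nn_integral_prod) auto
          also have "\<dots> \<le> (\<Prod>i\<in>{1..d}. ennreal \<sigma>)"
            by (intro prod_mono_ennreal nn_integral_exp_std_gauss_le \<sigma>)
          also have "\<dots> = ennreal (\<sigma> ^ d)" using \<sigma> by (simp add: ennreal_power)
          also have "\<sigma> ^ d = q * \<bar>y\<bar> ^ d" by (simp add: \<sigma>_def q_def power_divide)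
          also have "ennreal (q * \<bar>y\<bar> ^ d) = ennreal q * ennreal (\<bar>y\<bar> ^ d)" using q by (intro ennreal_mult) auto
          finally show ?case .
        qed
      qed
      also have "\<dots> = ennreal q * ennreal c1" by (subst nn_integral_cmult) (auto simp: nc1)
      also have "\<dots> = ennreal (c1 * q)" using q c1 by (simp add: ennreal_mult[symmetric] mult.commute)
      finally show ?thesis .
    qed
    note Gle = this
    have pw: "AE z in gauss d. (z 0 / snorm d z) ^ (2 * k) \<le> G z + (1 / 2) ^ k"
      using AE_coord_nonzero[OF d zero_le]
    proof eventually_elim
      case (elim z)
      define s where "s = (\<Sum>i\<in>{1..d}. (z i)\<^sup>2)"
      have s: "s \<ge> 0" unfolding s_def by (intro sum_nonneg) auto
      have "sdot d z z = (z 0)\<^sup>2 + s" unfolding sdot_def split s_def by (simp add: power2_eq_square)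
      then have "(z 0 / snorm d z) ^ (2 * k) = ((z 0)\<^sup>2 / ((z 0)\<^sup>2 + s)) ^ k"
        using s by (simp add: power_mult power_divide snorm_def)
      also have "\<dots> \<le> exp (- (real k * s / (2 * (z 0)\<^sup>2))) + (1 / 2) ^ k"
        using elim s by (intro ratio_power_le) auto
      also have "exp (- (real k * s / (2 * (z 0)\<^sup>2))) = G z"
        unfolding G_def exp_sum[OF finite_atLeastAtMost, symmetric] s_def
        using elim k by (simp add: sum_negf sum_distrib_left sum_divide_distrib power_divide mult.commute)
      finally show ?case .
    qed
    have bm: "(\<lambda>z. (z 0 / snorm d z) ^ (2 * k)) \<in> borel_measurable (gauss d)" by measurable
    have le1: "\<bar>z 0 / snorm d z\<bar> \<le> 1" for z
      using abs_dir_le[OF sdot_plane_unit, of d z] d by (simp add: sdot_plane_vec)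
    have "integrable (gauss d) (\<lambda>z. (z 0 / snorm d z) ^ (2 * k))"
      using bm le1 by (intro gauss.integrable_const_bound[where B=1]) (auto simp: power_abs intro!: power_le_one AE_I2)
    then have "ennreal (dir_moment d (2 * k)) = (\<integral>\<^sup>+ z. ennreal ((z 0 / snorm d z) ^ (2 * k)) \<partial>gauss d)"
      unfolding dir_moment_def by (intro nn_integral_eq_integral[symmetric]) auto
    also have "\<dots> \<le> (\<integral>\<^sup>+ z. ennreal (G z) + ennreal ((1 / 2) ^ k) \<partial>gauss d)"
      using pw by (intro nn_integral_mono_AE) (auto elim!: eventually_mono simp: G_def prod_nonneg ennreal_plus[symmetric] intro!: ennreal_leI simp del: ennreal_plus)
    also have "\<dots> = (\<integral>\<^sup>+ z. ennreal (G z) \<partial>gauss d) + ennreal ((1 / 2) ^ k)"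
      by (subst nn_integral_add) (auto simp: gauss.emeasure_space_1)
    also have "\<dots> \<le> ennreal (c1 * q) + ennreal (c2 * q)"
      using Gle c2[OF k] by (intro add_mono ennreal_leI) (auto simp: q_def)
    also have "\<dots> = ennreal ((c1 + c2) * q)" using c1 c20 q by (simp add: distrib_right)
    finally show ?thesis using c1 c20 q by (simp add: q_def ennreal_le_iff)
  qed
  show ?thesis
  proof (intro exI[of _ "c1 + c2 + 1"] conjI allI impI)
    show "1 \<le> c1 + c2 + 1" using c1 c20 by simp
    fix k :: nat assume "1 \<le> k"
    then have "dir_moment d (2 * k) \<le> (c1 + c2) * (1 / sqrt (real k)) ^ d" by (rule main)
    also have "\<dots> \<le> (c1 + c2 + 1) * (1 / sqrt (real k)) ^ d" by (intro mult_right_mono) auto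
    finally show "dir_moment d (2 * k) \<le> (c1 + c2 + 1) * (1 / sqrt (real k)) ^ d" .
  qed
qed

section \<open>The lower bound\<close>

(* Clipping the argument makes the function continuous, hence measurable, on the whole line. *)
definition arc_kernel :: "real \<Rightarrow> real" where
  "arc_kernel t = 2 / pi * arcsin (max (-1) (min 1 t))"

lemma arc_kernel_eq: "\<bar>t\<bar> \<le> 1 \<Longrightarrow> arc_kernel t = 2 / pi * arcsin t"
  by (simp add: arc_kernel_def abs_le_iff max_absorb2 min_absorb2)

text \<open>Hence the kernel is the expected product of two signs, which is -1 on the wedge and 1
  off it.\<close>

lemma arc_kernel_arccos: "\<bar>t\<bar> \<le> 1 \<Longrightarrow> arc_kernel t = 1 - 2 * (arccos t / pi)"
  by (simp add: arc_kernel_eq arccos_arcsin_eq abs_le_iff diff_divide_distrib)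

lemma measurable_arc_kernel [measurable]: "arc_kernel \<in> borel_measurable borel"
  unfolding arc_kernel_def[abs_def]
  by (intro borel_measurable_continuous_onI continuous_intros continuous_on_arcsin) auto

lemma abs_arc_kernel_le: "\<bar>arc_kernel t\<bar> \<le> 1"
proof -
  define u where "u = max (-1) (min 1 t)"
  have "-1 \<le> u" "u \<le> 1" by (auto simp: u_def)
  then have "\<bar>arcsin u\<bar> \<le> pi / 2" using arcsin_bounded[of u] by linarith
  then show ?thesis by (simp add: arc_kernel_def u_def[symmetric] abs_mult field_simps)
qed

section \<open>Energy difference as a mean square discrepancy\<close>

definition sign_pair :: "nat \<Rightarrow> (nat \<Rightarrow> real) \<Rightarrow> (nat \<Rightarrow> real) \<Rightarrow> real" where
  "sign_pair d x y = real_of_int (sgn_plus (sdot d x y))"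

lemma sign_pair_commute: "sign_pair d x y = sign_pair d y x"
  by (simp add: sign_pair_def sdot_commute)

lemma abs_sign_pair [simp]: "\<bar>sign_pair d x y\<bar> = 1"
  by (simp add: sign_pair_def sgn_plus_def)

lemma sign_pair_unit_direction: "snorm d z \<noteq> 0 \<Longrightarrow> sign_pair d (unit_direction d z) x = sign_pair d z x"
  by (simp add: sign_pair_def sgn_plus_unit_direction)

lemma measurable_sign_pair [measurable (raw)]:
  assumes "\<And>i. i \<le> d \<Longrightarrow> (\<lambda>x. f x i) \<in> borel_measurable M" "\<And>i. i \<le> d \<Longrightarrow> (\<lambda>x. g x i) \<in> borel_measurable M"
  shows "(\<lambda>x. sign_pair d (f x) (g x)) \<in> borel_measurable M"
proof -
  have [measurable]: "(\<lambda>x. sdot d (f x) (g x)) \<in> borel_measurable M" by (intro measurable_sdot assms)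
  show ?thesis unfolding sign_pair_def sgn_plus_def by measurable
qed

lemma integral_sign_pair:
  assumes d: "d \<ge> 2" and v: "sdot d v v = 1" and w: "snorm d w \<noteq> 0"
  shows "(\<integral>x. sign_pair d x v * sign_pair d x w \<partial>gauss d) = arc_kernel (sdot d w v / snorm d w)"
proof -
  define u where "u = unit_direction d w"
  have u: "sdot d u u = 1" using unit_direction_in_sphere[OF w] by (simp add: u_def unit_sphere_iff)
  have vu: "sdot d v u = sdot d w v / snorm d w" unfolding u_def by (subst sdot_commute) (rule sdot_unit_direction)
  have "sign_pair d x w = sign_pair d x u" for x
    unfolding u_def by (subst (1 2) sign_pair_commute) (simp add: sign_pair_unit_direction w)
  then have "(\<integral>x. sign_pair d x v * sign_pair d x w \<partial>gauss d) = (\<integral>x. 1 - 2 * indicator (wedge d v u) x \<partial>gauss d)"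
    by (intro Bochner_Integration.integral_cong refl) (auto simp: sign_pair_def wedge_def sgn_plus_def)
  also have "\<dots> = 1 - 2 * measure (gauss d) (wedge d v u)"
    by (subst Bochner_Integration.integral_diff) (auto simp: gauss.prob_space gauss.emeasure_eq_measure less_top[symmetric] wedge_def)
  also have "\<dots> = arc_kernel (sdot d v u)"
    unfolding measure_wedge[OF d v u] geo_dist_def using sdot_unit_bounds[OF v u] by (subst arc_kernel_arccos) (auto simp: abs_le_iff)
  finally show ?thesis by (simp add: vu)
qed

text \<open>The energy of the uniform measure for the squared kernel, again with one point
  fixed.\<close>

definition arc_energy :: "nat \<Rightarrow> real" where
  "arc_energy d = (\<integral>z. (arc_kernel (z 0 / snorm d z))\<^sup>2 \<partial>gauss d)"

lemma integral_arc_kernel_sq: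
  assumes d: "d \<ge> 2" and x: "sdot d x x = 1"
  shows "(\<integral>z. (arc_kernel (sdot d z x / snorm d z))\<^sup>2 \<partial>gauss d) = arc_energy d"
proof -
  have "(\<integral>z. (\<lambda>p. (arc_kernel (fst p / sqrt (snd (snd p))))\<^sup>2) (sdot d z x, sdot d z x, sdot d z z) \<partial>gauss d) =
    (\<integral>z. (\<lambda>p. (arc_kernel (fst p / sqrt (snd (snd p))))\<^sup>2) (sdot d z (plane_vec 1 0), sdot d z (plane_vec 1 0), sdot d z z) \<partial>gauss d)"
    using d x sdot_plane_unit[of d] by (intro gauss_integral_gram_eq) auto
  then show ?thesis using d by (simp add: arc_energy_def snorm_def sdot_plane_vec)
qed

interpretation gauss_pair: pair_prob_space "gauss d" "gauss d" for d
  by unfold_locales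

lemma integrable_gauss_pair:
  fixes f :: "_ \<Rightarrow> real"
  assumes "f \<in> borel_measurable (gauss d \<Otimes>\<^sub>M gauss d)" "\<And>p. \<bar>f p\<bar> \<le> B"
  shows "integrable (gauss d \<Otimes>\<^sub>M gauss d) f"
  using assms by (intro gauss_pair.P.integrable_const_bound[where B=B]) auto

lemma integral_swap_sign_pair:
  fixes p q :: "(nat \<Rightarrow> real) \<Rightarrow> real"
  assumes [measurable]: "p \<in> borel_measurable (gauss d)" "q \<in> borel_measurable (gauss d)"
    and b: "\<And>x. \<bar>p x\<bar> \<le> 1" "\<And>x. \<bar>q x\<bar> \<le> 1"
  shows "(\<integral>x. p x * (\<integral>w. sign_pair d x w * q w \<partial>gauss d) \<partial>gauss d) =
         (\<integral>w. q w * (\<integral>x. p x * sign_pair d x w \<partial>gauss d) \<partial>gauss d)"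
proof -
  have m: "(\<lambda>(x, w). p x * (sign_pair d x w * q w)) \<in> borel_measurable (gauss d \<Otimes>\<^sub>M gauss d)"
    by measurable
  have "\<bar>case y of (x, w) \<Rightarrow> p x * (sign_pair d x w * q w)\<bar> \<le> 1" for y
    using b mult_mono[OF b(1)[of "fst y"] b(2)[of "snd y"]] by (auto simp: abs_mult split: prod.split)
  then have i: "integrable (gauss d \<Otimes>\<^sub>M gauss d) (\<lambda>(x, w). p x * (sign_pair d x w * q w))"
    using m by (intro integrable_gauss_pair) auto
  have "(\<integral>x. p x * (\<integral>w. sign_pair d x w * q w \<partial>gauss d) \<partial>gauss d) = (\<integral>x. \<integral>w. p x * (sign_pair d x w * q w) \<partial>gauss d \<partial>gauss d)"
    by simp
  also have "\<dots> = (\<integral>w. \<integral>x. p x * (sign_pair d x w * q w) \<partial>gauss d \<partial>gauss d)"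
    by (rule gauss_pair.Fubini_integral[OF i, symmetric])
  also have "\<dots> = (\<integral>w. \<integral>x. q w * (p x * sign_pair d x w) \<partial>gauss d \<partial>gauss d)"
    by (intro Bochner_Integration.integral_cong refl) (simp add: mult_ac)
  finally show ?thesis by simp
qed

definition cos_angle :: "nat \<Rightarrow> (nat \<Rightarrow> real) \<Rightarrow> (nat \<Rightarrow> real) \<Rightarrow> real" where
  "cos_angle d x y = sdot d x y / (snorm d x * snorm d y)"

lemma integral_sign_pair_sign_pair:
  assumes d: "d \<ge> 2" and x: "snorm d x \<noteq> 0" and y: "snorm d y \<noteq> 0"
  shows "(\<integral>w. sign_pair d w x * sign_pair d w y \<partial>gauss d) = arc_kernel (cos_angle d x y)"
proof -
  have u: "sdot d (unit_direction d x) (unit_direction d x) = 1" using unit_direction_in_sphere[OF x] by (simp add: unit_sphere_iff)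
  have "sign_pair d w x = sign_pair d w (unit_direction d x)" for w
    by (subst (1 2) sign_pair_commute) (simp add: sign_pair_unit_direction x)
  then have "(\<integral>w. sign_pair d w x * sign_pair d w y \<partial>gauss d) = arc_kernel (sdot d y (unit_direction d x) / snorm d y)"
    using integral_sign_pair[OF d u y] by simp
  also have "sdot d y (unit_direction d x) / snorm d y = cos_angle d x y"
    by (simp add: sdot_commute[of d y "unit_direction d x"] sdot_unit_direction cos_angle_def)
  finally show ?thesis .
qed

text \<open>Write the kernel as the integral over w of sign(x.w) sign(y.w). By Fubini the double
  integral becomes the integral of H(w)^2, where H(w) is the kernel at the cosine of the angle
  between v and w.\<close>

lemma integral_pair_cross:
  assumes d: "d \<ge> 2" and v: "sdot d v v = 1"
  shows "(\<integral>x. \<integral>y. sign_pair d x v * sign_pair d y v * arc_kernel (cos_angle d x y) \<partial>gauss d \<partial>gauss d) = arc_energy d"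
proof -
  define a where "a x = sign_pair d x v" for x
  define H where "H w = (\<integral>y. a y * sign_pair d y w \<partial>gauss d)" for w
  have am [measurable]: "a \<in> borel_measurable (gauss d)" unfolding a_def by measurable
  have a1: "\<bar>a x\<bar> \<le> 1" for x by (simp add: a_def)
  have Hm [measurable]: "H \<in> borel_measurable (gauss d)" unfolding H_def by measurable
  have HB: "H w = arc_kernel (sdot d w v / snorm d w)" if "snorm d w \<noteq> 0" for w
    using integral_sign_pair[OF d v that] by (simp add: H_def a_def)
  have H1: "\<bar>H w\<bar> \<le> 1" for w
  proof -
    have "\<bar>H w\<bar> \<le> (\<integral>y. \<bar>a y * sign_pair d y w\<bar> \<partial>gauss d)" unfolding H_def by (rule integral_abs_bound)
    also have "\<dots> = (\<integral>y. 1 \<partial>gauss d)" by (intro Bochner_Integration.integral_cong refl) (simp add: a_def abs_mult)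
    finally show ?thesis by (simp add: gauss.prob_space)
  qed
  have inner: "(\<integral>y. a x * a y * arc_kernel (cos_angle d x y) \<partial>gauss d) = a x * (\<integral>w. sign_pair d x w * H w \<partial>gauss d)"
    if x: "snorm d x \<noteq> 0" for x
  proof -
    have "(\<integral>y. a x * a y * arc_kernel (cos_angle d x y) \<partial>gauss d) = (\<integral>y. a x * (a y * (\<integral>w. sign_pair d y w * sign_pair d x w \<partial>gauss d)) \<partial>gauss d)"
    proof (rule integral_cong_AE)
      show "(\<lambda>y. a x * a y * arc_kernel (cos_angle d x y)) \<in> borel_measurable (gauss d)" unfolding cos_angle_def by measurable
      show "(\<lambda>y. a x * (a y * (\<integral>w. sign_pair d y w * sign_pair d x w \<partial>gauss d))) \<in> borel_measurable (gauss d)" by measurable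
      show "AE y in gauss d. a x * a y * arc_kernel (cos_angle d x y) = a x * (a y * (\<integral>w. sign_pair d y w * sign_pair d x w \<partial>gauss d))"
        using AE_snorm_nonzero[OF d]
      proof eventually_elim
        case (elim y)
        have "(\<integral>w. sign_pair d y w * sign_pair d x w \<partial>gauss d) = (\<integral>w. sign_pair d w x * sign_pair d w y \<partial>gauss d)"
          by (simp add: sign_pair_commute[of d y] sign_pair_commute[of d x] mult.commute)
        then show ?case using integral_sign_pair_sign_pair[OF d x elim] by simp
      qed
    qed
    also have "\<dots> = a x * (\<integral>y. a y * (\<integral>w. sign_pair d y w * sign_pair d x w \<partial>gauss d) \<partial>gauss d)" by simp
    also have "(\<integral>y. a y * (\<integral>w. sign_pair d y w * sign_pair d x w \<partial>gauss d) \<partial>gauss d) = (\<integral>w. sign_pair d x w * H w \<partial>gauss d)"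
      unfolding H_def by (rule integral_swap_sign_pair) (use a1 in auto)
    finally show ?thesis .
  qed
  have "(\<integral>x. \<integral>y. a x * a y * arc_kernel (cos_angle d x y) \<partial>gauss d \<partial>gauss d) = (\<integral>x. a x * (\<integral>w. sign_pair d x w * H w \<partial>gauss d) \<partial>gauss d)"
  proof (rule integral_cong_AE)
    show "(\<lambda>x. \<integral>y. a x * a y * arc_kernel (cos_angle d x y) \<partial>gauss d) \<in> borel_measurable (gauss d)" unfolding cos_angle_def by measurable
    show "(\<lambda>x. a x * (\<integral>w. sign_pair d x w * H w \<partial>gauss d)) \<in> borel_measurable (gauss d)" by measurable
    show "AE x in gauss d. (\<integral>y. a x * a y * arc_kernel (cos_angle d x y) \<partial>gauss d) = a x * (\<integral>w. sign_pair d x w * H w \<partial>gauss d)"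
      using AE_snorm_nonzero[OF d] by eventually_elim (rule inner)
  qed
  also have "\<dots> = (\<integral>w. H w * (\<integral>x. a x * sign_pair d x w \<partial>gauss d) \<partial>gauss d)"
    by (rule integral_swap_sign_pair) (use a1 H1 in auto)
  also have "\<dots> = (\<integral>w. (H w)\<^sup>2 \<partial>gauss d)" by (simp add: H_def[symmetric] power2_eq_square)
  also have "\<dots> = (\<integral>w. (arc_kernel (sdot d w v / snorm d w))\<^sup>2 \<partial>gauss d)"
  proof (rule integral_cong_AE)
    show "AE w in gauss d. (H w)\<^sup>2 = (arc_kernel (sdot d w v / snorm d w))\<^sup>2"
      using AE_snorm_nonzero[OF d] by eventually_elim (simp add: HB)
  qed measurable
  finally show ?thesis by (simp add: a_def integral_arc_kernel_sq[OF d v])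
qed

text \<open>Let F = 1 - 2 \<open>hamming_dist\<close> and h = 1 - 2 \<open>geo_dist\<close>,
  evaluated at the directions of x and y. Then F - h is -2 times the discrepancy, so its mean square
  is at most 4 \<delta>^2. Expanding it, the mean of F^2 is the energy of the points, while those of
  F h and h^2 are both \<open>arc_energy d\<close>.\<close>

proposition arc_energy_discrepancy:
  assumes d: "d \<ge> 2" and N: "N \<ge> 1" and z: "\<And>j. j \<in> {1..N} \<Longrightarrow> z j \<in> unit_sphere d"
    and bound: "\<And>x y. x \<in> unit_sphere d \<Longrightarrow> y \<in> unit_sphere d \<Longrightarrow>
      \<bar>hamming_dist N (sign_linear_map d N z x) (sign_linear_map d N z y) - geo_dist d x y\<bar> \<le> \<delta>"
  shows "(\<Sum>j\<in>{1..N}. \<Sum>l\<in>{1..N}. (arc_kernel (sdot d (z j) (z l)))\<^sup>2) / (real N)\<^sup>2 - arc_energy d \<le> 4 * \<delta>\<^sup>2"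
proof -
  let ?P = "gauss d \<Otimes>\<^sub>M gauss d"
  have z1: "sdot d (z j) (z j) = 1" if "j \<in> {1..N}" for j using z[OF that] by (simp add: unit_sphere_iff)
  define F where "F x y = (\<Sum>j\<in>{1..N}. sign_pair d x (z j) * sign_pair d y (z j)) / real N" for x y
  define h where "h x y = arc_kernel (cos_angle d x y)" for x y
  have Fm [measurable]: "(\<lambda>p. F (fst p) (snd p)) \<in> borel_measurable ?P" unfolding F_def by measurable
  have hm [measurable]: "(\<lambda>p. h (fst p) (snd p)) \<in> borel_measurable ?P" unfolding h_def cos_angle_def by measurable
  have F1: "\<bar>F x y\<bar> \<le> 1" for x y
  proof -
    have "\<bar>\<Sum>j\<in>{1..N}. sign_pair d x (z j) * sign_pair d y (z j)\<bar> \<le> (\<Sum>j\<in>{1..N}. \<bar>sign_pair d x (z j) * sign_pair d y (z j)\<bar>)" by (rule sum_abs)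
    also have "\<dots> = real N" by (simp add: abs_mult)
    finally show ?thesis using N by (simp add: F_def)
  qed
  have h1: "\<bar>h x y\<bar> \<le> 1" for x y by (simp add: h_def abs_arc_kernel_le)
  have prod1: "\<bar>a * b\<bar> \<le> 1" if "\<bar>a\<bar> \<le> 1" "\<bar>b\<bar> \<le> 1" for a b :: real
    using mult_mono[OF that] by (simp add: abs_mult)
  have iFF: "integrable ?P (\<lambda>p. F (fst p) (snd p) * F (fst p) (snd p))"
    and iFh: "integrable ?P (\<lambda>p. F (fst p) (snd p) * h (fst p) (snd p))"
    and ihh: "integrable ?P (\<lambda>p. h (fst p) (snd p) * h (fst p) (snd p))"
    by (rule integrable_gauss_pair[where B=1], measurable, intro prod1 F1 h1)+
  have FF: "(\<integral>p. F (fst p) (snd p) * F (fst p) (snd p) \<partial>?P) = (\<Sum>j\<in>{1..N}. \<Sum>l\<in>{1..N}. (arc_kernel (sdot d (z j) (z l)))\<^sup>2) / (real N)\<^sup>2"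
  proof -
    \<comment> \<open>Each product in F^2 factors into a function of x and the same function of y,
      which is why the kernel appears squared.\<close>
    define g where "g j l x = sign_pair d x (z j) * sign_pair d x (z l)" for j l x
    have gi: "(\<integral>x. g j l x \<partial>gauss d) = arc_kernel (sdot d (z j) (z l))" if "j \<in> {1..N}" "l \<in> {1..N}" for j l
    proof -
      have "snorm d (z l) = 1" using z1[OF that(2)] by (simp add: snorm_def)
      then show ?thesis using integral_sign_pair[OF d z1[OF that(1)], of "z l"] by (simp add: g_def sdot_commute)
    qed
    have gb: "\<bar>g j l x\<bar> \<le> 1" for j l x by (simp add: g_def abs_mult)
    have gm [measurable]: "g j l \<in> borel_measurable (gauss d)" for j l unfolding g_def by measurable
    have ip: "integrable ?P (\<lambda>p. g j l (fst p) * g j l (snd p))" for j l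
      by (rule integrable_gauss_pair[where B=1]) (measurable, intro prod1 gb)
    have gg: "(\<integral>p. g j l (fst p) * g j l (snd p) \<partial>?P) = (arc_kernel (sdot d (z j) (z l)))\<^sup>2" if "j \<in> {1..N}" "l \<in> {1..N}" for j l
      using gauss_pair.integral_fst'[OF ip[of j l]] by (simp add: gi[OF that] power2_eq_square)
    have "F (fst p) (snd p) * F (fst p) (snd p) = (\<Sum>j\<in>{1..N}. \<Sum>l\<in>{1..N}. g j l (fst p) * g j l (snd p)) / (real N)\<^sup>2" for p
      unfolding F_def by (simp add: power2_eq_square sum_product g_def mult_ac)
    then have "(\<integral>p. F (fst p) (snd p) * F (fst p) (snd p) \<partial>?P) = (\<Sum>j\<in>{1..N}. \<Sum>l\<in>{1..N}. \<integral>p. g j l (fst p) * g j l (snd p) \<partial>?P) / (real N)\<^sup>2"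
      using ip by (simp add: Bochner_Integration.integral_sum)
    also have "\<dots> = (\<Sum>j\<in>{1..N}. \<Sum>l\<in>{1..N}. (arc_kernel (sdot d (z j) (z l)))\<^sup>2) / (real N)\<^sup>2"
      by (intro arg_cong2[where f="(/)"] sum.cong refl gg)
    finally show ?thesis .
  qed
  have Fh: "(\<integral>p. F (fst p) (snd p) * h (fst p) (snd p) \<partial>?P) = arc_energy d"
  proof -
    have ip: "integrable ?P (\<lambda>p. sign_pair d (fst p) (z j) * sign_pair d (snd p) (z j) * h (fst p) (snd p))" for j
      by (rule integrable_gauss_pair[where B=1]) (measurable, intro prod1 h1, simp_all)
    have e: "(\<integral>p. sign_pair d (fst p) (z j) * sign_pair d (snd p) (z j) * h (fst p) (snd p) \<partial>?P) = arc_energy d" if "j \<in> {1..N}" for j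
      using gauss_pair.integral_fst'[OF ip[of j]] integral_pair_cross[OF d z1[OF that]] by (simp add: h_def)
    have "F (fst p) (snd p) * h (fst p) (snd p) = (\<Sum>j\<in>{1..N}. sign_pair d (fst p) (z j) * sign_pair d (snd p) (z j) * h (fst p) (snd p)) / real N" for p
      unfolding F_def by (simp add: sum_distrib_right)
    then have "(\<integral>p. F (fst p) (snd p) * h (fst p) (snd p) \<partial>?P) = (\<Sum>j\<in>{1..N}. \<integral>p. sign_pair d (fst p) (z j) * sign_pair d (snd p) (z j) * h (fst p) (snd p) \<partial>?P) / real N"
      using ip by (simp add: Bochner_Integration.integral_sum)
    also have "\<dots> = (\<Sum>j\<in>{1..N}. arc_energy d) / real N" by (intro arg_cong2[where f="(/)"] sum.cong refl e)
    finally show ?thesis using N by simp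
  qed
  have hh: "(\<integral>p. h (fst p) (snd p) * h (fst p) (snd p) \<partial>?P) = arc_energy d"
  proof -
    have inner: "(\<integral>y. h x y * h x y \<partial>gauss d) = arc_energy d" if x: "snorm d x \<noteq> 0" for x
    proof -
      have u: "sdot d (unit_direction d x) (unit_direction d x) = 1" using unit_direction_in_sphere[OF x] by (simp add: unit_sphere_iff)
      have "cos_angle d x y = sdot d y (unit_direction d x) / snorm d y" for y
        by (simp add: sdot_commute[of d y "unit_direction d x"] sdot_unit_direction cos_angle_def)
      then show ?thesis using integral_arc_kernel_sq[OF d u] by (simp add: h_def power2_eq_square)
    qed
    have "(\<integral>p. h (fst p) (snd p) * h (fst p) (snd p) \<partial>?P) = (\<integral>x. \<integral>y. h x y * h x y \<partial>gauss d \<partial>gauss d)"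
      using gauss_pair.integral_fst'[OF ihh] by simp
    also have "\<dots> = (\<integral>x. arc_energy d \<partial>gauss d)"
    proof (rule integral_cong_AE)
      show "AE x in gauss d. (\<integral>y. h x y * h x y \<partial>gauss d) = arc_energy d"
        using AE_snorm_nonzero[OF d] by eventually_elim (rule inner)
      show "(\<lambda>x. \<integral>y. h x y * h x y \<partial>gauss d) \<in> borel_measurable (gauss d)" unfolding h_def cos_angle_def by measurable
    qed simp
    finally show ?thesis by (simp add: gauss.prob_space)
  qed
  have close: "(F x y - h x y)\<^sup>2 \<le> 4 * \<delta>\<^sup>2" if x: "snorm d x \<noteq> 0" and y: "snorm d y \<noteq> 0" for x y
  proof -
    define x' where "x' = unit_direction d x"
    define y' where "y' = unit_direction d y"
    have xs: "x' \<in> unit_sphere d" and ys: "y' \<in> unit_sphere d" using unit_direction_in_sphere x y by (auto simp: x'_def y'_def)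
    have x1: "sdot d x' x' = 1" and y1: "sdot d y' y' = 1" using xs ys by (auto simp: unit_sphere_iff)
    have "sdot d x' y' = sdot d x y / snorm d x / snorm d y"
      unfolding x'_def y'_def sdot_unit_direction sdot_commute[of d x] by simp
    then have c: "cos_angle d x y = sdot d x' y'" by (simp add: cos_angle_def)
    have hg: "h x y = 1 - 2 * geo_dist d x' y'"
      unfolding h_def c geo_dist_def using sdot_unit_bounds[OF x1 y1] by (subst arc_kernel_arccos) (auto simp: abs_le_iff)
    define s where "s = {j \<in> {1..N}. sgn_plus (sdot d (z j) x') \<noteq> sgn_plus (sdot d (z j) y')}"
    have "F x y = (\<Sum>j\<in>{1..N}. 1 - 2 * (if j \<in> s then 1 else 0)) / real N"
      unfolding F_def
    proof (intro arg_cong2[where f="(/)"] sum.cong refl)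
      fix j assume j: "j \<in> {1..N}"
      have "sign_pair d x (z j) = real_of_int (sgn_plus (sdot d (z j) x'))" "sign_pair d y (z j) = real_of_int (sgn_plus (sdot d (z j) y'))"
        using sign_pair_unit_direction[OF x, of "z j"] sign_pair_unit_direction[OF y, of "z j"]
        by (simp_all add: sign_pair_def x'_def y'_def sdot_commute)
      then show "sign_pair d x (z j) * sign_pair d y (z j) = 1 - 2 * (if j \<in> s then 1 else 0)"
        using j by (auto simp: s_def sgn_plus_def)
    qed
    also have "\<dots> = 1 - 2 * (real (card s) / real N)"
    proof -
      have "(\<Sum>j\<in>{1..N}. if j \<in> s then 1 else (0::real)) = real (card ({1..N} \<inter> s))" by (simp add: sum.If_cases)
      also have "{1..N} \<inter> s = s" by (auto simp: s_def)
      finally show ?thesis using N by (simp add: sum_subtractf sum_distrib_left[symmetric] diff_divide_distrib)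
    qed
    also have "real (card s) / real N = hamming_dist N (sign_linear_map d N z x') (sign_linear_map d N z y')"
      unfolding hamming_dist_def s_def by (intro arg_cong2[where f="(/)"] arg_cong[where f=real] arg_cong[where f=card] refl) (auto simp: sign_linear_map_def)
    finally have "F x y - h x y = - 2 * (hamming_dist N (sign_linear_map d N z x') (sign_linear_map d N z y') - geo_dist d x' y')"
      unfolding hg by simp
    then have "(F x y - h x y)\<^sup>2 = 4 * (hamming_dist N (sign_linear_map d N z x') (sign_linear_map d N z y') - geo_dist d x' y')\<^sup>2"
      by (simp only: power_mult_distrib) simp
    also have "\<dots> \<le> 4 * \<delta>\<^sup>2"
      using power_mono[OF bound[OF xs ys] abs_ge_zero, of 2] by simp
    finally show ?thesis .
  qed
  have "(\<integral>p. (F (fst p) (snd p) - h (fst p) (snd p))\<^sup>2 \<partial>?P) \<le> (\<integral>p. 4 * \<delta>\<^sup>2 \<partial>?P)"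
  proof (rule integral_mono_AE)
    have "(\<lambda>p. (F (fst p) (snd p) - h (fst p) (snd p))\<^sup>2) = (\<lambda>p. F (fst p) (snd p) * F (fst p) (snd p) - 2 * (F (fst p) (snd p) * h (fst p) (snd p)) + h (fst p) (snd p) * h (fst p) (snd p))"
      by (simp add: fun_eq_iff power2_eq_square algebra_simps)
    then show "integrable ?P (\<lambda>p. (F (fst p) (snd p) - h (fst p) (snd p))\<^sup>2)" using iFF iFh ihh by simp
    have meas: "{p \<in> space ?P. (F (fst p) (snd p) - h (fst p) (snd p))\<^sup>2 \<le> 4 * \<delta>\<^sup>2} \<in> sets ?P" by measurable
    have "AE x in gauss d. AE y in gauss d. (F x y - h x y)\<^sup>2 \<le> 4 * \<delta>\<^sup>2"
      using AE_snorm_nonzero[OF d]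
    proof eventually_elim
      case (elim x)
      show ?case using AE_snorm_nonzero[OF d] by eventually_elim (rule close[OF elim])
    qed
    then show "AE p in ?P. (F (fst p) (snd p) - h (fst p) (snd p))\<^sup>2 \<le> 4 * \<delta>\<^sup>2"
      using gauss_pair.AE_pair_measure[OF meas] by simp
  qed simp
  also have "\<dots> = 4 * \<delta>\<^sup>2" by (simp add: gauss_pair.P.prob_space)
  also have "(\<integral>p. (F (fst p) (snd p) - h (fst p) (snd p))\<^sup>2 \<partial>?P) =
    (\<integral>p. F (fst p) (snd p) * F (fst p) (snd p) - 2 * (F (fst p) (snd p) * h (fst p) (snd p)) + h (fst p) (snd p) * h (fst p) (snd p) \<partial>?P)"
    by (intro Bochner_Integration.integral_cong refl) (simp add: power2_eq_square algebra_simps)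
  also have "\<dots> = (\<integral>p. F (fst p) (snd p) * F (fst p) (snd p) \<partial>?P) - 2 * (\<integral>p. F (fst p) (snd p) * h (fst p) (snd p) \<partial>?P) + (\<integral>p. h (fst p) (snd p) * h (fst p) (snd p) \<partial>?P)"
    using iFF iFh ihh by simp
  finally show ?thesis unfolding FF Fh hh by simp
qed

section \<open>From the RIP to a bound on N\<close>

lemma hamming_dist_bounds: "0 \<le> hamming_dist N s t" "hamming_dist N s t \<le> 1"
proof -
  have "card {j \<in> {1..N}. s j \<noteq> t j} \<le> card {1..N}" by (intro card_mono) auto
  then show "0 \<le> hamming_dist N s t" "hamming_dist N s t \<le> 1" by (auto simp: hamming_dist_def divide_le_eq_1)
qed

lemma geo_dist_bounds:
  assumes "x \<in> unit_sphere d" "y \<in> unit_sphere d"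
  shows "0 \<le> geo_dist d x y" "geo_dist d x y \<le> 1"
proof -
  have "-1 \<le> sdot d x y" "sdot d x y \<le> 1" using sdot_unit_bounds[of d x y] assms by (auto simp: unit_sphere_iff)
  then show "0 \<le> geo_dist d x y" "geo_dist d x y \<le> 1"
    using arccos_lbound[of "sdot d x y"] arccos_ubound[of "sdot d x y"] by (auto simp: geo_dist_def)
qed

lemma RIP_pointwise:
  assumes R: "RIP d N \<delta> \<phi>" and x: "x \<in> unit_sphere d" and y: "y \<in> unit_sphere d"
  shows "\<bar>hamming_dist N (\<phi> x) (\<phi> y) - geo_dist d x y\<bar> < \<delta>"
proof -
  let ?f = "\<lambda>(x, y). \<bar>hamming_dist N (\<phi> x) (\<phi> y) - geo_dist d x y\<bar>"
  have "bdd_above (?f ` (unit_sphere d \<times> unit_sphere d))"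
  proof (rule bdd_aboveI2[where M=1])
    fix p assume "p \<in> unit_sphere d \<times> unit_sphere d"
    then obtain u v where p: "p = (u, v)" "u \<in> unit_sphere d" "v \<in> unit_sphere d" by auto
    show "?f p \<le> 1"
      using geo_dist_bounds[OF p(2,3)] hamming_dist_bounds[of N "\<phi> u" "\<phi> v"] by (simp add: p(1) abs_le_iff)
  qed
  then have "?f (x, y) \<le> (SUP p \<in> unit_sphere d \<times> unit_sphere d. ?f p)"
    using x y by (intro cSUP_upper) auto
  also have "\<dots> < \<delta>" using R unfolding RIP_def by blast
  finally show ?thesis by simp
qed

text \<open>Termwise integration: as |z_0| \<le> |z|, the terms are dominated by the summable
  coefficients.\<close>

lemma arc_energy_sums:
  assumes d: "d \<ge> 2"
  shows "(\<lambda>k. 4 / pi\<^sup>2 * (arcsin_sq_coeff k * dir_moment d (2 * k + 2))) sums arc_energy d"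
proof -
  define r where "r z = z 0 / snorm d z" for z
  have r1: "\<bar>r z\<bar> \<le> 1" for z
    using abs_dir_le[OF sdot_plane_unit, of d z] d by (simp add: r_def sdot_plane_vec)
  have rm [measurable]: "r \<in> borel_measurable (gauss d)" unfolding r_def by measurable
  let ?f = "\<lambda>k z. 4 / pi\<^sup>2 * (arcsin_sq_coeff k * r z ^ (2 * k + 2))"
  have tb: "norm (?f k z) \<le> 4 / pi\<^sup>2 * arcsin_sq_coeff k" for k z
    using power_le_one[of "\<bar>r z\<bar>" "2 * k + 2"] r1[of z] arcsin_sq_coeff_nonneg[of k]
    by (simp add: abs_mult power_abs mult_left_le divide_right_mono del: power_Suc)
  have fi: "integrable (gauss d) (?f k)" for k
    using tb by (intro gauss.integrable_const_bound[where B="4 / pi\<^sup>2 * arcsin_sq_coeff k"]) auto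
  have sb: "summable (\<lambda>k. 4 / pi\<^sup>2 * arcsin_sq_coeff k)" by (intro summable_mult summable_arcsin_sq_coeff)
  have sf: "summable (\<lambda>k. norm (?f k z))" for z
    using tb by (intro summable_comparison_test'[OF sb]) (auto simp: norm_mult)
  have si: "summable (\<lambda>k. \<integral>z. norm (?f k z) \<partial>gauss d)"
  proof (rule summable_comparison_test'[OF sb])
    fix k :: nat
    have "(\<integral>z. norm (?f k z) \<partial>gauss d) \<le> (\<integral>z. 4 / pi\<^sup>2 * arcsin_sq_coeff k \<partial>gauss d)"
      by (rule integral_mono[OF integrable_norm[OF fi]]) (simp, rule tb)
    also have "\<dots> = 4 / pi\<^sup>2 * arcsin_sq_coeff k" by (simp add: gauss.prob_space)
    finally show "norm (\<integral>z. norm (?f k z) \<partial>gauss d) \<le> 4 / pi\<^sup>2 * arcsin_sq_coeff k"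
      using integral_nonneg_AE[of "\<lambda>z. norm (?f k z)" "gauss d"] by simp
  qed
  have "(\<lambda>k. \<integral>z. ?f k z \<partial>gauss d) sums (\<integral>z. (\<Sum>k. ?f k z) \<partial>gauss d)"
    by (rule sums_integral[OF fi AE_I2[OF sf] si])
  moreover have "(\<integral>z. ?f k z \<partial>gauss d) = 4 / pi\<^sup>2 * (arcsin_sq_coeff k * dir_moment d (2 * k + 2))" for k
    by (simp only: dir_moment_def r_def integral_mult_right_zero)
  moreover have "(\<Sum>k. ?f k z) = (arc_kernel (z 0 / snorm d z))\<^sup>2" for z
  proof -
    have "(\<lambda>k. ?f k z) sums (4 / pi\<^sup>2 * (arcsin (r z))\<^sup>2)" by (intro sums_mult arcsin_sq_sums r1)
    then show ?thesis using r1[of z] by (simp add: sums_iff arc_kernel_eq r_def power_mult_distrib power_divide)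
  qed
  ultimately show ?thesis unfolding arc_energy_def by (simp only:)
qed

text \<open>No term of the series for the gap is negative, so only the block K \<le> k < 2K is kept.
  There half of the diagonal contribution 1/N survives the subtraction of the moment.\<close>

proposition arc_energy_gap:
  assumes d: "d \<ge> 2" and N: "N \<ge> 1" and z: "\<And>j. j \<in> {1..N} \<Longrightarrow> sdot d (z j) (z j) = 1"
    and K: "K \<ge> 1" and mom: "\<And>k. k \<ge> K \<Longrightarrow> dir_moment d (2 * k + 2) \<le> 1 / (2 * real N)"
  shows "(\<Sum>j\<in>{1..N}. \<Sum>l\<in>{1..N}. (arc_kernel (sdot d (z j) (z l)))\<^sup>2) / (real N)\<^sup>2 - arc_energy d
     \<ge> 4 / pi\<^sup>2 * (1 / (40 * (real N * sqrt (real K))))"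
proof -
  define t where "t j l = sdot d (z j) (z l)" for j l
  have t1: "\<bar>t j l\<bar> \<le> 1" if "j \<in> {1..N}" "l \<in> {1..N}" for j l
    using sdot_unit_bounds[OF z[OF that(1)] z[OF that(2)]] by (simp add: t_def abs_le_iff)
  define S where "S k = (\<Sum>j\<in>{1..N}. \<Sum>l\<in>{1..N}. t j l ^ (2 * k + 2)) / (real N)\<^sup>2" for k
  have "(\<lambda>k. (\<Sum>j\<in>{1..N}. \<Sum>l\<in>{1..N}. 4 / pi\<^sup>2 * (arcsin_sq_coeff k * t j l ^ (2 * k + 2))) / (real N)\<^sup>2)
     sums ((\<Sum>j\<in>{1..N}. \<Sum>l\<in>{1..N}. 4 / pi\<^sup>2 * (arcsin (t j l))\<^sup>2) / (real N)\<^sup>2)"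
    by (intro sums_divide sums_sum sums_mult arcsin_sq_sums t1)
  moreover have "(\<Sum>j\<in>{1..N}. \<Sum>l\<in>{1..N}. 4 / pi\<^sup>2 * (arcsin (t j l))\<^sup>2) = (\<Sum>j\<in>{1..N}. \<Sum>l\<in>{1..N}. (arc_kernel (t j l))\<^sup>2)"
    by (intro sum.cong refl) (simp add: arc_kernel_eq t1 power_mult_distrib power_divide)
  moreover have "(\<Sum>j\<in>{1..N}. \<Sum>l\<in>{1..N}. 4 / pi\<^sup>2 * (arcsin_sq_coeff k * t j l ^ (2 * k + 2))) / (real N)\<^sup>2 = 4 / pi\<^sup>2 * (arcsin_sq_coeff k * S k)" for k
    by (simp only: S_def sum_distrib_left times_divide_eq_right)
  ultimately have "(\<lambda>k. 4 / pi\<^sup>2 * (arcsin_sq_coeff k * S k)) sums ((\<Sum>j\<in>{1..N}. \<Sum>l\<in>{1..N}. (arc_kernel (t j l))\<^sup>2) / (real N)\<^sup>2)"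
    by simp
  from sums_diff[OF this arc_energy_sums[OF d]]
  have sums: "(\<lambda>k. 4 / pi\<^sup>2 * (arcsin_sq_coeff k * (S k - dir_moment d (2 * k + 2)))) sums
    ((\<Sum>j\<in>{1..N}. \<Sum>l\<in>{1..N}. (arc_kernel (t j l))\<^sup>2) / (real N)\<^sup>2 - arc_energy d)"
    by (simp add: right_diff_distrib)
  have pos: "S k - dir_moment d (2 * k + 2) \<ge> 0" for k
    using dir_moment_le_average[OF d N z, of "\<lambda>j. j" "2 * k + 2"] by (simp add: S_def t_def)
  have big: "S k - dir_moment d (2 * k + 2) \<ge> 1 / (2 * real N)" if k: "k \<ge> K" for k
  proof -
    \<comment> \<open>The exponent 2k + 2 is even, so dropping the off-diagonal terms only lowers
      the sum.\<close>
    have "real N = (\<Sum>j\<in>{1..N}. t j j ^ (2 * k + 2))" using z by (simp add: t_def)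
    also have "\<dots> \<le> (\<Sum>j\<in>{1..N}. \<Sum>l\<in>{1..N}. t j l ^ (2 * k + 2))"
    proof (intro sum_mono)
      fix j assume j: "j \<in> {1..N}"
      show "t j j ^ (2 * k + 2) \<le> (\<Sum>l\<in>{1..N}. t j l ^ (2 * k + 2))"
        using j by (intro member_le_sum[of j "{1..N}" "\<lambda>l. t j l ^ (2 * k + 2)"]) (auto intro!: zero_le_even_power simp del: power_Suc)
    qed
    finally have "real N / (real N)\<^sup>2 \<le> S k" unfolding S_def by (intro divide_right_mono) auto
    then have "1 / real N \<le> S k" using N by (simp add: power2_eq_square)
    moreover have "1 / real N = 1 / (2 * real N) + 1 / (2 * real N)" using N by simp
    ultimately show ?thesis using mom[OF k] by linarith
  qed
  have "4 / pi\<^sup>2 * (1 / (40 * (real N * sqrt (real K)))) = 4 / pi\<^sup>2 * (1 / (20 * sqrt (real K)) * (1 / (2 * real N)))" by simp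
  also have "\<dots> \<le> 4 / pi\<^sup>2 * ((\<Sum>k\<in>{K..<2*K}. arcsin_sq_coeff k) * (1 / (2 * real N)))"
    using sum_arcsin_sq_coeff_ge[OF K] by (intro mult_left_mono mult_right_mono) auto
  also have "\<dots> = (\<Sum>k\<in>{K..<2*K}. 4 / pi\<^sup>2 * (arcsin_sq_coeff k * (1 / (2 * real N))))"
    by (simp only: sum_distrib_left sum_distrib_right)
  also have "\<dots> \<le> (\<Sum>k\<in>{K..<2*K}. 4 / pi\<^sup>2 * (arcsin_sq_coeff k * (S k - dir_moment d (2 * k + 2))))"
    using big arcsin_sq_coeff_nonneg by (intro sum_mono mult_left_mono) auto
  also have "\<dots> \<le> (\<Sum>k. 4 / pi\<^sup>2 * (arcsin_sq_coeff k * (S k - dir_moment d (2 * k + 2))))"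
    using sums pos arcsin_sq_coeff_nonneg by (intro sum_le_suminf) (auto simp: sums_iff)
  also have "\<dots> = (\<Sum>j\<in>{1..N}. \<Sum>l\<in>{1..N}. (arc_kernel (t j l))\<^sup>2) / (real N)\<^sup>2 - arc_energy d"
    using sums by (simp add: sums_iff)
  finally show ?thesis by (simp add: t_def)
qed

proposition sign_linear_RIP_lower_bound:
  assumes d: "d \<ge> 2"
  shows "\<exists>b>0. \<forall>\<delta> N. 0 < \<delta> \<longrightarrow> \<delta> < 1 \<longrightarrow> sign_linear_RIP d \<delta> N \<longrightarrow> b * \<delta> powr (- 2 + 2 / (real d + 1)) \<le> real N"
proof -
  obtain C where C: "C \<ge> 1" "\<And>k. k \<ge> 1 \<Longrightarrow> dir_moment d (2 * k) \<le> C * (1 / sqrt (real k)) ^ d"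
    using dir_moment_bound[OF d] by blast
  define q where "q = 1 / (1000 * (2 * C) powr (1 / real d))"
  define e where "e = real d / (real d + 1)"
  have q: "q > 0" using C by (simp add: q_def)
  have main: "q powr e * \<delta> powr (- 2 + 2 / (real d + 1)) \<le> real N"
    if \<delta>: "0 < \<delta>" "\<delta> < 1" and R: "sign_linear_RIP d \<delta> N" for \<delta> N
  proof -
    obtain Z z where Z: "Z \<subseteq> unit_sphere d" "bij_betw z {1..N} Z" and RIP: "RIP d N \<delta> (sign_linear_map d N z)"
      using R by (auto simp: sign_linear_RIP_def)
    have zS: "z j \<in> unit_sphere d" if "j \<in> {1..N}" for j using Z that by (auto simp: bij_betw_def)
    \<comment> \<open>For N = 0 division by zero makes \<open>hamming_dist\<close> vanish, and a
      pair of antipodal points then has error 1.\<close>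
    have N1: "N \<ge> 1"
    proof (rule ccontr)
      assume "\<not> N \<ge> 1"
      then have N0: "N = 0" by simp
      define e0 where "e0 c = (\<lambda>i::nat. if i = 0 then c else 0 :: real)" for c
      have s: "sdot d (e0 a) (e0 b) = a * b" for a b
        using sdot_unit_vec[of 0 d "e0 a" b] by (simp add: e0_def)
      have S: "e0 1 \<in> unit_sphere d" "e0 (-1) \<in> unit_sphere d" unfolding unit_sphere_iff s by (auto simp: e0_def)
      have "geo_dist d (e0 1) (e0 (-1)) = 1" by (simp add: geo_dist_def s)
      then show False using RIP_pointwise[OF RIP S] \<delta> by (simp add: N0 hamming_dist_def)
    qed
    have n0: "real N > 0" using N1 by simp
    \<comment> \<open>Chosen so that C / Y^d = 1/(2N): by the moment bound, K \<ge> Y^2 is the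
      threshold beyond which moments are at most half of the diagonal contribution.\<close>
    define Y where "Y = (2 * C * real N) powr (1 / real d)"
    have CN: "2 * C * real N \<ge> 1" using C N1 mult_mono[of 1 "2 * C" 1 "real N"] by auto
    have Y1: "Y \<ge> 1" unfolding Y_def using CN by (intro ge_one_powr_ge_zero) auto
    have Yd: "Y ^ d = 2 * C * real N"
    proof -
      have "Y ^ d = Y powr real d" using Y1 by (simp add: powr_realpow)
      also have "\<dots> = (2 * C * real N) powr 1" unfolding Y_def powr_powr using d by simp
      also have "\<dots> = 2 * C * real N" using CN by (subst powr_one) auto
      finally show ?thesis .
    qed
    define K where "K = nat \<lceil>Y\<^sup>2\<rceil>"
    have Y2: "Y\<^sup>2 \<ge> 1" using Y1 by (simp add: one_le_power)
    have K: "Y\<^sup>2 \<le> real K" "real K \<le> 2 * Y\<^sup>2"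
    proof -
      have "real K = of_int \<lceil>Y\<^sup>2\<rceil>" using Y2 by (simp add: K_def)
      then show "Y\<^sup>2 \<le> real K" "real K \<le> 2 * Y\<^sup>2" using ceiling_correct[of "Y\<^sup>2"] Y2 by linarith+
    qed
    have K1: "K \<ge> 1" using K(1) Y2 by (cases K) auto
    have mom: "dir_moment d (2 * k + 2) \<le> 1 / (2 * real N)" if k: "k \<ge> K" for k
    proof -
      have "Y \<le> sqrt (real K)" using K(1) Y1 by (intro real_le_rsqrt) auto
      also have "\<dots> \<le> sqrt (real (k + 1))" using k by simp
      finally have yk: "Y \<le> sqrt (real (k + 1))" .
      have "dir_moment d (2 * (k + 1)) \<le> C * (1 / sqrt (real (k + 1))) ^ d" by (rule C(2)) simp
      also have "\<dots> \<le> C * (1 / Y) ^ d" using yk Y1 C by (intro mult_left_mono power_mono divide_left_mono) auto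
      also have "\<dots> = 1 / (2 * real N)" using C(1) by (simp add: power_divide Yd)
      finally show ?thesis by simp
    qed
    have "4 / pi\<^sup>2 * (1 / (40 * (real N * sqrt (real K)))) \<le> 4 * \<delta>\<^sup>2"
      using arc_energy_gap[OF d N1 _ K1 mom, of z] arc_energy_discrepancy[OF d N1 zS less_imp_le[OF RIP_pointwise[OF RIP]]] zS
      by (fastforce simp: unit_sphere_iff)
    moreover have "4 / pi\<^sup>2 * (1 / (40 * (real N * sqrt (real K)))) = 4 * (1 / (40 * pi\<^sup>2 * (real N * sqrt (real K))))" by simp
    ultimately have en: "1 / (40 * pi\<^sup>2 * (real N * sqrt (real K))) \<le> \<delta>\<^sup>2" by linarith
    \<comment> \<open>40 * 16 * 3/2 = 960 is rounded up to 1000. Since sqrt K is of order Y, the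
      left side is of order N^(1+1/d), which explains the shape of q.\<close>
    have "40 * pi\<^sup>2 * (real N * sqrt (real K)) \<le> 40 * 4\<^sup>2 * (real N * (3 / 2 * Y))"
    proof (intro mult_mono power_mono)
      have "sqrt (real K) \<le> sqrt (2 * Y\<^sup>2)" using K(2) by simp
      also have "\<dots> = sqrt 2 * Y" using Y1 by (simp add: real_sqrt_mult)
      also have "\<dots> \<le> 3 / 2 * Y" using Y1 by (intro mult_right_mono real_le_lsqrt) (auto simp: power2_eq_square)
      finally show "sqrt (real K) \<le> 3 / 2 * Y" .
    qed (use pi_less_4 Y1 in auto)
    also have "\<dots> \<le> 1000 * (real N * Y)" using n0 Y1 by simp
    finally have "1 / (1000 * (real N * Y)) \<le> 1 / (40 * pi\<^sup>2 * (real N * sqrt (real K)))"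
      using n0 K1 Y1 by (intro divide_left_mono mult_pos_pos) auto
    then have "1 / (1000 * (real N * Y)) \<le> \<delta>\<^sup>2" using en by linarith
    moreover have "real N * Y = (2 * C) powr (1 / real d) * real N powr (1 + 1 / real d)"
      using C n0 by (simp add: Y_def powr_mult powr_add)
    ultimately have "q / real N powr (1 + 1 / real d) \<le> \<delta>\<^sup>2" by (simp add: q_def mult.assoc)
    then have "q / \<delta>\<^sup>2 \<le> real N powr (1 + 1 / real d)" using n0 \<delta> by (simp add: field_simps)
    then have "(q / \<delta>\<^sup>2) powr e \<le> (real N powr (1 + 1 / real d)) powr e"
      using q \<delta> by (intro powr_mono2) (auto simp: e_def)
    also have "\<dots> = real N powr ((1 + 1 / real d) * e)" by (simp add: powr_powr)
    also have "(1 + 1 / real d) * e = 1"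
    proof -
      have "1 + 1 / real d = (real d + 1) / real d" using d by (simp add: add_divide_distrib)
      then show ?thesis using d by (simp add: e_def)
    qed
    also have "real N powr 1 = real N" using n0 by simp
    also have "(q / \<delta>\<^sup>2) powr e = q powr e * \<delta> powr (- 2 + 2 / (real d + 1))"
    proof -
      have "\<delta>\<^sup>2 powr e = \<delta> powr (2 * e)" using \<delta> by (simp add: powr_powr flip: powr_numeral)
      then have "(q / \<delta>\<^sup>2) powr e = q powr e * \<delta> powr (- (2 * e))"
        using q \<delta> by (simp add: powr_divide powr_minus divide_inverse[symmetric])
      moreover have "- (2 * e) = - 2 + 2 / (real d + 1)"
      proof -
        have "e = 1 - 1 / (real d + 1)" by (simp add: e_def field_simps)
        then show ?thesis by simp
      qed
      ultimately show ?thesis by simp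
    qed
    finally show ?thesis .
  qed
  show ?thesis using main q by (intro exI[of _ "q powr e"]) auto
qed

theorem theorem1p22:
  shows "\<exists>(C::real) (b :: nat \<Rightarrow> real). C > 0 \<and> (\<forall>d\<ge>2. b d > 0) \<and>
    (\<forall>(d::nat) (\<delta>::real). d \<ge> 2 \<longrightarrow> 0 < \<delta> \<longrightarrow> \<delta> < 1 \<longrightarrow>
      (\<exists>N. sign_linear_RIP d \<delta> N) \<and>
      b d * \<delta> powr (- 2 + 2 / (real d + 1)) \<le> real (min_N d \<delta>) \<and>
      real (min_N d \<delta>) \<le>
        max (100 * real d)
            (C * real d powr (5 / 2 - 2 / (real d + 1)) * \<delta> powr (- 2 + 2 / (real d + 1)) *
             (1 + ln (real d) + ln (1 / \<delta>)) powr (real d / (real d + 1))))"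
proof -
  \<comment> \<open>The case d < 2 is vacuous and takes b = 1, so that a function b on all
    dimensions can be chosen.\<close>
  have "\<forall>d. \<exists>b>0. d \<ge> 2 \<longrightarrow> (\<forall>\<delta> N. 0 < \<delta> \<longrightarrow> \<delta> < 1 \<longrightarrow> sign_linear_RIP d \<delta> N \<longrightarrow> b * \<delta> powr (- 2 + 2 / (real d + 1)) \<le> real N)"
    using sign_linear_RIP_lower_bound by (metis zero_less_one)
  then obtain b where b: "\<And>d. b d > 0"
    and lower: "\<And>d \<delta> N. d \<ge> 2 \<Longrightarrow> 0 < \<delta> \<Longrightarrow> \<delta> < 1 \<Longrightarrow> sign_linear_RIP d \<delta> N \<Longrightarrow> b d * \<delta> powr (- 2 + 2 / (real d + 1)) \<le> real N"
    by metis
  have "(\<exists>N. sign_linear_RIP d \<delta> N) \<and>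
      b d * \<delta> powr (- 2 + 2 / (real d + 1)) \<le> real (min_N d \<delta>) \<and>
      real (min_N d \<delta>) \<le>
        max (100 * real d)
            (exp 24 * real d powr (5 / 2 - 2 / (real d + 1)) * \<delta> powr (- 2 + 2 / (real d + 1)) *
             (1 + ln (real d) + ln (1 / \<delta>)) powr (real d / (real d + 1)))"
    if d: "d \<ge> 2" and \<delta>: "0 < \<delta>" "\<delta> < 1" for d \<delta>
  proof -
    obtain N where N: "N \<ge> 1" "real N \<le> exp 24 * real d powr (5 / 2 - 2 / (real d + 1)) * \<delta> powr (- 2 + 2 / (real d + 1)) *
             (1 + ln (real d) + ln (1 / \<delta>)) powr (real d / (real d + 1))"
      and small: "2 * ((2 * (real d + 1) / (\<delta> / (32 * real d * real N)) + 3) ^ (d + 1))\<^sup>2 *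
       (2 * exp (- (\<delta>\<^sup>2 * real N * real N powr (1 / real d)) / (12000 * (real d * sqrt (real d))))) < 1"
      using upper_bound_arithmetic[OF d \<delta>] by blast
    have R: "sign_linear_RIP d \<delta> N" by (rule sign_linear_RIP_of_bound[OF d N(1) \<delta> small])
    have "min_N d \<delta> \<le> N" unfolding min_N_def using R by (rule Least_le)
    moreover have "sign_linear_RIP d \<delta> (min_N d \<delta>)" unfolding min_N_def using R by (rule LeastI)
    ultimately show ?thesis using R lower[OF d \<delta>] N(2) by auto
  qed
  then show ?thesis using b by (intro exI[of _ "exp 24"] exI[of _ b]) auto
qed

end
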